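(* Let $\alpha$ be a positive irrational and let $\operatorname{Aut}(\mathcal A_\alpha)$ denote the group of isometric automorphisms of $\mathcal A_\alpha$. If $\alpha$ is not a quadratic irrational, then $\operatorname{Aut}(\mathcal A_\alpha)=\{\pi(\mathbf c):\mathbf c\in\mathbb T^2\}\cong\mathbb T^2$. If $\alpha$ is a quadratic irrational, then $\operatorname{Aut}(\mathcal A_\alpha)=\{\pi(\mathbf c)\pi(A)^k:\mathbf c\in\mathbb T^2,k\in\mathbb Z\}\cong\mathbb T^2\rtimes_{\psi_A}\mathbb Z$ for some non-identity matrix $A\in GL(2,\mathbb Z)$.
   Context: For $f\in C(\mathbb T^2)$ (with $\mathbb T$ the unit circle), the Fourier transform is $\hat f(m,n)=\int_{\mathbb T^2} f(e^{is},e^{it})e^{-i(ms+nt)}\,d\mu$, $\mu$ normalized Lebesgue measure. For a positive irrational $\alpha$, $\mathcal A_\alpha=\{f\in C(\mathbb T^2): \hat f(m,n)=0 \text{ whenever } m+\alpha n<0\}$, a uniform algebra with the sup norm on $\mathbb T^2$. For $(c_1,c_2)\in\mathbb T^2$, $\pi((c_1,c_2))(f)(z,w)=f(c_1z,c_2w)$. For $A=\begin{bmatrix} a&b\\ c&d\end{bmatrix}\in GL(2,\mathbb Z)$, $\pi(A)(f)=f\circ\varphi$ with $\varphi(z,w)=(z^aw^b,z^cw^d)$, and $\psi_A:\mathbb T^2\to\mathbb T^2$ is $\psi_A(c_1,c_2)=(c_1^ac_2^b,c_1^cc_2^d)$. The semidirect product $\mathbb T^2\rtimes_{\psi_A}\mathbb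 Z$ has multiplication $(\mathbf c,m)\cdot(\mathbf d,n)=(\mathbf c\,\psi_A^m(\mathbf d),m+n)$. *)

theory Defs
  imports "HOL-Analysis.Analysis"
begin

definition T2 :: "(complex \<times> complex) set" where
  "T2 = sphere 0 1 \<times> sphere 0 1"

definition CT2 :: "(complex \<times> complex \<Rightarrow> complex) set" where
  "CT2 = {f. continuous_on T2 f \<and> (\<forall>p. p \<notin> T2 \<longrightarrow> f p = 0)}"

definition fourier :: "(complex \<times> complex \<Rightarrow> complex) \<Rightarrow> int \<Rightarrow> int \<Rightarrow> complex" where
  "fourier f m n = integral (cbox (0,0) (2*pi, 2*pi))
      (\<lambda>(s,t). f (cis s, cis t) * exp (- (\<i> * (of_int m * of_real s + of_int n * of_real t))))
      / (4 * of_real (pi^2))"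

definition Aalpha :: "real \<Rightarrow> (complex \<times> complex \<Rightarrow> complex) set" where
  "Aalpha \<alpha> = {f \<in> CT2. \<forall>m n. real_of_int m + \<alpha> * real_of_int n < 0 \<longrightarrow> fourier f m n = 0}"

definition supnorm :: "(complex \<times> complex \<Rightarrow> complex) \<Rightarrow> real" where
  "supnorm f = (SUP p\<in>T2. norm (f p))"

definition Aut :: "real \<Rightarrow> ((complex \<times> complex \<Rightarrow> complex) \<Rightarrow> (complex \<times> complex \<Rightarrow> complex)) set" where
  "Aut \<alpha> = {\<Phi>. \<Phi> \<in> extensional (Aalpha \<alpha>) \<and> bij_betw \<Phi> (Aalpha \<alpha>) (Aalpha \<alpha>)
     \<and> (\<forall>f\<in>Aalpha \<alpha>. \<forall>g\<in>Aalpha \<alpha>. \<Phi> (\<lambda>p. f p + g p) = (\<lambda>p. \<Phi> f p + \<Phi> g p))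
     \<and> (\<forall>f\<in>Aalpha \<alpha>. \<forall>a::complex. \<Phi> (\<lambda>p. a * f p) = (\<lambda>p. a * \<Phi> f p))
     \<and> (\<forall>f\<in>Aalpha \<alpha>. \<forall>g\<in>Aalpha \<alpha>. \<Phi> (\<lambda>p. f p * g p) = (\<lambda>p. \<Phi> f p * \<Phi> g p))
     \<and> (\<forall>f\<in>Aalpha \<alpha>. supnorm (\<Phi> f) = supnorm f)}"

definition pi_c :: "complex \<times> complex \<Rightarrow> (complex \<times> complex \<Rightarrow> complex) \<Rightarrow> (complex \<times> complex \<Rightarrow> complex)" where
  "pi_c c f = (\<lambda>(z,w). if (z,w) \<in> T2 then f (fst c * z, snd c * w) else 0)"

definition mat_map :: "int^2^2 \<Rightarrow> complex \<times> complex \<Rightarrow> complex \<times> complex" where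
  "mat_map A p = (fst p powi (A$1$1) * snd p powi (A$1$2), fst p powi (A$2$1) * snd p powi (A$2$2))"

definition GL2Z :: "(int^2^2) set" where
  "GL2Z = {A. det A = 1 \<or> det A = -1}"

definition pi_A :: "int^2^2 \<Rightarrow> (complex \<times> complex \<Rightarrow> complex) \<Rightarrow> (complex \<times> complex \<Rightarrow> complex)" where
  "pi_A A f = (\<lambda>p. if p \<in> T2 then f (mat_map A p) else 0)"

definition psi_A :: "int^2^2 \<Rightarrow> complex \<times> complex \<Rightarrow> complex \<times> complex" where
  "psi_A A = mat_map A"

definition zpow :: "'a set \<Rightarrow> ('a \<Rightarrow> 'a) \<Rightarrow> int \<Rightarrow> 'a \<Rightarrow> 'a" where
  "zpow S g k = (if 0 \<le> k then g ^^ nat k else (inv_into S g) ^^ nat (- k))"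

definition sd_mult :: "int^2^2 \<Rightarrow> (complex \<times> complex) \<times> int \<Rightarrow> (complex \<times> complex) \<times> int \<Rightarrow> (complex \<times> complex) \<times> int" where
  "sd_mult A x y = (let (c,m) = x; (d,n) = y; e = zpow T2 (psi_A A) m d
                    in ((fst c * fst e, snd c * snd e), m + n))"

definition quadratic_irrational :: "real \<Rightarrow> bool" where
  "quadratic_irrational x \<longleftrightarrow> x \<notin> \<rat> \<and>
     (\<exists>a b c :: int. a \<noteq> 0 \<and> of_int a * x^2 + of_int b * x + of_int c = 0)"

end

theory Submission
  imports Defs "HOL-Complex_Analysis.Conformal_Mappings"
begin

text \<open>
  Order the exponents \<open>(m, n)\<close> by their weight \<open>m + \<alpha> n\<close>. By Fejer's theorem the algebra is the uniform closure
  of the characters of non-negative weight, and every \<open>f\<close> in it extends along the leaf \<open>t \<mapsto> (exp (i t), exp (i \<alpha> t))\<close>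
  to a bounded holomorphic function on the upper half-plane. A contractive multiplicative functional either
  kills all characters of positive weight, and is then the mean over the torus, or it is evaluation at a point
  of a (rotated) leaf.

  Let \<open>\<Phi>\<close> be an isometric automorphism. Since the torus is the Shilov boundary, \<open>\<Phi>\<close> maps characters to unimodular
  functions. A character of positive weight is divisible by arbitrarily high powers of characters of small
  positive weight; by the Schwarz lemma this rules out that \<open>\<Phi>\<close> moves the mean to a point of a leaf, so
  \<open>\<Phi>\<close> preserves the mean. Consequently the extension of the image \<open>u\<close> of a character has no zeros, and by
  reflection it equals \<open>exp (i G)\<close> with \<open>G\<close> entire and preserving the upper and the lower half-plane. Such a
  \<open>G\<close> is affine, hence \<open>u\<close> is a pure frequency on the leaf, and by density of the leaf it is a multiple of a character.

  So \<open>\<Phi>\<close> acts on exponents by an integral matrix that preserves the order, i.e. has \<open>(1, \<alpha>)\<close> as an eigenvector with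
  positive eigenvalue. For non-quadratic \<open>\<alpha>\<close> only the identity qualifies; for quadratic \<open>\<alpha>\<close> the eigenvalues
  are the positive units of an order in \<open>\<rat>(\<alpha>)\<close>, which form an infinite cyclic group by Pell's equation.
\<close>

section \<open>Function theory in the upper half-plane\<close>

text \<open>Irrationality of \<alpha> is used in three ways: only the zero exponent has weight 0,
  which makes the mean multiplicative on the algebra; positive weights accumulate at 0, which
  supplies the characters with high powers below a given one; and one leaf is dense in the torus, so
  a function is known from its leaf. All continuations are uniform limits of exponential sums, so
  bounds, products and uniqueness are inherited from finite sums, and neither a Poisson integral nor
  a topology on the spectrum appears. A functional is known from its values on characters of
  non-negative weight, which turns identities between operators into identities between exponents. A
  stabilizing matrix is determined by its eigenvalue, so cyclicity becomes discreteness of a set of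
  positive reals. Substitution in functions reverses composition; this is why the integer coordinate
  changes sign in the final isomorphism.\<close>

lemma pseudo_hyperbolic_less_1:
  assumes "0 < Im a" "0 < Im z"
  shows "norm ((z - a) / (z - cnj a)) < 1"
proof -
  have "(norm (z - a))\<^sup>2 < (norm (z - cnj a))\<^sup>2"
    unfolding cmod_power2 using assms by (simp add: power2_eq_square algebra_simps)
  then have "norm (z - a) < norm (z - cnj a)" using power2_less_imp_less by fastforce
  then show ?thesis by (simp add: norm_divide divide_less_eq_1)
qed

text \<open>Schwarz's lemma transported from the disc by the Cayley map centred at
  \<open>a\<close>.\<close>

lemma schwarz_pick_half_plane:
  assumes hol: "W holomorphic_on {z. 0 < Im z}"
    and le1: "\<And>z. 0 < Im z \<Longrightarrow> norm (W z) \<le> 1"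
    and Wa: "W a = 0" and a: "0 < Im a" and z: "0 < Im z"
  shows "norm (W z) \<le> norm ((z - a) / (z - cnj a))"
proof -
  \<comment> \<open>Inverse of the Cayley map \<open>z \<mapsto> (z - a) / (z - cnj a)\<close>; it
    takes the unit disc into the half-plane and 0 to \<open>a\<close>.\<close>
  define \<phi> where "\<phi> w = (a - cnj a * w) / (1 - w)" for w
  have ne1: "1 - w \<noteq> 0" if "norm w < 1" for w :: complex
    using that by auto
  have Im\<phi>: "0 < Im (\<phi> w)" if w: "norm w < 1" for w
  proof -
    have "Im (\<phi> w) = Im ((a - cnj a * w) * cnj (1 - w)) / (norm (1 - w))\<^sup>2"
      unfolding \<phi>_def by (subst complex_div_cnj) (simp add: Im_divide_of_real[symmetric] del: complex_cnj_diff)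
    also have "Im ((a - cnj a * w) * cnj (1 - w)) = Im a * (1 - (norm w)\<^sup>2)"
      unfolding cmod_power2 by (simp add: algebra_simps power2_eq_square)
    finally have "Im (\<phi> w) = Im a * (1 - (norm w)\<^sup>2) / (norm (1 - w))\<^sup>2" .
    moreover have "(norm w)\<^sup>2 < 1"
      using w by (simp add: power_less_one_iff)
    ultimately show ?thesis
      using a ne1[OF w] by simp
  qed
  define w where "w = (z - a) / (z - cnj a)"
  have zne: "z - cnj a \<noteq> 0"
  proof
    assume "z - cnj a = 0"
    then have "Im (z - cnj a) = 0" by simp
    then show False using a z by simp
  qed
  have w1: "norm w < 1" unfolding w_def by (rule pseudo_hyperbolic_less_1[OF a z])
  have aa: "a - cnj a \<noteq> 0"
  proof
    assume "a - cnj a = 0"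
    then have "Im (a - cnj a) = 0" by simp
    then show False using a by simp
  qed
  have \<phi>w: "\<phi> w = z"
  proof -
    have "1 - w = (a - cnj a) / (z - cnj a)"
      using zne by (simp add: w_def field_simps)
    moreover have "a - cnj a * w = (z * (a - cnj a)) / (z - cnj a)"
      using zne by (simp add: w_def field_simps)
    ultimately show ?thesis
      using zne aa by (simp add: \<phi>_def)
  qed
  have hol\<phi>: "\<phi> holomorphic_on ball 0 1"
    unfolding \<phi>_def by (intro holomorphic_intros) (use ne1 in auto)
  \<comment> \<open>Schwarz's lemma wants values in the open disc, while \<open>W\<close> may reach
    modulus 1; hence the factor \<open>r < 1\<close>, removed at the end.\<close>
  have "norm (of_real r * W z) \<le> norm w" if r: "0 < r" "r < 1" for r
  proof -
    define k where "k = (\<lambda>w. of_real r * W (\<phi> w))"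
    have "k holomorphic_on ball 0 1"
      unfolding k_def
      by (intro holomorphic_intros holomorphic_on_compose_gen[OF hol\<phi> hol, unfolded o_def])
        (use Im\<phi> in auto)
    moreover have "k 0 = 0" by (simp add: k_def \<phi>_def Wa)
    moreover have "norm (k u) < 1" if "norm u < 1" for u
    proof -
      have "norm (k u) \<le> r * 1"
        unfolding k_def norm_mult using le1[OF Im\<phi>[OF that]] r by (intro mult_mono) auto
      then show ?thesis using r by simp
    qed
    ultimately have "norm (k w) \<le> norm w"
      using Schwarz_Lemma(1) w1 by blast
    then show ?thesis by (simp add: k_def \<phi>w)
  qed
  then have *: "r * norm (W z) \<le> norm w" if "0 < r" "r < 1" for r
    using that by (simp add: norm_mult)
  have "norm (W z) \<le> norm w"
  proof (rule field_le_mult_one_interval)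
    fix r :: real assume "0 < r" "r < 1"
    then show "r * norm (W z) \<le> norm w" using * by blast
  qed
  then show ?thesis by (simp add: w_def)
qed

text \<open>Phragmen-Lindelof for bounded functions. Dividing by \<open>z + \<i>\<close> gives decay
  at infinity, so the ordinary maximum principle works on large half-discs; applying this to every
  power \<open>f ^ n\<close> makes the factor \<open>norm (z + \<i>)\<close> harmless, since it does
  not depend on \<open>n\<close>.\<close>

lemma half_plane_maximum_principle:
  fixes F :: "complex \<Rightarrow> complex"
  assumes hol: "F holomorphic_on UNIV"
    and bdd: "\<And>z. 0 \<le> Im z \<Longrightarrow> norm (F z) \<le> C"
    and real_line: "\<And>t::real. norm (F (of_real t)) \<le> B"
    and z: "0 \<le> Im z"
  shows "norm (F z) \<le> B"
proof (rule field_le_epsilon)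
  fix e :: real assume e: "0 < e"
  have B0: "0 \<le> B" using real_line[of 0] norm_ge_zero order_trans by blast
  \<comment> \<open>The surplus \<open>e\<close> keeps the divisor positive even if
    \<open>B = 0\<close>.\<close>
  define D where "D = B + e"
  have D: "D > 0" using B0 e by (simp add: D_def)
  define f where "f = (\<lambda>z. F z / of_real D)"
  define K where "K = C / D"
  have holf: "f holomorphic_on UNIV"
    unfolding f_def using hol D by (intro holomorphic_intros) auto
  have fK: "norm (f z) \<le> K" if "0 \<le> Im z" for z
    using bdd[OF that] D by (simp add: f_def K_def norm_divide divide_right_mono)
  have f1: "norm (f (of_real t)) \<le> 1" for t
  proof -
    have "norm (f (of_real t)) = norm (F (of_real t)) / D" using D by (simp add: f_def norm_divide)
    also have "\<dots> \<le> 1" using real_line[of t] e D by (simp add: D_def)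
    finally show ?thesis .
  qed
  have K0: "0 \<le> K" using order_trans[OF norm_ge_zero fK[of 0]] by simp
  have main: "norm (f z) ^ n \<le> norm (z + \<i>)" for n
  proof -
    \<comment> \<open>Large enough that \<open>z\<close> lies inside and that
      \<open>norm (u + \<i>) \<ge> R - 1 \<ge> K ^ n\<close> on the arc.\<close>
    define R where "R = norm z + K ^ n + 2"
    define S where "S = {u::complex. 0 \<le> Im u} \<inter> cball 0 R"
    define H where "H = (\<lambda>u. f u ^ n / (u + \<i>))"
    have Kn: "0 \<le> K ^ n" using K0 by simp
    have ne: "u + \<i> \<noteq> 0" if "0 \<le> Im u" for u
    proof
      assume "u + \<i> = 0"
      then have "Im (u + \<i>) = 0" by simp
      then show False using that by simp
    qed
    have clS: "closed S" unfolding S_def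
      by (intro closed_Int closed_halfspace_Im_ge closed_cball)
    have holH: "H holomorphic_on S"
      unfolding H_def
      by (intro holomorphic_intros holomorphic_on_subset[OF holf]) (use ne in \<open>auto simp: S_def\<close>)
    have "norm (H z) \<le> 1"
    proof (rule maximum_modulus_frontier[where S = S and f = H])
      show "H holomorphic_on interior S"
        using holH holomorphic_on_subset interior_subset by blast
      show "continuous_on (closure S) H"
        using holH clS by (simp add: holomorphic_on_imp_continuous_on)
      show "bounded S" unfolding S_def using bounded_Int bounded_cball by blast
      show "z \<in> S" using z Kn by (simp add: S_def R_def)
      fix u assume u: "u \<in> frontier S"
      then have uS: "u \<in> S" using clS frontier_subset_closed by blast
      have "\<not> (0 < Im u \<and> norm u < R)"
      proof
        assume *: "0 < Im u \<and> norm u < R"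
        have "{u. 0 < Im u} \<inter> ball 0 R \<subseteq> interior S"
          by (rule interior_maximal) (auto simp: S_def intro!: open_Int open_halfspace_Im_gt)
        then have "u \<in> interior S" using * by auto
        then show False using u by (simp add: frontier_def)
      qed
      then consider "Im u = 0" | "norm u = R" using uS by (force simp: S_def)
      then show "norm (H u) \<le> 1"
      proof cases
        case 1
        then obtain t where t: "u = of_real t"
          using complex_is_Real_iff Reals_cases by metis
        have "1 \<le> norm (u + \<i>)"
          using abs_Im_le_cmod[of "u + \<i>"] 1 by simp
        moreover have "norm (f u) ^ n \<le> 1" using f1 t by (simp add: power_le_one)
        ultimately show ?thesis
          unfolding H_def norm_divide norm_power
          by (smt (verit) divide_le_eq_1)
      next
        case 2
        have "norm (f u) ^ n \<le> K ^ n" using fK uS by (intro power_mono) (auto simp: S_def)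
        also have "\<dots> \<le> norm (u + \<i>)"
        proof -
          have "norm u \<le> norm (u + \<i>) + 1"
            using norm_triangle_ineq4[of "u + \<i>" "\<i>"] by simp
          then show ?thesis using 2 norm_ge_zero[of z] unfolding R_def by linarith
        qed
        finally show ?thesis
          unfolding H_def norm_divide norm_power using ne uS
          by (simp add: S_def divide_le_eq_1)
      qed
    qed
    then show ?thesis
      unfolding H_def norm_divide norm_power using ne[OF z] by (simp add: divide_le_eq_1)
  qed
  have "norm (f z) \<le> 1"
  proof (rule ccontr)
    assume "\<not> norm (f z) \<le> 1"
    then obtain n where "norm (z + \<i>) < norm (f z) ^ n"
      using real_arch_pow[of "norm (f z)"] by auto
    then show False using main[of n] by simp
  qed
  then have "norm (F z) / D \<le> 1"
    using D by (simp add: f_def norm_divide)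
  then show "norm (F z) \<le> B + e"
    using D by (simp add: D_def)
qed

text \<open>Schwarz-Pick bounds the pseudo-hyperbolic distance of \<open>H z\<close> from
  \<open>H \<i>\<close>; solved for the Euclidean distance, this is a bound of size
  \<open>\<bar>z\<bar>\<^sup>2\<close> over the height.\<close>

lemma half_plane_growth:
  assumes hol: "H holomorphic_on UNIV" and im: "\<And>z. 0 \<le> Im z \<Longrightarrow> 0 \<le> Im (H z)"
  obtains K where "\<And>z. 0 < Im z \<Longrightarrow> 1 \<le> norm z \<Longrightarrow> norm (H z) \<le> K * (norm z)\<^sup>2 / Im z"
proof -
  define v where "v = Im (H \<i>) + 1"
  have v: "v > 0" using im[of \<i>] by (simp add: v_def)
  \<comment> \<open>Cayley map of the larger half-plane \<open>Im > -1\<close>, centred at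
    \<open>H \<i>\<close>, whose mirror image is \<open>cnj (H \<i>) - 2 * \<i>\<close>. The margin
    1 keeps the denominator off 0 even where \<open>H\<close> is real.\<close>
  define W where "W = (\<lambda>z. (H z - H \<i>) / (H z - cnj (H \<i>) + 2 * \<i>))"
  have den: "H z - cnj (H \<i>) + 2 * \<i> \<noteq> 0" if "0 < Im z" for z
  proof
    assume "H z - cnj (H \<i>) + 2 * \<i> = 0"
    then have "Im (H z - cnj (H \<i>) + 2 * \<i>) = 0" by simp
    then show False using im[of z] im[of \<i>] that by simp
  qed
  have *: "norm (H z - H \<i>) \<le> v * (norm (z + \<i>))\<^sup>2 / Im z" if z: "0 < Im z" for z
  proof -
    have W1: "norm (W u) \<le> 1" if u: "0 < Im u" for u
    proof -
      have "(norm (H u - H \<i>))\<^sup>2 \<le> (norm (H u - cnj (H \<i>) + 2 * \<i>))\<^sup>2"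
      proof -
        have "(norm (H u - cnj (H \<i>) + 2 * \<i>))\<^sup>2 - (norm (H u - H \<i>))\<^sup>2
            = 4 * (Im (H u) + 1) * (Im (H \<i>) + 1)"
          unfolding cmod_power2 by (simp add: power2_eq_square algebra_simps)
        moreover have "0 \<le> 4 * (Im (H u) + 1) * (Im (H \<i>) + 1)"
          using im[of u] im[of \<i>] u by simp
        ultimately show ?thesis by linarith
      qed
      then have "norm (H u - H \<i>) \<le> norm (H u - cnj (H \<i>) + 2 * \<i>)"
        using power2_le_imp_le norm_ge_zero by blast
      then show ?thesis unfolding W_def norm_divide using den[OF u] by (simp add: divide_le_eq_1)
    qed
    have "W holomorphic_on {z. 0 < Im z}"
      unfolding W_def
      by (intro holomorphic_intros holomorphic_on_subset[OF hol]) (use den in auto)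
    then have "norm (W z) \<le> norm ((z - \<i>) / (z - cnj \<i>))"
      using W1 z by (intro schwarz_pick_half_plane) (auto simp: W_def)
    then have Wr: "norm (W z) \<le> norm (z - \<i>) / norm (z + \<i>)"
      by (simp add: norm_divide)
    define q where "q = norm (z + \<i>)"
    define p where "p = norm (z - \<i>)"
    define d where "d = norm (H z - H \<i>)"
    \<comment> \<open>This converts the contraction factor \<open>p / q\<close> into the height:
      \<open>q - p = 4 * Im z / (q + p)\<close>.\<close>
    have pq: "q\<^sup>2 - p\<^sup>2 = 4 * Im z"
      unfolding p_def q_def cmod_power2 by (simp add: power2_eq_square algebra_simps)
    have p0: "0 \<le> p" and q0: "0 \<le> q" by (auto simp: p_def q_def)
    have plq: "p < q" using pq z q0 by (smt (verit) power2_le_imp_le power_mono)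
    have "norm (H z - cnj (H \<i>) + 2 * \<i>) \<le> d + 2 * v"
    proof -
      have "H z - cnj (H \<i>) + 2 * \<i> = (H z - H \<i>) + 2 * \<i> * of_real v"
        by (simp add: complex_eq_iff v_def)
      then have "norm (H z - cnj (H \<i>) + 2 * \<i>) \<le> d + norm (2 * \<i> * of_real v)"
        using norm_triangle_ineq unfolding d_def by metis
      then show ?thesis using v by (simp add: norm_mult)
    qed
    moreover have "d \<le> p / q * norm (H z - cnj (H \<i>) + 2 * \<i>)"
      using Wr den[OF z] unfolding W_def norm_divide d_def p_def q_def
      by (simp add: divide_le_eq)
    ultimately have "d \<le> p / q * (d + 2 * v)"
      by (smt (verit) p0 q0 divide_nonneg_nonneg mult_left_mono)
    then have "d * (q - p) \<le> 2 * v * p"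
      using plq p0 by (simp add: field_simps)
    then have "d * (q - p) * (q + p) \<le> 2 * v * p * (q + p)"
      using p0 q0 by (intro mult_right_mono) auto
    also have "\<dots> \<le> 2 * v * q * (q + q)"
      using plq p0 q0 v by (intro mult_mono) auto
    finally have "d * (4 * Im z) \<le> 4 * v * q\<^sup>2"
      unfolding pq[symmetric] by (simp add: power2_eq_square algebra_simps)
    then show ?thesis
      using z by (simp add: d_def q_def pos_le_divide_eq)
  qed
  show ?thesis
  proof (rule that)
    fix z assume z: "0 < Im z" and z1: "1 \<le> norm z"
    have "norm (z + \<i>) \<le> 2 * norm z"
      using norm_triangle_ineq[of z \<i>] z1 by simp
    then have "(norm (z + \<i>))\<^sup>2 \<le> (2 * norm z)\<^sup>2" by (intro power_mono) auto
    then have "v * (norm (z + \<i>))\<^sup>2 / Im z \<le> v * (2 * norm z)\<^sup>2 / Im z"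
      using v z by (intro divide_right_mono mult_left_mono) auto
    moreover have "norm (H \<i>) \<le> norm (H \<i>) * (norm z)\<^sup>2 / Im z"
    proof -
      have "Im z \<le> norm z" using abs_Im_le_cmod[of z] z by simp
      also have "\<dots> \<le> (norm z)\<^sup>2" using z1 by (simp add: self_le_power)
      finally have "1 \<le> (norm z)\<^sup>2 / Im z" using z by simp
      then have "norm (H \<i>) * 1 \<le> norm (H \<i>) * ((norm z)\<^sup>2 / Im z)"
        by (intro mult_left_mono) auto
      then show ?thesis by simp
    qed
    moreover have "norm (H z) \<le> norm (H z - H \<i>) + norm (H \<i>)"
      using norm_triangle_ineq[of "H z - H \<i>" "H \<i>"] by simp
    ultimately have "norm (H z) \<le> v * (2 * norm z)\<^sup>2 / Im z + norm (H \<i>) * (norm z)\<^sup>2 / Im z"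
      using *[OF z] by linarith
    also have "\<dots> = (4 * v + norm (H \<i>)) * (norm z)\<^sup>2 / Im z"
      by (simp add: add_divide_distrib algebra_simps power2_eq_square)
    finally show "norm (H z) \<le> (4 * v + norm (H \<i>)) * (norm z)\<^sup>2 / Im z" .
  qed
qed

text \<open>Each half-plane gives a bound that degenerates only at the real line, the lower one
  after conjugation. Once the degeneration is removed, growth is linear and Liouville's theorem for
  polynomial growth applies.\<close>

lemma entire_half_plane_preserving_imp_affine:
  fixes G :: "complex \<Rightarrow> complex"
  assumes hol: "G holomorphic_on UNIV"
    and up: "\<And>z. 0 \<le> Im z \<Longrightarrow> 0 \<le> Im (G z)"
    and low: "\<And>z. Im z \<le> 0 \<Longrightarrow> Im (G z) \<le> 0"
  obtains a b where "\<And>z. G z = a * z + b"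
proof -
  obtain K1 where K1: "\<And>z. 0 < Im z \<Longrightarrow> 1 \<le> norm z \<Longrightarrow> norm (G z) \<le> K1 * (norm z)\<^sup>2 / Im z"
    using half_plane_growth[OF hol up] by blast
  have "(cnj \<circ> G \<circ> cnj) holomorphic_on UNIV"
    by (rule holomorphic_on_compose_cnj_cnj) (auto intro: holomorphic_on_subset[OF hol])
  then obtain K2 where K2: "\<And>z. 0 < Im z \<Longrightarrow> 1 \<le> norm z \<Longrightarrow> norm ((cnj \<circ> G \<circ> cnj) z) \<le> K2 * (norm z)\<^sup>2 / Im z"
    using half_plane_growth[of "cnj \<circ> G \<circ> cnj"] low by force
  define K where "K = max 0 (max K1 K2)"
  have K0: "0 \<le> K" by (simp add: K_def)
  have K: "norm (G z) * \<bar>Im z\<bar> \<le> K * (norm z)\<^sup>2" if z: "1 \<le> norm z" for z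
  proof -
    consider "Im z = 0" | "0 < Im z" | "Im z < 0" by linarith
    then show ?thesis
    proof cases
      case 1 then show ?thesis using K0 by simp
    next
      case 2
      have "norm (G z) * Im z \<le> K1 * (norm z)\<^sup>2"
        using K1[OF 2 z] 2 by (simp add: pos_le_divide_eq)
      also have "\<dots> \<le> K * (norm z)\<^sup>2" by (intro mult_right_mono) (auto simp: K_def)
      finally show ?thesis using 2 by simp
    next
      case 3
      have "norm (G z) * (- Im z) \<le> K2 * (norm z)\<^sup>2"
        using K2[of "cnj z"] 3 z by (simp add: pos_le_divide_eq neg_le_divide_eq field_simps)
      also have "\<dots> \<le> K * (norm z)\<^sup>2" by (intro mult_right_mono) (auto simp: K_def)
      finally show ?thesis using 3 by simp
    qed
  qed
  \<comment> \<open>On the circle of radius \<open>R\<close> one has \<open>\<bar>u\<^sup>2 - R\<^sup>2\<bar> = 2 R \<bar>Im u\<bar>\<close>, so multiplying by \<open>u\<^sup>2 - R\<^sup>2\<close>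
     removes the singularity of the bound \<open>K \<bar>u\<bar>\<^sup>2 / \<bar>Im u\<bar>\<close> on the real line.\<close>
  have growth: "norm (G z) \<le> (16/3 * K) * norm z ^ 1" if z: "1 \<le> norm z" for z
  proof -
    define R where "R = 2 * norm z"
    have R: "R \<ge> 1" using z by (simp add: R_def)
    define P where "P = (\<lambda>u. G u * (u\<^sup>2 - of_real (R\<^sup>2)))"
    have "norm (P z) \<le> 2 * K * R ^ 3"
    proof (rule maximum_modulus_frontier[where S = "cball 0 R" and f = P])
      have "P holomorphic_on UNIV" unfolding P_def using hol by (intro holomorphic_intros)
      then show "P holomorphic_on interior (cball 0 R)" "continuous_on (closure (cball 0 R)) P"
        by (auto intro: holomorphic_on_subset holomorphic_on_imp_continuous_on)
      show "z \<in> cball 0 R" using z by (simp add: R_def)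
      fix u assume "u \<in> frontier (cball (0::complex) R)"
      then have uR: "norm u = R" using R by simp
      have "of_real (R\<^sup>2) = u * cnj u"
        using uR complex_norm_square[of u] by simp
      then have "u\<^sup>2 - of_real (R\<^sup>2) = u * (u - cnj u)"
        by (simp add: power2_eq_square algebra_simps)
      then have "norm (u\<^sup>2 - of_real (R\<^sup>2)) = R * (2 * \<bar>Im u\<bar>)"
        using uR by (simp add: norm_mult complex_diff_cnj)
      then have "norm (P u) = 2 * R * (norm (G u) * \<bar>Im u\<bar>)"
        by (simp add: P_def norm_mult)
      also have "\<dots> \<le> 2 * R * (K * R\<^sup>2)"
        using K[of u] uR R by (intro mult_left_mono) auto
      finally show "norm (P u) \<le> 2 * K * R ^ 3"
        by (simp add: power2_eq_square power3_eq_cube algebra_simps)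
    qed auto
    moreover have "norm (P z) \<ge> norm (G z) * (3 * (norm z)\<^sup>2)"
    proof -
      have "norm (of_real (R\<^sup>2) :: complex) - norm (z\<^sup>2) \<le> norm (z\<^sup>2 - of_real (R\<^sup>2))"
        using norm_triangle_ineq3[of "of_real (R\<^sup>2)" "z\<^sup>2"] by (simp add: norm_minus_commute)
      moreover have "norm (of_real (R\<^sup>2) :: complex) = 4 * (norm z)\<^sup>2"
        by (simp only: norm_of_real) (simp add: R_def power_mult_distrib)
      moreover have "norm (z\<^sup>2) = (norm z)\<^sup>2" by (rule norm_power)
      ultimately have "3 * (norm z)\<^sup>2 \<le> norm (z\<^sup>2 - of_real (R\<^sup>2))"
        by linarith
      then show ?thesis unfolding P_def norm_mult by (rule mult_left_mono) (rule norm_ge_zero)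
    qed
    ultimately have "norm (G z) * (3 * (norm z)\<^sup>2) \<le> (16 * K * norm z) * (norm z)\<^sup>2"
      by (simp add: R_def power2_eq_square power3_eq_cube algebra_simps)
    then have "norm (G z) * 3 * (norm z)\<^sup>2 \<le> (16 * K * norm z) * (norm z)\<^sup>2" by simp
    then have "norm (G z) * 3 \<le> 16 * K * norm z"
      using z by (subst (asm) mult_le_cancel_right) auto
    then show ?thesis by simp
  qed
  have "G z = deriv G 0 * z + G 0" for z
    using Liouville_polynomial[OF hol growth, where \<xi> = z] by simp
  then show ?thesis using that by blast
qed

text \<open>A zero of \<open>E\<close> would turn into a pole of the reflected function; without
  zeros \<open>F\<close> is entire and has an entire logarithm. Both coefficients of the affine
  \<open>G\<close> are real because \<open>E\<close> is unimodular on the line, so only a frequency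
  survives.\<close>

lemma zero_free_inner_half_plane:
  fixes E :: "complex \<Rightarrow> complex"
  assumes cont: "continuous_on {z. 0 \<le> Im z} E"
    and hol: "E holomorphic_on {z. 0 < Im z}"
    and le1: "\<And>z. 0 \<le> Im z \<Longrightarrow> norm (E z) \<le> 1"
    and eq1: "\<And>t::real. norm (E (of_real t)) = 1"
    and nz: "\<And>z. 0 < Im z \<Longrightarrow> E z \<noteq> 0"
  obtains a :: real where "\<And>t::real. E (of_real t) = E 0 * cis (a * t)"
proof -
  define F where "F z = (if 0 \<le> Im z then E z else 1 / cnj (E (cnj z)))" for z
  have nz0: "E z \<noteq> 0" if "0 \<le> Im z" for z
  proof (cases "Im z = 0")
    case True
    then obtain t where "z = of_real t" using complex_is_Real_iff Reals_cases by metis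
    then show ?thesis using eq1[of t] by auto
  next
    case False then show ?thesis using nz that by simp
  qed
  have Fnz: "F z \<noteq> 0" for z
    using nz0[of z] nz0[of "cnj z"] by (auto simp: F_def)
  have contL: "continuous_on {z. Im z \<le> 0} (\<lambda>z. 1 / cnj (E (cnj z)))"
  proof -
    have "continuous_on {z. Im z \<le> 0} (E \<circ> cnj)"
      by (rule continuous_on_compose) (auto intro!: continuous_intros continuous_on_subset[OF cont])
    then show ?thesis using nz0 unfolding o_def by (intro continuous_intros) auto
  qed
  have contF: "continuous_on UNIV F"
  proof -
    have "continuous_on ({z. 0 \<le> Im z} \<union> {z. Im z \<le> 0}) F"
      unfolding F_def
    proof (rule continuous_on_cases; (intro allI impI)?)
      fix z assume "z \<in> {z. 0 \<le> Im z} \<and> \<not> 0 \<le> Im z \<or> z \<in> {z. Im z \<le> 0} \<and> 0 \<le> Im z"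
      then have "Im z = 0" by auto
      then obtain t where t: "z = of_real t" using complex_is_Real_iff Reals_cases by metis
      have "E z * cnj (E z) = 1"
        using eq1[of t] complex_norm_square[of "E z"] t by simp
      then show "E z = 1 / cnj (E (cnj z))"
        using nz0[of z] \<open>Im z = 0\<close> t by (simp add: field_simps)
    qed (use cont contL closed_halfspace_Im_ge[of 0] closed_halfspace_Im_le[of 0] in simp_all)
    moreover have "{z. 0 \<le> Im z} \<union> {z. Im z \<le> 0} = UNIV" by auto
    ultimately show ?thesis by simp
  qed
  have "F holomorphic_on UNIV"
  proof (rule holomorphic_on_paste_across_line[where d = "\<i>" and k = 0])
    have "E holomorphic_on {z. 0 < Im z} \<Longrightarrow> F holomorphic_on {z. 0 < Im z}"
      by (rule holomorphic_transform) (auto simp: F_def)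
    then show "F holomorphic_on UNIV \<inter> {z. 0 < \<i> \<bullet> z}"
      using hol by (simp add: inner_complex_def)
    have CNJ: "cnj ` {z. 0 < Im z} = {z. Im z < 0}"
    proof (intro equalityI subsetI)
      fix z :: complex assume "z \<in> {z. Im z < 0}"
      then show "z \<in> cnj ` {z. 0 < Im z}" by (intro image_eqI[of _ _ "cnj z"]) auto
    qed auto
    have "(cnj \<circ> E \<circ> cnj) holomorphic_on cnj ` {z. 0 < Im z}"
      using holomorphic_on_compose_cnj_cnj[of E "{z. Im z < 0}"] hol
        open_halfspace_Im_lt[of 0] by (simp add: CNJ[symmetric] image_image)
    with CNJ have "(\<lambda>z. cnj (E (cnj z))) holomorphic_on {z. Im z < 0}"
      by (simp add: o_def)
    then have "(\<lambda>z. 1 / cnj (E (cnj z))) holomorphic_on {z. Im z < 0}"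
      using nz by (intro holomorphic_intros) auto
    then have "F holomorphic_on {z. Im z < 0}"
      by (rule holomorphic_transform) (auto simp: F_def)
    then show "F holomorphic_on UNIV \<inter> {z. \<i> \<bullet> z < 0}"
      by (simp add: inner_complex_def)
  qed (use contF in auto)
  then obtain g where g: "g holomorphic_on UNIV" "\<And>z. exp (g z) = F z"
    using holomorphic_logarithm_exists[of UNIV F 0] Fnz by auto
  define G where "G = (\<lambda>z. - \<i> * g z)"
  have FG: "F z = exp (\<i> * G z)" for z using g(2)[of z] by (simp add: G_def)
  then have nF: "norm (F z) = exp (- Im (G z))" for z by simp
  have "G holomorphic_on UNIV" unfolding G_def using g(1) by (intro holomorphic_intros)
  moreover have "0 \<le> Im (G z)" if "0 \<le> Im z" for z
    using le1[OF that] nF[of z] that by (simp add: F_def)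
  moreover have "Im (G z) \<le> 0" if "Im z \<le> 0" for z
  proof (cases "Im z = 0")
    case True
    then obtain t where "z = of_real t" using complex_is_Real_iff Reals_cases by metis
    then show ?thesis using nF[of z] eq1[of t] by (simp add: F_def)
  next
    case False
    then have "norm (F z) = 1 / norm (E (cnj z))" using that by (simp add: F_def norm_divide)
    moreover have "norm (E (cnj z)) \<le> 1" "norm (E (cnj z)) > 0"
      using le1[of "cnj z"] nz0[of "cnj z"] that by auto
    ultimately have "1 \<le> norm (F z)" by simp
    then show ?thesis using nF[of z] by simp
  qed
  ultimately obtain a b where ab: "\<And>z. G z = a * z + b"
    using entire_half_plane_preserving_imp_affine[of G] by blast
  have ImG: "Im (G (of_real t)) = 0" for t :: real
    using nF[of "of_real t"] eq1[of t] by (simp add: F_def)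
  have b: "Im b = 0" using ImG[of 0] ab by simp
  have "Im a = 0" using ImG[of 1] ab b by simp
  then have a: "a = of_real (Re a)" by (simp add: complex_eq_iff)
  have "E (of_real t) = E 0 * cis (Re a * t)" for t :: real
  proof -
    have "E (of_real t) = exp (\<i> * (a * of_real t + b))"
      using FG[of "of_real t"] ab by (simp add: F_def)
    also have "\<dots> = exp (\<i> * b) * exp (\<i> * (of_real (Re a) * of_real t))"
      by (subst a) (simp add: algebra_simps exp_add)
    also have "exp (\<i> * b) = E 0" using FG[of 0] ab by (simp add: F_def)
    finally show ?thesis by (simp add: cis_conv_exp)
  qed
  then show ?thesis using that by blast
qed

section \<open>Fourier analysis on the torus\<close>

lemma mem_T2_iff: "p \<in> T2 \<longleftrightarrow> norm (fst p) = 1 \<and> norm (snd p) = 1"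
  by (cases p) (auto simp: T2_def)

lemma cis_mem_T2 [simp]: "(cis s, cis t) \<in> T2"
  by (simp add: mem_T2_iff)

lemma T2_E:
  assumes "p \<in> T2" obtains s t where "p = (cis s, cis t)"
proof -
  have "fst p = cis (Arg (fst p))" "snd p = cis (Arg (snd p))"
    using assms rcis_cmod_Arg[of "fst p"] rcis_cmod_Arg[of "snd p"] by (simp_all add: mem_T2_iff rcis_def)
  then show ?thesis using that[of "Arg (fst p)" "Arg (snd p)"] by (metis prod.collapse)
qed

lemma compact_T2: "compact T2"
  unfolding T2_def by (intro compact_Times compact_sphere)

lemma one_mem_T2 [simp]: "(1, 1) \<in> T2"
  by (simp add: mem_T2_iff)

lemma fst_snd_nz_T2: "p \<in> T2 \<Longrightarrow> fst p \<noteq> 0 \<and> snd p \<noteq> 0"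
  by (auto simp: mem_T2_iff)

definition torus_char :: "int \<Rightarrow> int \<Rightarrow> complex \<times> complex \<Rightarrow> complex" where
  "torus_char m n p = fst p powi m * snd p powi n"

lemma torus_char_cis: "torus_char m n (cis s, cis t) = cis (of_int m * s + of_int n * t)"
  by (simp add: torus_char_def cis_power_int cis_mult)

lemma norm_torus_char: "p \<in> T2 \<Longrightarrow> norm (torus_char m n p) = 1"
  by (elim T2_E) (simp add: torus_char_cis)

lemma torus_char_0 [simp]: "torus_char 0 0 p = 1"
  by (simp add: torus_char_def)

lemma torus_char_add:
  "p \<in> T2 \<Longrightarrow> torus_char (m + m') (n + n') p = torus_char m n p * torus_char m' n' p"
  by (elim T2_E) (simp add: torus_char_cis cis_mult algebra_simps)

lemma torus_char_diff:
  "p \<in> T2 \<Longrightarrow> torus_char (m - m') (n - n') p = torus_char m n p * torus_char (- m') (- n') p"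
  using torus_char_add[of p m "- m'" n "- n'"] by simp

lemma cnj_torus_char: "p \<in> T2 \<Longrightarrow> cnj (torus_char m n p) = torus_char (- m) (- n) p"
  by (elim T2_E) (simp add: torus_char_cis cis_cnj)

lemma continuous_on_torus_char [continuous_intros]: "continuous_on T2 (torus_char m n)"
proof -
  have "continuous_on T2 (\<lambda>p. fst p powi m * snd p powi n)"
    by (intro continuous_intros) (auto simp: fst_snd_nz_T2)
  then show ?thesis by (simp add: torus_char_def[abs_def])
qed

definition torus_mean :: "(complex \<times> complex \<Rightarrow> complex) \<Rightarrow> complex" where
  "torus_mean f = integral (cbox (0,0) (2*pi, 2*pi)) (\<lambda>(s,t). f (cis s, cis t)) / (4 * of_real (pi^2))"

lemma continuous_on_lift_torus:
  assumes "continuous_on T2 f"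
  shows "continuous_on A (\<lambda>(s,t). f (cis s, cis t))"
proof -
  have "continuous_on A (\<lambda>x. f (cis (fst x), cis (snd x)))"
    by (rule continuous_on_compose2[OF assms]) (auto intro!: continuous_intros)
  then show ?thesis by (simp add: case_prod_unfold)
qed

lemma integrable_lift_torus:
  fixes f :: "complex \<times> complex \<Rightarrow> complex"
  shows "continuous_on T2 f \<Longrightarrow> (\<lambda>(s,t). f (cis s, cis t)) integrable_on cbox (0,0) (2*pi, 2*pi)"
  by (rule integrable_continuous[OF continuous_on_lift_torus])

lemma fourier_eq_torus_mean: "fourier f m n = torus_mean (\<lambda>p. f p * torus_char (- m) (- n) p)"
proof -
  have "exp (- (\<i> * (of_int m * of_real s + of_int n * of_real t))) = torus_char (- m) (- n) (cis s, cis t)" for s t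
    unfolding torus_char_cis unfolding cis_conv_exp by (simp add: algebra_simps)
  then show ?thesis by (simp add: fourier_def torus_mean_def)
qed

lemma torus_mean_cong: "(\<And>p. p \<in> T2 \<Longrightarrow> f p = g p) \<Longrightarrow> torus_mean f = torus_mean g"
  by (simp add: torus_mean_def)

lemma torus_mean_add:
  assumes "continuous_on T2 f" "continuous_on T2 g"
  shows "torus_mean (\<lambda>p. f p + g p) = torus_mean f + torus_mean g"
  using integral_add[OF assms[THEN integrable_lift_torus]]
  by (simp add: torus_mean_def case_prod_unfold add_divide_distrib)

lemma torus_mean_mult_left: "torus_mean (\<lambda>p. c * f p) = c * torus_mean f"
  by (simp add: torus_mean_def case_prod_unfold)

lemma torus_mean_sum:
  assumes "finite A" "\<And>a. a \<in> A \<Longrightarrow> continuous_on T2 (f a)"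
  shows "torus_mean (\<lambda>p. \<Sum>a\<in>A. f a p) = (\<Sum>a\<in>A. torus_mean (f a))"
  using assms
proof (induction A rule: finite_induct)
  case empty then show ?case by (simp add: torus_mean_def case_prod_unfold)
next
  case (insert a A)
  then show ?case by (simp add: torus_mean_add continuous_on_sum)
qed

lemma integral_cis_period:
  "integral {0..2*pi} (\<lambda>t. cis (of_int k * t)) = (if k = 0 then 2 * of_real pi else 0)"
proof (cases "k = 0")
  case False
  have "integral {0..2*pi} (\<lambda>t. exp (\<i> * of_int k * complex_of_real t))
      = (exp (\<i> * of_int k * of_real (2*pi)) - 1) / (\<i> * of_int k)"
  proof -
    have "((\<lambda>x. exp (\<i> * of_int k * x) / (\<i> * of_int k)) has_vector_derivative exp (\<i> * of_int k * t)) (at t within {0..2*pi})" for t :: real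
      using False
      by (intro derivative_eq_intros has_complex_derivative_imp_has_vector_derivative [unfolded o_def] | simp)+
    then have "((\<lambda>t. exp (\<i> * of_int k * of_real t)) has_integral
        exp (\<i> * of_int k * complex_of_real (2*pi)) / (\<i> * of_int k) - exp (\<i> * of_int k * of_real 0) / (\<i> * of_int k)) {0..2*pi}"
      by (intro fundamental_theorem_of_calculus) auto
    then show ?thesis by (simp add: diff_divide_distrib integral_unique)
  qed
  moreover have "exp (\<i> * of_int k * of_real (2*pi)) = 1"
    using exp_integer_2pi[of "of_int k"] by (simp add: mult_ac)
  ultimately show ?thesis using False by (simp add: cis_conv_exp mult_ac)
qed (simp add: scaleR_conv_of_real)

lemma torus_mean_torus_char: "torus_mean (torus_char m n) = (if m = 0 \<and> n = 0 then 1 else 0)"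
proof -
  have "integral (cbox (0,0) (2*pi, 2*pi)) (\<lambda>(s,t). torus_char m n (cis s, cis t))
      = integral (cbox 0 (2*pi)) (\<lambda>s. integral (cbox 0 (2*pi)) (\<lambda>t. torus_char m n (cis s, cis t)))"
    using integral_prod_continuous[OF continuous_on_lift_torus[OF continuous_on_torus_char], of 0 0 "2*pi" "2*pi" m n]
    by simp
  also have "\<dots> = integral {0..2*pi} (\<lambda>s. integral {0..2*pi} (\<lambda>t. cis (of_int m * s) * cis (of_int n * t)))"
    by (simp add: torus_char_cis cis_mult)
  also have "\<dots> = integral {0..2*pi} (\<lambda>s. cis (of_int m * s)) * integral {0..2*pi} (\<lambda>t. cis (of_int n * t))"
    by simp
  finally show ?thesis
    by (simp add: torus_mean_def integral_cis_period power2_eq_square)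
qed

lemma fourier_torus_char:
  "fourier (torus_char a b) m n = (if a = m \<and> b = n then 1 else 0)"
proof -
  have "fourier (torus_char a b) m n = torus_mean (torus_char (a - m) (b - n))"
    unfolding fourier_eq_torus_mean by (rule torus_mean_cong) (simp add: torus_char_diff)
  then show ?thesis by (simp add: torus_mean_torus_char)
qed

lemma fourier_cong: "(\<And>p. p \<in> T2 \<Longrightarrow> f p = g p) \<Longrightarrow> fourier f m n = fourier g m n"
  unfolding fourier_eq_torus_mean by (rule torus_mean_cong) simp

lemma fourier_add:
  assumes "continuous_on T2 f" "continuous_on T2 g"
  shows "fourier (\<lambda>p. f p + g p) m n = fourier f m n + fourier g m n"
  unfolding fourier_eq_torus_mean using assms
  by (subst torus_mean_add[symmetric]) (auto intro!: continuous_intros simp: algebra_simps)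

lemma fourier_mult_left: "fourier (\<lambda>p. c * f p) m n = c * fourier f m n"
  unfolding fourier_eq_torus_mean by (simp add: torus_mean_mult_left mult.assoc)

text \<open>Positivity of a kernel of the form \<open>q * cnj q\<close> is exploited here:
  \<open>q = 1\<close> gives the bound for the plain mean, and the Fejer kernel is a multiple of
  such a square.\<close>

lemma torus_mean_bound_weight:
  assumes f: "continuous_on T2 f" "\<And>p. p \<in> T2 \<Longrightarrow> norm (f p) \<le> B"
    and q: "continuous_on T2 q"
  shows "norm (torus_mean (\<lambda>p. f p * (q p * cnj (q p)))) \<le> B * Re (torus_mean (\<lambda>p. q p * cnj (q p)))"
proof -
  let ?C = "cbox (0::real, 0::real) (2*pi, 2*pi)"
  let ?w = "\<lambda>x. (norm (q (cis (fst x), cis (snd x))))\<^sup>2"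
  have cw: "continuous_on ?C ?w"
    by (intro continuous_intros continuous_on_compose2[OF q]) auto
  have "norm (integral ?C (\<lambda>(s,t). f (cis s, cis t) * (q (cis s, cis t) * cnj (q (cis s, cis t)))))
      \<le> integral ?C (\<lambda>x. B * ?w x)"
  proof (rule integral_norm_bound_integral)
    show "(\<lambda>(s,t). f (cis s, cis t) * (q (cis s, cis t) * cnj (q (cis s, cis t)))) integrable_on ?C"
      using f(1) q by (intro integrable_lift_torus[where f = "\<lambda>p. f p * (q p * cnj (q p))"] continuous_intros)
    show "(\<lambda>x. B * ?w x) integrable_on ?C"
      by (intro integrable_continuous continuous_intros cw)
    fix x assume "x \<in> ?C"
    show "norm (case x of (s, t) \<Rightarrow> f (cis s, cis t) * (q (cis s, cis t) * cnj (q (cis s, cis t)))) \<le> B * ?w x"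
      using f(2)[of "(cis (fst x), cis (snd x))"]
      by (auto simp: case_prod_unfold norm_mult power2_eq_square intro!: mult_right_mono)
  qed
  also have "\<dots> = B * integral ?C ?w" by simp
  finally have 1: "norm (integral ?C (\<lambda>(s,t). f (cis s, cis t) * (q (cis s, cis t) * cnj (q (cis s, cis t)))))
      \<le> B * integral ?C ?w" .
  have "integral ?C (\<lambda>(s,t). q (cis s, cis t) * cnj (q (cis s, cis t))) = integral ?C (\<lambda>x. of_real (?w x))"
    by (simp only: complex_norm_square case_prod_unfold)
  also have "\<dots> = of_real (integral ?C ?w)"
    using integral_linear[OF integrable_continuous[OF cw], of complex_of_real]
    by (simp add: o_def bounded_linear_of_real)
  finally have 2: "torus_mean (\<lambda>p. q p * cnj (q p)) = of_real (integral ?C ?w / (4 * pi\<^sup>2))"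
    by (simp add: torus_mean_def)
  show ?thesis
    unfolding 2 using 1
    by (simp add: torus_mean_def norm_divide norm_mult norm_power divide_right_mono)
qed

lemma torus_mean_norm_le:
  assumes "continuous_on T2 f" "\<And>p. p \<in> T2 \<Longrightarrow> norm (f p) \<le> B"
  shows "norm (torus_mean f) \<le> B"
  using torus_mean_bound_weight[OF assms, of "\<lambda>_. 1"] torus_mean_torus_char[of 0 0]
  by (simp add: torus_char_def[abs_def])

lemma fourier_norm_le:
  assumes "continuous_on T2 f" "\<And>p. p \<in> T2 \<Longrightarrow> norm (f p) \<le> B"
  shows "norm (fourier f m n) \<le> B"
  unfolding fourier_eq_torus_mean
  using assms by (intro torus_mean_norm_le) (auto intro!: continuous_intros simp: norm_mult norm_torus_char)

section \<open>Fejer means and trigonometric approximation\<close>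

definition fejer_index :: "nat \<Rightarrow> (int \<times> int) set" where
  "fejer_index N = {0..<int N} \<times> {0..<int N}"

text \<open>Equivalently, the Cesaro mean with weights \<open>(1 - \<bar>m\<bar>/N) (1 - \<bar>n\<bar>/N)\<close>: the double sum over
  differences exhibits the kernel as a square.\<close>

definition fejer :: "nat \<Rightarrow> (complex \<times> complex \<Rightarrow> complex) \<Rightarrow> complex \<times> complex \<Rightarrow> complex" where
  "fejer N f p = (\<Sum>a\<in>fejer_index N. \<Sum>b\<in>fejer_index N.
      fourier f (fst a - fst b) (snd a - snd b) * torus_char (fst a - fst b) (snd a - snd b) p) / of_nat (N\<^sup>2)"

lemma finite_fejer_index [simp]: "finite (fejer_index N)"
  by (simp add: fejer_index_def)

lemma card_fejer_index [simp]: "card (fejer_index N) = N\<^sup>2"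
  by (simp add: fejer_index_def power2_eq_square)

text \<open>\<open>q x\<close> sums the characters of the index block at the quotient
  \<open>p / x\<close>, so \<open>q * cnj q\<close> reproduces the double sum over differences. By
  orthogonality its mean is \<open>N\<^sup>2\<close>, exactly the divisor in \<open>fejer\<close>,
  whence the contraction.\<close>

lemma fejer_norm_le:
  assumes f: "continuous_on T2 f" "\<And>p. p \<in> T2 \<Longrightarrow> norm (f p) \<le> B" and p: "p \<in> T2"
  shows "norm (fejer N f p) \<le> B"
proof (cases "N = 0")
  case True
  then show ?thesis using order_trans[OF norm_ge_zero f(2)[OF p]] by (simp add: fejer_def)
next
  case N: False
  let ?I = "fejer_index N"
  let ?F = "\<lambda>a b. fourier f (fst a - fst b) (snd a - snd b)"
    and ?t = "\<lambda>a b. torus_char (fst a - fst b) (snd a - snd b)"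
  define Q where "Q a x = torus_char (fst a) (snd a) p * torus_char (- fst a) (- snd a) x" for a :: "int \<times> int" and x
  define q where "q x = (\<Sum>a\<in>?I. Q a x)" for x
  have cQ: "continuous_on T2 (Q a)" for a
    unfolding Q_def[abs_def] by (intro continuous_intros)
  have cq: "continuous_on T2 q"
    unfolding q_def[abs_def] by (intro continuous_on_sum cQ)
  have cnjQ: "Q a x * cnj (Q b x) = ?t a b p * ?t b a x"
    if "x \<in> T2" for a b x
    using that p torus_char_diff[OF p, of "fst a" "fst b" "snd a" "snd b"]
      torus_char_add[OF that, of "fst b" "- fst a" "snd b" "- snd a"]
    by (simp add: Q_def cnj_torus_char)
  have qq: "q x * cnj (q x) = (\<Sum>a\<in>?I. \<Sum>b\<in>?I. Q a x * cnj (Q b x))" for x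
    by (simp add: q_def sum_product cnj_sum)
  have "torus_mean (\<lambda>x. f x * (q x * cnj (q x))) = torus_mean (\<lambda>x. \<Sum>a\<in>?I. \<Sum>b\<in>?I. f x * (Q a x * cnj (Q b x)))"
    by (simp add: qq sum_distrib_left)
  also have "\<dots> = (\<Sum>a\<in>?I. \<Sum>b\<in>?I. torus_mean (\<lambda>x. f x * (Q a x * cnj (Q b x))))"
    by (subst torus_mean_sum torus_mean_sum[symmetric]; auto intro!: continuous_intros f cQ sum.cong)+
  also have "\<dots> = (\<Sum>a\<in>?I. \<Sum>b\<in>?I. ?F a b * ?t a b p)"
  proof (intro sum.cong refl)
    fix a b
    have "torus_mean (\<lambda>x. f x * (Q a x * cnj (Q b x)))
        = torus_mean (\<lambda>x. ?t a b p * (f x * torus_char (- (fst a - fst b)) (- (snd a - snd b)) x))"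
      by (rule torus_mean_cong) (simp add: cnjQ)
    then show "torus_mean (\<lambda>x. f x * (Q a x * cnj (Q b x))) = ?F a b * ?t a b p"
      by (simp add: torus_mean_mult_left fourier_eq_torus_mean)
  qed
  finally have A: "fejer N f p = torus_mean (\<lambda>x. f x * (q x * cnj (q x))) / of_nat (N\<^sup>2)"
    by (simp add: fejer_def)
  have "torus_mean (\<lambda>x. q x * cnj (q x)) = (\<Sum>a\<in>?I. \<Sum>b\<in>?I. torus_mean (\<lambda>x. Q a x * cnj (Q b x)))"
    unfolding qq
    by (subst torus_mean_sum torus_mean_sum[symmetric]; auto intro!: continuous_intros cQ sum.cong)+
  also have "\<dots> = (\<Sum>a\<in>?I. \<Sum>b\<in>?I. if a = b then 1 else 0)"
  proof (intro sum.cong refl)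
    fix a b
    have "torus_mean (\<lambda>x. Q a x * cnj (Q b x))
        = torus_mean (\<lambda>x. ?t a b p * ?t b a x)"
      by (rule torus_mean_cong) (simp add: cnjQ)
    then show "torus_mean (\<lambda>x. Q a x * cnj (Q b x)) = (if a = b then 1 else 0)"
      by (auto simp: torus_mean_mult_left torus_mean_torus_char prod_eq_iff)
  qed
  also have "\<dots> = of_nat (N\<^sup>2)" by simp
  finally have B: "torus_mean (\<lambda>x. q x * cnj (q x)) = of_nat (N\<^sup>2)" .
  have "norm (torus_mean (\<lambda>x. f x * (q x * cnj (q x)))) \<le> B * real (N\<^sup>2)"
    using torus_mean_bound_weight[OF f cq] unfolding B by simp
  then show ?thesis
    unfolding A norm_divide using N by (simp add: norm_power field_simps)
qed

lemma fejer_add: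
  assumes "continuous_on T2 f" "continuous_on T2 g"
  shows "fejer N (\<lambda>p. f p + g p) p = fejer N f p + fejer N g p"
  by (simp add: fejer_def fourier_add[OF assms] algebra_simps sum.distrib add_divide_distrib)

lemma fejer_mult_left: "fejer N (\<lambda>p. c * f p) p = c * fejer N f p"
  by (simp add: fejer_def fourier_mult_left sum_distrib_left mult.assoc)

inductive_set trig_poly :: "(complex \<times> complex \<Rightarrow> complex) set" where
  char: "(\<lambda>p. c * torus_char m n p) \<in> trig_poly"
| add: "f \<in> trig_poly \<Longrightarrow> g \<in> trig_poly \<Longrightarrow> (\<lambda>p. f p + g p) \<in> trig_poly"

lemma continuous_on_trig_poly: "f \<in> trig_poly \<Longrightarrow> continuous_on T2 f"
  by (induction rule: trig_poly.induct) (auto intro!: continuous_intros)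

text \<open>Only pairs with difference \<open>(m, n)\<close> contribute, so the Fejer mean is the
  character times the proportion \<open>card J / N\<^sup>2\<close>. The lost indices lie in at most
  \<open>\<bar>m\<bar>\<close> columns and \<open>\<bar>n\<bar>\<close> rows of the square.\<close>

lemma fejer_torus_char_converges:
  assumes "0 < e"
  shows "\<exists>N0. \<forall>N\<ge>N0. \<forall>p\<in>T2. norm (fejer N (torus_char m n) p - torus_char m n p) \<le> e"
proof -
  obtain N0 :: nat where N0: "(of_int \<bar>m\<bar> + of_int \<bar>n\<bar>) / e < real N0" using reals_Archimedean2 by blast
  show ?thesis
  proof (intro exI[of _ "Suc N0"] allI impI ballI)
    fix N p assume N: "Suc N0 \<le> N" and p: "p \<in> T2"
    let ?I = "fejer_index N"
    define J where "J = {a \<in> ?I. (fst a - m, snd a - n) \<in> ?I}"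
    have J: "finite J" "J \<subseteq> ?I" by (auto simp: J_def)
    have "(\<Sum>b\<in>?I. fourier (torus_char m n) (fst a - fst b) (snd a - snd b) * torus_char (fst a - fst b) (snd a - snd b) p)
        = (if a \<in> J then torus_char m n p else 0)" if "a \<in> ?I" for a
    proof -
      have "(\<Sum>b\<in>?I. fourier (torus_char m n) (fst a - fst b) (snd a - snd b) * torus_char (fst a - fst b) (snd a - snd b) p)
        = (\<Sum>b\<in>?I. if b = (fst a - m, snd a - n) then torus_char m n p else 0)"
        by (rule sum.cong) (auto simp: fourier_torus_char prod_eq_iff)
      then show ?thesis using that by (simp add: J_def)
    qed
    then have "fejer N (torus_char m n) p = (\<Sum>a\<in>?I. if a \<in> J then torus_char m n p else 0) / of_nat (N\<^sup>2)"
      unfolding fejer_def by simp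
    also have "(\<Sum>a\<in>?I. if a \<in> J then torus_char m n p else 0) = of_nat (card J) * torus_char m n p"
      using J by (simp add: sum.If_cases Int_absorb1)
    finally have fej: "fejer N (torus_char m n) p = of_nat (card J) * torus_char m n p / of_nat (N\<^sup>2)" .
    have cardJ: "card (?I - J) \<le> nat \<bar>m\<bar> * N + N * nat \<bar>n\<bar>"
    proof -
      \<comment> \<open>Contains the coordinates that leave \<open>{0..<N}\<close> when
        \<open>k\<close> is subtracted: the lowest ones for positive \<open>k\<close>, the highest
        for negative \<open>k\<close>.\<close>
      define M where "M k = (if 0 \<le> k then {0..<k} else {int N + k..<int N})" for k :: int
      have cM: "card (M k) = nat \<bar>k\<bar>" for k by (simp add: M_def)
      have "?I - J \<subseteq> M m \<times> {0..<int N} \<union> {0..<int N} \<times> M n"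
        by (auto simp: J_def fejer_index_def M_def)
      moreover have "finite (M m \<times> {0..<int N} \<union> {0..<int N} \<times> M n)" by (simp add: M_def)
      ultimately have "card (?I - J) \<le> card (M m \<times> {0..<int N} \<union> {0..<int N} \<times> M n)"
        by (rule card_mono[rotated])
      also have "\<dots> \<le> card (M m \<times> {0..<int N}) + card ({0..<int N} \<times> M n)" by (rule card_Un_le)
      finally show ?thesis by (simp add: cM card_cartesian_product)
    qed
    have c: "real (card J) = real (N\<^sup>2) - real (card (?I - J))"
      using J card_mono[OF _ J(2)] by (simp add: card_Diff_subset of_nat_diff)
    have "norm (fejer N (torus_char m n) p - torus_char m n p) = real (card (?I - J)) / real (N\<^sup>2)"
    proof -
      have "fejer N (torus_char m n) p - torus_char m n p = of_real ((real (card J) - real (N\<^sup>2)) / real (N\<^sup>2)) * torus_char m n p"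
        using N unfolding fej by (simp add: field_simps)
      then have "norm (fejer N (torus_char m n) p - torus_char m n p) = \<bar>(real (card J) - real (N\<^sup>2)) / real (N\<^sup>2)\<bar>"
        using norm_torus_char[OF p] by (simp only: norm_mult norm_of_real)
      then show ?thesis by (simp add: c)
    qed
    also have "\<dots> \<le> real (nat \<bar>m\<bar> * N + N * nat \<bar>n\<bar>) / real (N\<^sup>2)"
      using cardJ by (intro divide_right_mono) (auto simp del: of_nat_add of_nat_mult)
    also have "\<dots> = (of_int \<bar>m\<bar> + of_int \<bar>n\<bar>) / real N"
      using N by (simp add: power2_eq_square field_simps)
    also have "\<dots> \<le> e"
    proof -
      have "(of_int \<bar>m\<bar> + of_int \<bar>n\<bar>) / e \<le> real N" using N0 N by linarith
      then show ?thesis using assms N by (simp add: field_simps)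
    qed
    finally show "norm (fejer N (torus_char m n) p - torus_char m n p) \<le> e" .
  qed
qed

lemma norm_scaled_diff_le:
  fixes a b c :: "'a::real_normed_field"
  assumes "norm (a - b) \<le> e / (norm c + 1)"
  shows "norm (c * a - c * b) \<le> e"
proof -
  have c: "0 < norm c + 1" using norm_ge_zero[of c] by linarith
  have "norm (c * a - c * b) = norm c * norm (a - b)" by (simp add: norm_mult flip: right_diff_distrib)
  also have "\<dots> \<le> (norm c + 1) * (e / (norm c + 1))" using assms c by (intro mult_mono) auto
  finally show ?thesis using c by simp
qed

lemma fejer_trig_poly_converges:
  assumes "f \<in> trig_poly" "0 < e"
  shows "\<exists>N0. \<forall>N\<ge>N0. \<forall>p\<in>T2. norm (fejer N f p - f p) \<le> e"
  using assms
proof (induction arbitrary: e rule: trig_poly.induct)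
  case (char c m n)
  then have "0 < e / (norm c + 1)" by (simp add: add_nonneg_pos)
  then obtain N0 where N0: "\<forall>N\<ge>N0. \<forall>p\<in>T2. norm (fejer N (torus_char m n) p - torus_char m n p) \<le> e / (norm c + 1)"
    using fejer_torus_char_converges by blast
  then show ?case
    by (intro exI[of _ N0]) (simp add: fejer_mult_left norm_scaled_diff_le)
next
  case (add f g)
  then obtain N1 N2 where N: "\<forall>N\<ge>N1. \<forall>p\<in>T2. norm (fejer N f p - f p) \<le> e/2"
    "\<forall>N\<ge>N2. \<forall>p\<in>T2. norm (fejer N g p - g p) \<le> e/2"
    by (meson half_gt_zero)
  show ?case
  proof (intro exI[of _ "max N1 N2"] allI impI ballI)
    fix N p assume Np: "max N1 N2 \<le> N" "p \<in> T2"
    have "fejer N (\<lambda>p. f p + g p) p - (f p + g p) = (fejer N f p - f p) + (fejer N g p - g p)"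
      using add by (simp add: fejer_add continuous_on_trig_poly)
    then have "norm (fejer N (\<lambda>p. f p + g p) p - (f p + g p)) \<le> norm (fejer N f p - f p) + norm (fejer N g p - g p)"
      by (metis norm_triangle_ineq)
    also have "\<dots> \<le> e/2 + e/2" using N Np by (intro add_mono) auto
    finally show "norm (fejer N (\<lambda>p. f p + g p) p - (f p + g p)) \<le> e" by simp
  qed
qed

lemma trig_poly_mult:
  assumes "f \<in> trig_poly" "g \<in> trig_poly"
  shows "\<exists>h\<in>trig_poly. \<forall>p\<in>T2. h p = f p * g p"
  using assms
proof (induction rule: trig_poly.induct)
  case (char c m n)
  from char show ?case
  proof (induction rule: trig_poly.induct)
    case (char c' m' n')
    show ?case
      by (rule bexI[of _ "\<lambda>p. (c * c') * torus_char (m + m') (n + n') p"])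
        (auto simp: torus_char_add intro: trig_poly.char)
  next
    case (add f g)
    then obtain h1 h2 where "h1 \<in> trig_poly" "h2 \<in> trig_poly"
      "\<forall>p\<in>T2. h1 p = c * torus_char m n p * f p" "\<forall>p\<in>T2. h2 p = c * torus_char m n p * g p" by blast
    then show ?case
      by (intro bexI[of _ "\<lambda>p. h1 p + h2 p"]) (auto simp: algebra_simps intro: trig_poly.add)
  qed
next
  case (add f1 f2)
  then obtain h1 h2 where "h1 \<in> trig_poly" "h2 \<in> trig_poly"
    "\<forall>p\<in>T2. h1 p = f1 p * g p" "\<forall>p\<in>T2. h2 p = f2 p * g p" by blast
  then show ?case
    by (intro bexI[of _ "\<lambda>p. h1 p + h2 p"]) (auto simp: algebra_simps intro: trig_poly.add)
qed

text \<open>The linear case carries the content: real and imaginary part of a coordinate are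
  combinations of the coordinate and its conjugate, which on the torus is again a character.\<close>

lemma real_polynomial_function_trig_poly:
  assumes "real_polynomial_function (f :: complex \<times> complex \<Rightarrow> real)"
  shows "\<exists>h\<in>trig_poly. \<forall>p\<in>T2. h p = of_real (f p)"
  using assms
proof (induction rule: real_polynomial_function.induct)
  case (linear f)
  then interpret bounded_linear f .
  \<comment> \<open>Values of \<open>f\<close> on the real basis, to be used in \<open>a * Re z + b
    * Im z = ((a - \<i> * b) * z + (a + \<i> * b) * cnj z) / 2\<close>.\<close>
  define A where "A = complex_of_real (f (1, 0))"
  define B where "B = complex_of_real (f (\<i>, 0))"
  define C where "C = complex_of_real (f (0, 1))"
  define D where "D = complex_of_real (f (0, \<i>))"
  define h where "h p = (((A - \<i> * B) / 2 * torus_char 1 0 p + (A + \<i> * B) / 2 * torus_char (-1) 0 p)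
      + ((C - \<i> * D) / 2 * torus_char 0 1 p + (C + \<i> * D) / 2 * torus_char 0 (-1) p))" for p
  have "h \<in> trig_poly" unfolding h_def[abs_def] by (intro trig_poly.intros)
  moreover have "h p = of_real (f p)" if p: "p \<in> T2" for p
  proof -
    obtain z w where zw: "p = (z, w)" by (cases p)
    have "p = Re z *\<^sub>R (1, 0) + Im z *\<^sub>R (\<i>, 0) + Re w *\<^sub>R (0, 1) + Im w *\<^sub>R (0, \<i>)"
      by (simp add: zw complex_eq_iff)
    then have "f p = Re z * f (1, 0) + Im z * f (\<i>, 0) + Re w * f (0, 1) + Im w * f (0, \<i>)"
      by (metis add scaleR real_scaleR_def)
    moreover have "torus_char 1 0 p = z" "torus_char (-1) 0 p = cnj z" "torus_char 0 1 p = w" "torus_char 0 (-1) p = cnj w"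
      using cnj_torus_char[OF p, of 1 0] cnj_torus_char[OF p, of 0 1] by (auto simp: torus_char_def zw)
    ultimately show ?thesis
      by (simp add: h_def complex_eq_iff A_def B_def C_def D_def algebra_simps add_divide_distrib diff_divide_distrib)
  qed
  ultimately show ?case by blast
next
  case (const c)
  show ?case by (rule bexI[of _ "\<lambda>p. of_real c * torus_char 0 0 p"]) (auto intro: trig_poly.char simp del: torus_char_0, simp)
next
  case (add f g)
  then obtain h1 h2 where "h1 \<in> trig_poly" "h2 \<in> trig_poly"
    "\<forall>p\<in>T2. h1 p = of_real (f p)" "\<forall>p\<in>T2. h2 p = of_real (g p)" by blast
  then show ?case by (intro bexI[of _ "\<lambda>p. h1 p + h2 p"]) (auto intro: trig_poly.add)
next
  case (mult f g)
  then obtain h1 h2 where h: "h1 \<in> trig_poly" "h2 \<in> trig_poly"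
    "\<forall>p\<in>T2. h1 p = of_real (f p)" "\<forall>p\<in>T2. h2 p = of_real (g p)" by blast
  then obtain h where "h \<in> trig_poly" "\<forall>p\<in>T2. h p = h1 p * h2 p" using trig_poly_mult by blast
  then show ?case using h by (intro bexI[of _ h]) auto
qed

lemma trig_poly_dense:
  assumes "continuous_on T2 f" "0 < e"
  shows "\<exists>h\<in>trig_poly. \<forall>p\<in>T2. norm (f p - h p) < e"
proof -
  obtain g where g: "polynomial_function g" "\<forall>p\<in>T2. norm (f p - g p) < e"
    using Stone_Weierstrass_polynomial_function[OF compact_T2 assms] by blast
  have "real_polynomial_function (Re \<circ> g)" "real_polynomial_function (Im \<circ> g)"
    using g(1) bounded_linear_Re bounded_linear_Im by (auto simp: polynomial_function_def)
  from this[THEN real_polynomial_function_trig_poly]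
  obtain h1 h2 where h: "h1 \<in> trig_poly" "h2 \<in> trig_poly"
    "\<forall>p\<in>T2. h1 p = of_real ((Re \<circ> g) p)" "\<forall>p\<in>T2. h2 p = of_real ((Im \<circ> g) p)"
    by (elim bexE)
  have "(\<lambda>p. \<i> * torus_char 0 0 p) \<in> trig_poly" by (rule trig_poly.char)
  then obtain h3 where h3: "h3 \<in> trig_poly" "\<forall>p\<in>T2. h3 p = \<i> * torus_char 0 0 p * h2 p"
    using trig_poly_mult h(2) by blast
  have "h1 p + h3 p = g p" if "p \<in> T2" for p
  proof -
    have "h1 p + h3 p = of_real (Re (g p)) + \<i> * of_real (Im (g p))"
      using h(3,4) h3(2) that by simp
    then show ?thesis by (simp only: complex_eq[of "g p", symmetric])
  qed
  then have "\<forall>p\<in>T2. norm (f p - (h1 p + h3 p)) < e" using g(2) by simp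
  then show ?thesis
    by (rule bexI[where x = "\<lambda>p. h1 p + h3 p"]) (rule trig_poly.add[OF h(1) h3(1)])
qed

text \<open>Density alone yields trigonometric polynomials with uncontrolled frequencies. Fejer
  means use only frequencies present in \<open>f\<close>, which is what keeps approximants of
  elements of the algebra inside it; contractivity carries convergence over from the dense
  set.\<close>

lemma fejer_converges:
  assumes f: "continuous_on T2 f" and e: "0 < e"
  shows "\<exists>N. \<forall>p\<in>T2. norm (fejer N f p - f p) \<le> e"
proof -
  obtain h where h: "h \<in> trig_poly" "\<forall>p\<in>T2. norm (f p - h p) < e/3"
    using trig_poly_dense[OF f, of "e/3"] e by auto
  obtain N where N: "\<forall>p\<in>T2. norm (fejer N h p - h p) \<le> e/3"
    using fejer_trig_poly_converges[OF h(1), of "e/3"] e by auto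
  have ch: "continuous_on T2 h" using h(1) by (rule continuous_on_trig_poly)
  show ?thesis
  proof (intro exI[of _ N] ballI)
    fix p assume p: "p \<in> T2"
    have "fejer N f p = fejer N (\<lambda>p. (f p + (-1) * h p) + h p) p" by simp
    also have "\<dots> = fejer N (\<lambda>p. f p + (-1) * h p) p + fejer N h p"
      using f ch by (subst fejer_add) (auto intro!: continuous_intros)
    finally have eq: "fejer N f p - f p = fejer N (\<lambda>p. f p + (-1) * h p) p + (fejer N h p - h p) - (f p - h p)"
      by simp
    have "norm (fejer N (\<lambda>p. f p + (-1) * h p) p) \<le> e/3"
      using f ch h(2) p by (intro fejer_norm_le) (auto intro!: continuous_intros less_imp_le)
    moreover have "norm (fejer N h p - h p) \<le> e/3" "norm (f p - h p) \<le> e/3"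
      using N h(2) p by (auto intro: less_imp_le)
    ultimately show "norm (fejer N f p - f p) \<le> e"
      unfolding eq using norm_triangle_ineq4[of "fejer N (\<lambda>p. f p + (-1) * h p) p + (fejer N h p - h p)" "f p - h p"]
        norm_triangle_ineq[of "fejer N (\<lambda>p. f p + (-1) * h p) p" "fejer N h p - h p"] by linarith
  qed
qed

section \<open>Units and stabilizing matrices\<close>

text \<open>Good rational approximations keep \<open>h\<^sup>2 - D * k\<^sup>2\<close> bounded on
  infinitely many reduced pairs. Pigeonhole fixes first this value \<open>n\<close> and then the
  residues modulo \<open>n\<close>; the quotient of two such pairs is integral of norm 1.\<close>

lemma pell_solution_exists:
  fixes \<theta> :: real and D :: int
  assumes irr: "\<theta> \<notin> \<rat>" and sq: "\<theta>\<^sup>2 = of_int D"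
  obtains x y :: int where "y \<noteq> 0" "x\<^sup>2 - D * y\<^sup>2 = 1"
proof -
  define S where "S = approx_set \<theta>"
  have infS: "infinite S" unfolding S_def using rational_iff_finite_approx_set irr by blast
  have S: "0 < k \<and> coprime h k \<and> \<bar>\<theta> - of_int h / of_int k\<bar> < 1 / (of_int k)\<^sup>2" if "(h, k) \<in> S" for h k
    using that by (simp add: S_def approx_set_def)
  \<comment> \<open>For \<open>d = h - \<theta> * k\<close> both \<open>\<bar>d\<bar> * k\<close>
    and \<open>\<bar>d\<bar>\<close> are at most 1, so
    \<open>h\<^sup>2 - D * k\<^sup>2 = d * (d + 2 * \<theta> * k)\<close> has modulus at most
    \<open>1 + 2 * \<bar>\<theta>\<bar>\<close>.\<close>
  define M where "M = \<lceil>2 * \<bar>\<theta>\<bar> + 1\<rceil>"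
  define N where "N = (\<lambda>(h, k). h\<^sup>2 - D * k\<^sup>2 :: int)"
  have N_bound: "N p \<in> {- M..M}" if pS: "p \<in> S" for p
  proof -
    obtain h k where p: "p = (h, k)" by (cases p)
    have k: "0 < k" and ap: "\<bar>\<theta> - of_int h / of_int k\<bar> < 1 / (of_int k)\<^sup>2" using S pS p by auto
    define d where "d = of_int h - \<theta> * of_int k"
    have k1: "1 \<le> real_of_int k" using k by simp
    have "\<bar>d\<bar> = \<bar>\<theta> - of_int h / of_int k\<bar> * of_int k"
    proof -
      have "d = - (\<theta> - of_int h / of_int k) * of_int k" using k by (simp add: d_def field_simps)
      then show ?thesis using k by (simp add: abs_mult)
    qed
    also have "\<dots> \<le> 1 / (of_int k)\<^sup>2 * of_int k" using ap k by (intro mult_right_mono) auto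
    finally have d1: "\<bar>d\<bar> * of_int k \<le> 1" using k by (simp add: power2_eq_square field_simps)
    have d2: "\<bar>d\<bar> \<le> 1" using d1 k1 by (smt (verit) mult_left_mono abs_ge_zero mult_cancel_left1)
    have "real_of_int (N p) = d * (d + 2 * \<theta> * of_int k)"
      using sq by (simp add: N_def p d_def power2_eq_square algebra_simps)
    then have "\<bar>real_of_int (N p)\<bar> = \<bar>d\<bar> * \<bar>d + 2 * \<theta> * of_int k\<bar>" by (simp add: abs_mult)
    also have "\<dots> \<le> \<bar>d\<bar> * (\<bar>d\<bar> + 2 * \<bar>\<theta>\<bar> * of_int k)"
      using k abs_triangle_ineq[of d "2 * \<theta> * of_int k"] by (intro mult_left_mono) (auto simp: abs_mult)
    also have "\<dots> = \<bar>d\<bar> * \<bar>d\<bar> + 2 * \<bar>\<theta>\<bar> * (\<bar>d\<bar> * of_int k)" by (simp add: algebra_simps)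
    also have "\<dots> \<le> 1 + 2 * \<bar>\<theta>\<bar> * 1"
      using mult_le_one[OF d2 abs_ge_zero d2] mult_left_mono[OF d1, of "2 * \<bar>\<theta>\<bar>"] by simp
    also have "\<dots> \<le> real_of_int M" unfolding M_def by linarith
    finally show ?thesis by (simp only: atLeastAtMost_iff) linarith
  qed
  then have "finite (N ` S)" using finite_subset[of "N ` S" "{- M..M}"] by blast
  then obtain p0 where p0: "p0 \<in> S" "infinite {p \<in> S. N p = N p0}"
    using pigeonhole_infinite[OF infS, of N] by blast
  define n where "n = N p0"
  define S' where "S' = {p \<in> S. N p = n}"
  have infS': "infinite S'" using p0 by (simp add: S'_def n_def)
  have n0: "n \<noteq> 0"
  proof
    assume "n = 0"
    obtain h k where p: "p0 = (h, k)" by (cases p0)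
    then have k: "0 < k" using S p0 by blast
    have "(of_int h)\<^sup>2 = (\<theta> * of_int k)\<^sup>2"
      using \<open>n = 0\<close> sq by (simp add: n_def N_def p power_mult_distrib flip: of_int_power of_int_mult)
    then have "\<bar>of_int h\<bar> = \<bar>\<theta>\<bar> * of_int k"
      using k by (metis abs_mult abs_of_pos of_int_0_less_iff power2_eq_iff abs_minus_cancel)
    then have "\<bar>\<theta>\<bar> = of_int \<bar>h\<bar> / of_int k" using k by (simp add: field_simps)
    then have "\<bar>\<theta>\<bar> \<in> \<rat>" by simp
    then show False using irr by (simp add: abs_if split: if_splits)
  qed
  define R where "R = (\<lambda>(h, k). (h mod n, k mod n) :: int \<times> int)"
  have "R p \<in> {- \<bar>n\<bar>..\<bar>n\<bar>} \<times> {- \<bar>n\<bar>..\<bar>n\<bar>}" for p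
  proof -
    have "h mod n \<in> {- \<bar>n\<bar>..\<bar>n\<bar>}" for h
      using abs_mod_less[OF n0, of h] by (simp only: atLeastAtMost_iff) linarith
    then show ?thesis by (cases p) (simp add: R_def del: atLeastAtMost_iff)
  qed
  then have "finite (R ` S')" using finite_subset[of "R ` S'" "{- \<bar>n\<bar>..\<bar>n\<bar>} \<times> {- \<bar>n\<bar>..\<bar>n\<bar>}"] by blast
  then obtain p1 where p1: "p1 \<in> S'" "infinite {p \<in> S'. R p = R p1}"
    using pigeonhole_infinite[OF infS', of R] by blast
  then have "\<not> {p \<in> S'. R p = R p1} \<subseteq> {p1}" using finite_subset by blast
  then obtain p2 where p2: "p2 \<in> S'" "R p2 = R p1" "p2 \<noteq> p1" by blast
  obtain h1 k1 h2 k2 where hk: "p1 = (h1, k1)" "p2 = (h2, k2)" by (cases p1, cases p2)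
  have N1: "h1\<^sup>2 - D * k1\<^sup>2 = n" and N2: "h2\<^sup>2 - D * k2\<^sup>2 = n"
    using p1 p2 by (auto simp: S'_def N_def hk)
  have "n dvd h2 - h1" "n dvd k2 - k1"
    using p2(2) by (simp_all add: R_def hk mod_eq_dvd_iff)
  then obtain u v where "h2 - h1 = n * u" "k2 - k1 = n * v" by (elim dvdE)
  then have uv: "h2 = h1 + n * u" "k2 = k1 + n * v" by (simp_all add: algebra_simps)
  \<comment> \<open>\<open>x - y * \<theta>\<close> is the quotient
    \<open>(h2 + k2 * \<theta>) / (h1 + k1 * \<theta>)\<close>; the congruences allow the division
    by \<open>n\<close>.\<close>
  define x where "x = 1 + h1 * u - D * k1 * v"
  define y where "y = k1 * u - h1 * v"
  have nx: "n * x = h1 * h2 - D * k1 * k2"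
    unfolding x_def uv using N1 by (simp add: algebra_simps power2_eq_square)
  have ny: "n * y = k1 * h2 - h1 * k2"
    unfolding y_def uv by (simp add: algebra_simps)
  have "n\<^sup>2 * (x\<^sup>2 - D * y\<^sup>2) = (n * x)\<^sup>2 - D * (n * y)\<^sup>2" by (simp add: algebra_simps power_mult_distrib)
  also have "\<dots> = (h1\<^sup>2 - D * k1\<^sup>2) * (h2\<^sup>2 - D * k2\<^sup>2)"
    unfolding nx ny by (simp add: algebra_simps power2_eq_square)
  also have "\<dots> = n\<^sup>2 * 1" unfolding N1 N2 by (simp add: power2_eq_square)
  finally have "x\<^sup>2 - D * y\<^sup>2 = 1" using n0 by simp
  \<comment> \<open>\<open>y = 0\<close> means \<open>h1 / k1 = h2 / k2\<close>; both fractions are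
    reduced with positive denominators, so the two pairs would coincide.\<close>
  moreover have "y \<noteq> 0"
  proof
    assume "y = 0"
    then have e: "k1 * h2 = h1 * k2" using ny by simp
    have pos: "0 < k1" "0 < k2" and cop: "coprime h1 k1" "coprime h2 k2"
      using S p1 p2 by (auto simp: S'_def hk)
    have "k1 dvd k2" using e cop by (metis coprime_commute coprime_dvd_mult_right_iff dvd_triv_left)
    moreover have "k2 dvd k1" using e cop by (metis coprime_commute coprime_dvd_mult_left_iff dvd_triv_right)
    ultimately have "k1 = k2" using pos zdvd_antisym_nonneg by simp
    then show False using e pos p2(3) by (simp add: hk)
  qed
  ultimately show ?thesis using that by blast
qed

section \<open>Matrices that preserve the half-plane of exponents\<close>

context
  fixes \<alpha> :: real
begin

abbreviation \<A> :: "(complex \<times> complex \<Rightarrow> complex) set" where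
  "\<A> \<equiv> Aalpha \<alpha>"

text \<open>\<open>eigval A\<close> is the eigenvalue of \<open>(1, \<alpha>)\<close> if that is an eigenvector of \<open>A\<close>. The matrices in
  \<open>cone_stabilizer\<close>, multiplied from the right, are those preserving the half-plane \<open>m + \<alpha> n \<ge> 0\<close> of exponents.\<close>

definition eigval :: "int^2^2 \<Rightarrow> real" where
  "eigval A = of_int (A$1$1) + \<alpha> * of_int (A$1$2)"

definition cone_stabilizer :: "(int^2^2) set" where
  "cone_stabilizer = {A \<in> GL2Z. 0 < eigval A \<and> of_int (A$2$1) + \<alpha> * of_int (A$2$2) = eigval A * \<alpha>}"

lemma mat2_eq_iff: "A = B \<longleftrightarrow> A$1$1 = B$1$1 \<and> A$1$2 = B$1$2 \<and> A$2$1 = B$2$1 \<and> A$2$2 = B$2$2" for A B :: "'a^2^2"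
  by (auto simp: vec_eq_iff forall_2)

lemma mat2_mult:
  fixes A B :: "'a::semiring_1^2^2"
  shows "(A ** B)$i$j = A$i$1 * B$1$j + A$i$2 * B$2$j"
  by (simp add: matrix_matrix_mult_def sum_2)

lemma mat2_one: "(mat 1 :: 'a::{zero,one}^2^2)$1$1 = 1" "(mat 1 :: 'a^2^2)$1$2 = 0" "(mat 1 :: 'a^2^2)$2$1 = 0" "(mat 1 :: 'a^2^2)$2$2 = 1"
  by (simp_all add: mat_def)

lemma irrational_lin_indep:
  assumes "\<alpha> \<notin> \<rat>" "of_int a + \<alpha> * of_int b = of_int a' + \<alpha> * of_int b'"
  shows "a = a' \<and> b = b'"
proof -
  have "b = b'"
  proof (rule ccontr)
    assume "b \<noteq> b'"
    then have "\<alpha> = of_int (a' - a) / of_int (b - b')" using assms(2) by (simp add: field_simps)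
    then have "\<alpha> \<in> \<rat>" by (metis Rats_divide Rats_of_int)
    then show False using assms(1) by blast
  qed
  then show ?thesis using assms(2) by simp
qed

text \<open>The rows are the coordinates of the eigenvalue and of \<alpha> times the eigenvalue in
  the rational basis \<open>1, \<alpha>\<close>. So \<open>eigval\<close> embeds the stabilizer into
  the positive reals.\<close>

lemma cone_stabilizer_eqI:
  assumes "\<alpha> \<notin> \<rat>" "A \<in> cone_stabilizer" "B \<in> cone_stabilizer" "eigval A = eigval B"
  shows "A = B"
proof -
  have "of_int (A$2$1) + \<alpha> * of_int (A$2$2) = of_int (B$2$1) + \<alpha> * of_int (B$2$2)"
    using assms(2-4) by (simp add: cone_stabilizer_def)
  moreover have "of_int (A$1$1) + \<alpha> * of_int (A$1$2) = of_int (B$1$1) + \<alpha> * of_int (B$1$2)"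
    using assms(4) by (simp add: eigval_def)
  ultimately show ?thesis
    unfolding mat2_eq_iff using irrational_lin_indep[OF assms(1)] by blast
qed

lemma cone_stabilizer_mult:
  assumes "A \<in> cone_stabilizer" "B \<in> cone_stabilizer"
  shows "A ** B \<in> cone_stabilizer" and "eigval (A ** B) = eigval A * eigval B"
proof -
  have e: "of_int (B$2$1) + \<alpha> * of_int (B$2$2) = eigval B * \<alpha>"
    and eA: "of_int (A$2$1) + \<alpha> * of_int (A$2$2) = eigval A * \<alpha>"
    using assms by (auto simp: cone_stabilizer_def)
  have row: "of_int ((A ** B)$i$1) + \<alpha> * of_int ((A ** B)$i$2) = (of_int (A$i$1) + \<alpha> * of_int (A$i$2)) * eigval B" for i
  proof -
    have "of_int ((A ** B)$i$1) + \<alpha> * of_int ((A ** B)$i$2)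
        = of_int (A$i$1) * eigval B + of_int (A$i$2) * (of_int (B$2$1) + \<alpha> * of_int (B$2$2))"
      by (simp add: mat2_mult eigval_def algebra_simps)
    then show ?thesis unfolding e by (simp add: algebra_simps)
  qed
  show ev: "eigval (A ** B) = eigval A * eigval B"
    using row[of 1] by (simp add: eigval_def)
  have e2: "of_int ((A ** B)$2$1) + \<alpha> * of_int ((A ** B)$2$2) = eigval (A ** B) * \<alpha>"
    unfolding row eA ev by (simp add: algebra_simps)
  have "0 < eigval (A ** B)" unfolding ev using assms by (simp add: cone_stabilizer_def)
  moreover have "A ** B \<in> GL2Z" using assms by (auto simp: cone_stabilizer_def GL2Z_def det_mul)
  ultimately show "A ** B \<in> cone_stabilizer"
    using e2 by (simp add: cone_stabilizer_def)
qed

lemma mat_1_in_cone_stabilizer: "mat 1 \<in> cone_stabilizer" and eigval_mat_1: "eigval (mat 1) = 1"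
  by (auto simp: cone_stabilizer_def GL2Z_def eigval_def mat2_one)

lemma cone_stabilizer_inverse:
  assumes "A \<in> cone_stabilizer"
  obtains B where "B \<in> cone_stabilizer" "A ** B = mat 1" "B ** A = mat 1" "eigval B = 1 / eigval A"
proof -
  define d where "d = det A"
  have d: "d = A$1$1 * A$2$2 - A$1$2 * A$2$1" by (simp add: d_def det_2)
  have dd: "d * d = 1" using assms by (auto simp: d_def cone_stabilizer_def GL2Z_def)
  \<comment> \<open>The adjugate times the determinant, which is its own inverse.\<close>
  define B :: "int^2^2" where "B = (\<chi> i j. if i = 1 then (if j = 1 then d * A$2$2 else - d * A$1$2) else (if j = 1 then - d * A$2$1 else d * A$1$1))"
  have B: "B$1$1 = d * A$2$2" "B$1$2 = - d * A$1$2" "B$2$1 = - d * A$2$1" "B$2$2 = d * A$1$1"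
    by (simp_all add: B_def)
  have "d * d = d * (A$1$1 * A$2$2 - A$1$2 * A$2$1)" by (simp add: d)
  then have dd': "d * (A$1$1 * A$2$2) = 1 + d * (A$1$2 * A$2$1)" using dd by (simp add: algebra_simps)
  have AB: "A ** B = mat 1" and BA: "B ** A = mat 1"
    unfolding mat2_eq_iff mat2_mult B mat2_one using dd' by (simp_all add: algebra_simps)
  have ev: "0 < eigval A" "of_int (A$2$1) + \<alpha> * of_int (A$2$2) = eigval A * \<alpha>"
    using assms by (auto simp: cone_stabilizer_def)
  have "det B = (d * d) * (A$1$1 * A$2$2 - A$1$2 * A$2$1)" by (simp add: det_2 B algebra_simps)
  then have detB: "det B = d" using dd d by simp
  have row: "of_int (B$i$1) * eigval A + of_int (B$i$2) * (eigval A * \<alpha>)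
      = of_int ((B ** A)$i$1) + \<alpha> * of_int ((B ** A)$i$2)" for i
    unfolding ev(2)[symmetric] by (simp add: mat2_mult eigval_def algebra_simps)
  have r1: "eigval B * eigval A = 1"
    using row[of 1] by (simp add: BA mat2_one) (simp add: eigval_def algebra_simps)
  have r2: "(of_int (B$2$1) + \<alpha> * of_int (B$2$2)) * eigval A = \<alpha>"
    using row[of 2] by (simp add: BA mat2_one algebra_simps)
  have eB: "eigval B = 1 / eigval A" using r1 ev(1) by (simp add: field_simps)
  have "of_int (B$2$1) + \<alpha> * of_int (B$2$2) = eigval B * \<alpha>"
    using r2 ev(1) unfolding eB by (simp add: field_simps)
  then have "B \<in> cone_stabilizer"
    using ev(1) eB dd detB zmult_eq_1_iff[of d d] by (auto simp: cone_stabilizer_def GL2Z_def)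
  then show ?thesis using that AB BA eB by blast
qed

text \<open>The eigenvector condition is a quadratic equation for \<alpha> with leading coefficient
  \<open>A$1$2\<close>. When all its coefficients vanish, the matrix is scalar, and positivity of
  the eigenvalue leaves the identity.\<close>

lemma cone_stabilizer_trivial:
  assumes "\<alpha> \<notin> \<rat>" "\<not> quadratic_irrational \<alpha>"
  shows "cone_stabilizer = {mat 1}"
proof -
  have "A = mat 1" if A: "A \<in> cone_stabilizer" for A
  proof -
    have e: "of_int (A$2$1) + \<alpha> * of_int (A$2$2) = eigval A * \<alpha>" and pos: "0 < eigval A"
      and det: "det A = 1 \<or> det A = -1"
      using A by (auto simp: cone_stabilizer_def GL2Z_def)
    have "of_int (A$1$2) * \<alpha>\<^sup>2 + of_int (A$1$1 - A$2$2) * \<alpha> + of_int (- A$2$1) = 0"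
      using e by (simp add: eigval_def power2_eq_square algebra_simps)
    then have b: "A$1$2 = 0" using assms unfolding quadratic_irrational_def by blast
    then have "of_int (A$2$1) + \<alpha> * of_int (A$2$2) = of_int 0 + \<alpha> * of_int (A$1$1)"
      using e by (simp add: eigval_def)
    then have "A$2$1 = 0" "A$2$2 = A$1$1" using irrational_lin_indep[OF assms(1)] by blast+
    then have "A$1$1 * A$1$1 = 1 \<or> A$1$1 * A$1$1 = - 1" using det b by (simp add: det_2)
    moreover have "A$1$1 * A$1$1 \<ge> 0" by simp
    ultimately have "A$1$1 * A$1$1 = 1" by linarith
    then have "A$1$1 = 1 \<or> A$1$1 = -1" using zmult_eq_1_iff by blast
    moreover have "0 < A$1$1" using pos b by (simp add: eigval_def)
    ultimately have "A$1$1 = 1" by linarith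
    then show ?thesis using b \<open>A$2$1 = 0\<close> \<open>A$2$2 = A$1$1\<close> by (simp add: mat2_eq_iff mat2_one)
  qed
  then show ?thesis using mat_1_in_cone_stabilizer by blast
qed

text \<open>A nontrivial Pell unit acts by multiplication on the lattice spanned by 1 and \<alpha>;
  either it or its inverse exceeds 1.\<close>

lemma cone_stabilizer_nontrivial:
  assumes "quadratic_irrational \<alpha>"
  obtains A where "A \<in> cone_stabilizer" "1 < eigval A"
proof -
  obtain e f g :: int where irr: "\<alpha> \<notin> \<rat>" and e0: "e \<noteq> 0" and eq: "of_int e * \<alpha>\<^sup>2 + of_int f * \<alpha> + of_int g = 0"
    using assms by (auto simp: quadratic_irrational_def)
  define \<theta> where "\<theta> = 2 * of_int e * \<alpha> + of_int f"
  define D where "D = f\<^sup>2 - 4 * e * g"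
  have "\<theta>\<^sup>2 = 4 * of_int e * (of_int e * \<alpha>\<^sup>2 + of_int f * \<alpha> + of_int g) + of_int D"
    by (simp add: \<theta>_def D_def power2_eq_square algebra_simps)
  then have sq: "\<theta>\<^sup>2 = of_int D" by (simp add: eq)
  have "\<theta> \<notin> \<rat>"
  proof
    assume "\<theta> \<in> \<rat>"
    then have "(\<theta> - of_int f) / of_int (2 * e) \<in> \<rat>" by (intro Rats_divide Rats_diff) auto
    moreover have "(\<theta> - of_int f) / of_int (2 * e) = \<alpha>" using e0 by (simp add: \<theta>_def)
    ultimately show False using irr by simp
  qed
  then obtain x0 y where y: "y \<noteq> 0" and p0: "x0\<^sup>2 - D * y\<^sup>2 = 1"
    using pell_solution_exists[of \<theta> D] sq by metis
  \<comment> \<open>With this sign \<open>x\<close> exceeds the modulus of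
    \<open>y * \<theta>\<close>, so the eigenvalue is positive.\<close>
  define x where "x = \<bar>x0\<bar>"
  have p: "x\<^sup>2 - D * y\<^sup>2 = 1" and x0: "0 \<le> x" using p0 by (auto simp: x_def)
  \<comment> \<open>Matrix of multiplication by \<open>x + y * \<theta>\<close> in the basis
    \<open>1, \<alpha>\<close>, where \<open>\<alpha>\<^sup>2\<close> has been eliminated by the
    quadratic equation; its determinant is the norm
    \<open>x\<^sup>2 - D * y\<^sup>2\<close>.\<close>
  define A :: "int^2^2" where "A = (\<chi> i j. if i = 1 then (if j = 1 then x + y * f else 2 * e * y) else (if j = 1 then - 2 * g * y else x - f * y))"
  have A: "A$1$1 = x + y * f" "A$1$2 = 2 * e * y" "A$2$1 = - 2 * g * y" "A$2$2 = x - f * y"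
    by (simp_all add: A_def)
  have "det A = x\<^sup>2 - D * y\<^sup>2"
    by (simp add: det_2 A D_def power2_eq_square algebra_simps)
  then have det: "det A = 1" using p by simp
  have ev: "eigval A = of_int x + of_int y * \<theta>"
    by (simp add: eigval_def A \<theta>_def algebra_simps)
  have "(of_int y * \<theta>)\<^sup>2 < (of_int x)\<^sup>2"
  proof -
    have "real_of_int (x\<^sup>2 - D * y\<^sup>2) = 1" using p by simp
    then show ?thesis by (simp add: power_mult_distrib sq algebra_simps)
  qed
  then have "\<bar>of_int y * \<theta>\<bar> < of_int x" using x0 abs_le_square_iff[of "of_int x" "of_int y * \<theta>"] by (smt (verit) of_int_0_le_iff)
  then have pos: "0 < eigval A" unfolding ev by linarith
  have "of_int (A$2$1) + \<alpha> * of_int (A$2$2) - eigval A * \<alpha> = - 2 * of_int y * (of_int e * \<alpha>\<^sup>2 + of_int f * \<alpha> + of_int g)"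
    unfolding eigval_def A by (simp add: power2_eq_square algebra_simps)
  then have AS: "A \<in> cone_stabilizer"
    using det pos eq by (simp add: cone_stabilizer_def GL2Z_def)
  have ne: "eigval A \<noteq> 1"
  proof
    assume "eigval A = 1"
    then have "A = mat 1"
      using cone_stabilizer_eqI[OF irr AS mat_1_in_cone_stabilizer] eigval_mat_1 by simp
    then have "2 * e * y = 0" using A(2) by (simp add: mat2_one)
    then show False using e0 y by simp
  qed
  show ?thesis
  proof (cases "1 < eigval A")
    case True then show ?thesis using that AS by blast
  next
    case False
    obtain B where "B \<in> cone_stabilizer" "eigval B = 1 / eigval A"
      using cone_stabilizer_inverse[OF AS] by blast
    then show ?thesis using that[of B] False ne pos by simp
  qed
qed

text \<open>Discreteness: the eigenvalue \<open>l\<close> is a root of the characteristic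
  polynomial, whose constant term \<open>d\<close> is 1 or -1 and whose trace
  \<open>l + d / l\<close> is bounded by \<open>C + 1\<close>. Only finitely many polynomials
  qualify.\<close>

lemma finite_eigval_bounded:
  assumes \<alpha>: "\<alpha> \<noteq> 0"
  shows "finite {l. \<exists>A\<in>cone_stabilizer. l = eigval A \<and> 1 \<le> l \<and> l \<le> C}"
proof -
  have "finite {x::real. poly [:of_int d, - of_int t, 1:] x = 0}" for d t :: int
    by (rule poly_roots_finite) simp
  then have fin: "finite (\<Union>d\<in>{1,-1::int}. \<Union>t\<in>{- \<lceil>C + 1\<rceil>..\<lceil>C + 1\<rceil>}. {x::real. poly [:of_int d, - of_int t, 1:] x = 0})"
    by blast
  show ?thesis
  proof (rule finite_subset[OF _ fin], safe)
    fix A assume A: "A \<in> cone_stabilizer" and l1: "1 \<le> eigval A" and lC: "eigval A \<le> C"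
    define l where "l = eigval A"
    define t where "t = A$1$1 + A$2$2"
    define d where "d = det A"
    have d: "d = 1 \<or> d = -1" and e2: "of_int (A$2$1) + \<alpha> * of_int (A$2$2) = l * \<alpha>"
      using A by (auto simp: cone_stabilizer_def GL2Z_def d_def l_def)
    have "(l - of_int (A$1$1)) * (\<alpha> * (l - of_int (A$2$2))) = \<alpha> * (of_int (A$1$2) * of_int (A$2$1))"
    proof -
      have "l - of_int (A$1$1) = \<alpha> * of_int (A$1$2)" by (simp add: l_def eigval_def)
      moreover have "\<alpha> * (l - of_int (A$2$2)) = of_int (A$2$1)" using e2 by (simp add: algebra_simps)
      ultimately show ?thesis by simp
    qed
    then have "\<alpha> * ((l - of_int (A$1$1)) * (l - of_int (A$2$2)) - of_int (A$1$2) * of_int (A$2$1)) = 0"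
      by (simp add: algebra_simps)
    then have "(l - of_int (A$1$1)) * (l - of_int (A$2$2)) - of_int (A$1$2) * of_int (A$2$1) = 0"
      using \<alpha> by (simp only: mult_eq_0_iff) simp
    then have q: "of_int d - of_int t * l + l * l = 0"
      by (simp add: d_def det_2 t_def algebra_simps)
    have "of_int t = l + of_int d / l" using q l1 by (simp add: l_def field_simps)
    moreover have "\<bar>of_int d / l\<bar> \<le> 1" using d l1 by (auto simp: l_def)
    ultimately have "\<bar>real_of_int t\<bar> \<le> C + 1" using l1 lC unfolding l_def by linarith
    then have "t \<in> {- \<lceil>C + 1\<rceil>..\<lceil>C + 1\<rceil>}" by (simp only: atLeastAtMost_iff) linarith
    moreover have "poly [:of_int d, - of_int t, 1:] l = 0" using q by (simp add: algebra_simps)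
    ultimately show "eigval A \<in> (\<Union>d\<in>{1,-1::int}. \<Union>t\<in>{- \<lceil>C + 1\<rceil>..\<lceil>C + 1\<rceil>}. {x. poly [:of_int d, - of_int t, 1:] x = 0})"
      using d unfolding l_def by blast
  qed
qed

lemma cone_stabilizer_powi:
  assumes "A \<in> cone_stabilizer"
  shows "\<exists>B\<in>cone_stabilizer. eigval B = eigval A powi k"
proof -
  have nat: "\<exists>B\<in>cone_stabilizer. eigval B = eigval A ^ n" if "A \<in> cone_stabilizer" for A and n :: nat
  proof (induction n)
    case 0 show ?case using mat_1_in_cone_stabilizer eigval_mat_1 by (metis power_0)
  next
    case (Suc n) then show ?case using cone_stabilizer_mult[OF that] by (metis power_Suc)
  qed
  obtain A' where A': "A' \<in> cone_stabilizer" "eigval A' = 1 / eigval A"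
    using cone_stabilizer_inverse[OF assms] by blast
  show ?thesis
  proof (cases "0 \<le> k")
    case True
    then show ?thesis using nat[OF assms, of "nat k"] by (simp add: power_int_def)
  next
    case False
    then show ?thesis using nat[OF A'(1), of "nat (- k)"] A'(2) by (simp add: power_int_def inverse_eq_divide)
  qed
qed

text \<open>A nontrivial discrete group of positive reals is generated by its least element above 1.
  The least element is found among the finitely many eigenvalues up to one that is already
  known.\<close>

lemma cone_stabilizer_cyclic:
  assumes "quadratic_irrational \<alpha>"
  shows "\<exists>A\<in>cone_stabilizer. 1 < eigval A \<and> (\<forall>B\<in>cone_stabilizer. \<exists>k::int. eigval B = eigval A powi k)"
proof -
  have irr: "\<alpha> \<notin> \<rat>" using assms by (simp add: quadratic_irrational_def)
  then have \<alpha>: "\<alpha> \<noteq> 0" by auto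
  obtain A1 where A1: "A1 \<in> cone_stabilizer" "1 < eigval A1"
    using cone_stabilizer_nontrivial[OF assms] by blast
  define L where "L = {l. \<exists>A\<in>cone_stabilizer. l = eigval A \<and> 1 \<le> l \<and> l \<le> eigval A1} \<inter> {l. 1 < l}"
  have finL: "finite L" unfolding L_def using finite_eigval_bounded[OF \<alpha>] by blast
  have "eigval A1 \<in> L" using A1 by (auto simp: L_def)
  then have "Min L \<in> L" using Min_in[OF finL] by blast
  have Lmin: "\<And>l. l \<in> L \<Longrightarrow> Min L \<le> l" using finL by simp
  from \<open>Min L \<in> L\<close> obtain A where A: "A \<in> cone_stabilizer" "eigval A = Min L" "1 < eigval A" by (auto simp: L_def)
  have least: "eigval A \<le> eigval B" if "B \<in> cone_stabilizer" "1 < eigval B" for B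
  proof (cases "eigval B \<le> eigval A1")
    case True
    then have "eigval B \<in> L" using that by (auto simp: L_def)
    then show ?thesis using Lmin A by simp
  next
    case False
    then show ?thesis using Lmin[OF \<open>eigval A1 \<in> L\<close>] A by simp
  qed
  have "\<exists>k::int. eigval B = eigval A powi k" if B: "B \<in> cone_stabilizer" for B
  proof -
    define l where "l = eigval A"
    define b where "b = eigval B"
    have l: "1 < l" using A by (simp add: l_def)
    have b: "0 < b" using B by (simp add: b_def cone_stabilizer_def)
    \<comment> \<open>With this exponent \<open>b * l powi (- k)\<close> falls into the interval
      from 1 (included) to \<open>l\<close> (excluded), where minimality of \<open>l\<close> leaves
      only 1.\<close>
    define k where "k = \<lfloor>ln b / ln l\<rfloor>"
    obtain C where C: "C \<in> cone_stabilizer" "eigval C = l powi (- k)"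
      using cone_stabilizer_powi[OF A(1), of "- k"] by (auto simp: l_def)
    have BC: "B ** C \<in> cone_stabilizer" "eigval (B ** C) = b * l powi (- k)"
      using cone_stabilizer_mult[OF B C(1)] C(2) by (auto simp: b_def)
    have pw: "l powi j = exp (of_int j * ln l)" for j
      using l by (simp add: powr_real_of_int' powr_def flip: powr_real_of_int')
    have e: "b * l powi (- k) = exp (ln b - of_int k * ln l)"
      using b unfolding pw by (simp add: exp_diff exp_minus divide_inverse)
    have "0 < ln l" using l by simp
    then have "of_int k * ln l \<le> ln b" "ln b < (of_int k + 1) * ln l"
      unfolding k_def by (simp_all add: pos_le_divide_eq[symmetric] pos_divide_less_eq[symmetric])
    then have "1 \<le> b * l powi (- k)" "b * l powi (- k) < exp (ln l)"
      unfolding e by (auto simp: algebra_simps)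
    then have "1 \<le> b * l powi (- k)" "b * l powi (- k) < l" using l by auto
    then have "b * l powi (- k) = 1"
      using least[OF BC(1)] BC(2) unfolding l_def by fastforce
    then have "b = l powi k" using l by (simp add: power_int_minus field_simps)
    then show ?thesis by (auto simp: b_def l_def)
  qed
  then show ?thesis using A by blast
qed

section \<open>Analytic extension along a leaf\<close>

definition weight :: "int \<Rightarrow> int \<Rightarrow> real" where
  "weight m n = of_int m + \<alpha> * of_int n"

lemma weight_add: "weight (m + m') (n + n') = weight m n + weight m' n'"
  by (simp add: weight_def algebra_simps)

lemma weight_0 [simp]: "weight 0 0 = 0"
  by (simp add: weight_def)

text \<open>Finite sums of characters of non-negative weight, paired with the entire function which such a sum
  induces on the leaf \<open>t \<mapsto> (exp (i t), exp (i \<alpha> t))\<close>.\<close>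

inductive_set hardy_poly :: "((complex \<times> complex \<Rightarrow> complex) \<times> (complex \<Rightarrow> complex)) set" where
  char: "0 \<le> weight m n \<Longrightarrow> (\<lambda>p. c * torus_char m n p, \<lambda>\<zeta>. c * exp (\<i> * of_real (weight m n) * \<zeta>)) \<in> hardy_poly"
| add: "(f, F) \<in> hardy_poly \<Longrightarrow> (g, G) \<in> hardy_poly \<Longrightarrow> (\<lambda>p. f p + g p, \<lambda>\<zeta>. F \<zeta> + G \<zeta>) \<in> hardy_poly"

lemma hardy_poly_scale: "(f, F) \<in> hardy_poly \<Longrightarrow> (\<lambda>p. c * f p, \<lambda>\<zeta>. c * F \<zeta>) \<in> hardy_poly"
proof (induction rule: hardy_poly.induct)
  case (char m n c')
  then show ?case using hardy_poly.char[of m n "c * c'"] by (simp add: mult.assoc)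
next
  case (add f F g G)
  then show ?case using hardy_poly.add[of "\<lambda>p. c * f p" "\<lambda>\<zeta>. c * F \<zeta>" "\<lambda>p. c * g p" "\<lambda>\<zeta>. c * G \<zeta>"]
    by (simp add: algebra_simps)
qed

lemma hardy_poly_diff:
  assumes "(f, F) \<in> hardy_poly" "(g, G) \<in> hardy_poly"
  shows "(\<lambda>p. f p - g p, \<lambda>\<zeta>. F \<zeta> - G \<zeta>) \<in> hardy_poly"
  using hardy_poly.add[OF assms(1) hardy_poly_scale[OF assms(2), of "-1"]] by simp

lemma hardy_poly_continuous: "(f, F) \<in> hardy_poly \<Longrightarrow> continuous_on T2 f"
  by (induction rule: hardy_poly.induct) (auto intro!: continuous_intros)

lemma hardy_poly_holomorphic: "(f, F) \<in> hardy_poly \<Longrightarrow> F holomorphic_on UNIV"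
  by (induction rule: hardy_poly.induct) (auto intro!: holomorphic_intros)

lemma hardy_poly_leaf: "(f, F) \<in> hardy_poly \<Longrightarrow> F (of_real t) = f (cis t, cis (\<alpha> * t))"
proof (induction rule: hardy_poly.induct)
  case (char m n c)
  have "torus_char m n (cis t, cis (\<alpha> * t)) = cis (weight m n * t)"
    by (simp add: torus_char_cis weight_def algebra_simps)
  then show ?case by (simp add: cis_conv_exp mult.assoc)
qed simp

lemma hardy_poly_bounded: "(f, F) \<in> hardy_poly \<Longrightarrow> \<exists>C. \<forall>\<zeta>. 0 \<le> Im \<zeta> \<longrightarrow> norm (F \<zeta>) \<le> C"
proof (induction rule: hardy_poly.induct)
  case (char m n c)
  have "norm (c * exp (\<i> * of_real (weight m n) * \<zeta>)) \<le> norm c" if "0 \<le> Im \<zeta>" for \<zeta>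
    using char that by (simp add: norm_mult mult_left_le)
  then show ?case by blast
next
  case (add f F g G)
  then obtain C D where "\<forall>\<zeta>. 0 \<le> Im \<zeta> \<longrightarrow> norm (F \<zeta>) \<le> C" "\<forall>\<zeta>. 0 \<le> Im \<zeta> \<longrightarrow> norm (G \<zeta>) \<le> D" by blast
  then have "\<forall>\<zeta>. 0 \<le> Im \<zeta> \<longrightarrow> norm (F \<zeta> + G \<zeta>) \<le> C + D"
    using norm_triangle_mono by blast
  then show ?case by blast
qed

text \<open>The real line is mapped into the torus, and the maximum principle carries the bound
  upwards. Thus uniform convergence on the torus forces uniform convergence on the closed
  half-plane.\<close>

lemma hardy_poly_norm_le:
  assumes h: "(f, F) \<in> hardy_poly" and B: "\<And>p. p \<in> T2 \<Longrightarrow> norm (f p) \<le> B" and z: "0 \<le> Im \<zeta>"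
  shows "norm (F \<zeta>) \<le> B"
proof -
  obtain C where "\<forall>\<zeta>. 0 \<le> Im \<zeta> \<longrightarrow> norm (F \<zeta>) \<le> C" using hardy_poly_bounded[OF h] by blast
  then show ?thesis
    using half_plane_maximum_principle[OF hardy_poly_holomorphic[OF h], of C B \<zeta>] z B
    by (simp add: hardy_poly_leaf[OF h])
qed

lemma hardy_poly_fourier: "(f, F) \<in> hardy_poly \<Longrightarrow> weight m n < 0 \<Longrightarrow> fourier f m n = 0"
proof (induction rule: hardy_poly.induct)
  case (char m' n' c)
  then show ?case by (auto simp: fourier_mult_left fourier_torus_char)
next
  case (add f F g G)
  then show ?case by (simp add: fourier_add hardy_poly_continuous)
qed

text \<open>The product is matched only on the torus, because the addition law for
  \<open>powi\<close> fails at 0.\<close>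

lemma hardy_poly_mult:
  assumes "(f, F) \<in> hardy_poly" "(g, G) \<in> hardy_poly"
  shows "\<exists>h. (h, \<lambda>\<zeta>. F \<zeta> * G \<zeta>) \<in> hardy_poly \<and> (\<forall>p\<in>T2. h p = f p * g p)"
  using assms
proof (induction rule: hardy_poly.induct)
  case (char m n c)
  from char(2) char(1) show ?case
  proof (induction rule: hardy_poly.induct)
    case (char m' n' c')
    have "(\<lambda>p. (c * c') * torus_char (m + m') (n + n') p, \<lambda>\<zeta>. (c * c') * exp (\<i> * of_real (weight (m + m') (n + n')) * \<zeta>)) \<in> hardy_poly"
      using char by (intro hardy_poly.char) (simp add: weight_add)
    moreover have "(c * c') * exp (\<i> * of_real (weight (m + m') (n + n')) * \<zeta>)
        = c * exp (\<i> * of_real (weight m n) * \<zeta>) * (c' * exp (\<i> * of_real (weight m' n') * \<zeta>))" for \<zeta>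
      by (simp add: weight_add algebra_simps exp_add)
    ultimately have "(\<lambda>p. (c * c') * torus_char (m + m') (n + n') p, \<lambda>\<zeta>. c * exp (\<i> * of_real (weight m n) * \<zeta>) * (c' * exp (\<i> * of_real (weight m' n') * \<zeta>))) \<in> hardy_poly"
      by simp
    then show ?case by (intro exI conjI) (assumption, simp add: torus_char_add)
  next
    case (add f F g G)
    then obtain h1 h2 where
      "(h1, \<lambda>\<zeta>. c * exp (\<i> * of_real (weight m n) * \<zeta>) * F \<zeta>) \<in> hardy_poly" "\<forall>p\<in>T2. h1 p = c * torus_char m n p * f p"
      "(h2, \<lambda>\<zeta>. c * exp (\<i> * of_real (weight m n) * \<zeta>) * G \<zeta>) \<in> hardy_poly" "\<forall>p\<in>T2. h2 p = c * torus_char m n p * g p"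
      by blast
    then show ?case using hardy_poly.add[of h1 _ h2]
      by (intro exI[of _ "\<lambda>p. h1 p + h2 p"]) (simp add: distrib_left)
  qed
next
  case (add f1 F1 f2 F2)
  then obtain h1 h2 where
    "(h1, \<lambda>\<zeta>. F1 \<zeta> * G \<zeta>) \<in> hardy_poly" "\<forall>p\<in>T2. h1 p = f1 p * g p"
    "(h2, \<lambda>\<zeta>. F2 \<zeta> * G \<zeta>) \<in> hardy_poly" "\<forall>p\<in>T2. h2 p = f2 p * g p"
    by blast
  then show ?case using hardy_poly.add[of h1 _ h2]
    by (intro exI[of _ "\<lambda>p. h1 p + h2 p"]) (simp add: distrib_right)
qed

lemma hardy_poly_sum:
  assumes "finite I" "\<And>i. i \<in> I \<Longrightarrow> \<exists>F. (f i, F) \<in> hardy_poly"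
  shows "\<exists>F. (\<lambda>p. \<Sum>i\<in>I. f i p, F) \<in> hardy_poly"
  using assms
proof (induction I rule: finite_induct)
  case empty
  show ?case using hardy_poly.char[of 0 0 0] by auto
next
  case (insert i I)
  then obtain F G where "(f i, F) \<in> hardy_poly" "(\<lambda>p. \<Sum>i\<in>I. f i p, G) \<in> hardy_poly" by blast
  from hardy_poly.add[OF this] insert show ?case by auto
qed

section \<open>Membership in the algebra as uniform approximability\<close>

text \<open>Elements of \<open>CT2\<close> are total functions normalised to 0 off the torus, so
  pointwise formulas have to be cut off before they can be members.\<close>

definition on_T2 :: "(complex \<times> complex \<Rightarrow> complex) \<Rightarrow> complex \<times> complex \<Rightarrow> complex" where
  "on_T2 f p = (if p \<in> T2 then f p else 0)"

lemma on_T2_in_CT2: "continuous_on T2 f \<Longrightarrow> on_T2 f \<in> CT2"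
proof -
  assume "continuous_on T2 f"
  then have "continuous_on T2 (on_T2 f)" by (rule continuous_on_eq) (simp add: on_T2_def)
  then show ?thesis by (simp add: CT2_def on_T2_def)
qed

lemma CT2_continuous: "f \<in> CT2 \<Longrightarrow> continuous_on T2 f"
  by (simp add: CT2_def)

lemma Aalpha_continuous: "f \<in> \<A> \<Longrightarrow> continuous_on T2 f"
  by (simp add: Aalpha_def CT2_def)

lemma Aalpha_outside: "f \<in> \<A> \<Longrightarrow> p \<notin> T2 \<Longrightarrow> f p = 0"
  unfolding Aalpha_def CT2_def by blast

text \<open>In the Fejer mean the terms of negative weight have coefficient 0 and may be replaced by
  a zero multiple of the constant character.\<close>

lemma Aalpha_approx:
  assumes f: "f \<in> \<A>" and e: "0 < e"
  obtains h H where "(h, H) \<in> hardy_poly" "\<And>p. p \<in> T2 \<Longrightarrow> norm (f p - h p) \<le> e"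
proof -
  obtain N where N: "\<forall>p\<in>T2. norm (fejer N f p - f p) \<le> e"
    using fejer_converges[OF Aalpha_continuous[OF f] e] by blast
  have "\<exists>H. (\<lambda>p. fourier f m n / of_nat (N\<^sup>2) * torus_char m n p, H) \<in> hardy_poly" for m n
  proof (cases "0 \<le> weight m n")
    case True
    then show ?thesis using hardy_poly.char by blast
  next
    case False
    then have "fourier f m n = 0" using f by (simp add: Aalpha_def weight_def)
    then show ?thesis using hardy_poly.char[of 0 0 0] by auto
  qed
  then have "\<exists>H. (\<lambda>p. \<Sum>a\<in>fejer_index N. \<Sum>b\<in>fejer_index N. fourier f (fst a - fst b) (snd a - snd b) / of_nat (N\<^sup>2) * torus_char (fst a - fst b) (snd a - snd b) p, H) \<in> hardy_poly"
    by (intro hardy_poly_sum finite_fejer_index)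
  moreover have "(\<lambda>p. \<Sum>a\<in>fejer_index N. \<Sum>b\<in>fejer_index N. fourier f (fst a - fst b) (snd a - snd b) / of_nat (N\<^sup>2) * torus_char (fst a - fst b) (snd a - snd b) p) = fejer N f"
    by (rule ext) (simp add: fejer_def sum_divide_distrib)
  ultimately obtain H where "(fejer N f, H) \<in> hardy_poly" by auto
  then show ?thesis using that N by (metis norm_minus_commute)
qed

text \<open>Fourier coefficients are continuous in the uniform norm. This test proves membership of
  products and of substituted functions without computing their coefficients.\<close>

lemma Aalpha_if_approx:
  assumes f: "f \<in> CT2"
    and approx: "\<And>e. 0 < e \<Longrightarrow> \<exists>h H. (h, H) \<in> hardy_poly \<and> (\<forall>p\<in>T2. norm (f p - h p) \<le> e)"
  shows "f \<in> \<A>"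
proof -
  have "fourier f m n = 0" if w: "weight m n < 0" for m n
  proof (rule ccontr)
    assume "fourier f m n \<noteq> 0"
    then have "0 < norm (fourier f m n) / 2" by simp
    then obtain h H where h: "(h, H) \<in> hardy_poly" "\<forall>p\<in>T2. norm (f p - h p) \<le> norm (fourier f m n) / 2"
      using approx by blast
    note ch = hardy_poly_continuous[OF h(1)]
    have cd: "continuous_on T2 (\<lambda>p. f p - h p)" using CT2_continuous[OF f] ch by (intro continuous_intros)
    have "fourier f m n = fourier (\<lambda>p. (f p - h p) + h p) m n" by simp
    also have "\<dots> = fourier (\<lambda>p. f p - h p) m n"
      using fourier_add[OF cd ch] hardy_poly_fourier[OF h(1) w] by simp
    finally have "norm (fourier f m n) \<le> norm (fourier f m n) / 2"
      using fourier_norm_le[OF cd] h(2) by metis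
    then show False using \<open>0 < norm (fourier f m n) / 2\<close> by simp
  qed
  then show ?thesis using f by (simp add: Aalpha_def weight_def)
qed

lemma on_T2_hardy_poly:
  assumes "(h, H) \<in> hardy_poly"
  shows "on_T2 h \<in> \<A>"
  using assms
  by (intro Aalpha_if_approx on_T2_in_CT2 hardy_poly_continuous[OF assms]) (auto simp: on_T2_def intro!: exI[of _ h])

lemma CT2_add: "f \<in> CT2 \<Longrightarrow> g \<in> CT2 \<Longrightarrow> (\<lambda>p. f p + g p) \<in> CT2"
  by (auto simp: CT2_def intro!: continuous_intros)

lemma CT2_mult: "f \<in> CT2 \<Longrightarrow> g \<in> CT2 \<Longrightarrow> (\<lambda>p. f p * g p) \<in> CT2"
  by (auto simp: CT2_def intro!: continuous_intros)

lemma CT2_bounded: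
  assumes "f \<in> CT2"
  obtains B where "0 < B" "\<And>p. p \<in> T2 \<Longrightarrow> norm (f p) \<le> B"
proof -
  have "bounded (f ` T2)"
    using compact_continuous_image[OF CT2_continuous[OF assms] compact_T2] by (rule compact_imp_bounded)
  then show ?thesis using that unfolding bounded_pos by blast
qed

lemma Aalpha_CT2: "f \<in> \<A> \<Longrightarrow> f \<in> CT2"
  by (simp add: Aalpha_def)

lemma Aalpha_add: "f \<in> \<A> \<Longrightarrow> g \<in> \<A> \<Longrightarrow> (\<lambda>p. f p + g p) \<in> \<A>"
  by (auto simp: Aalpha_def CT2_add fourier_add CT2_continuous)

lemma Aalpha_scale: "f \<in> \<A> \<Longrightarrow> (\<lambda>p. c * f p) \<in> \<A>"
  by (auto simp: Aalpha_def CT2_def fourier_mult_left intro!: continuous_intros)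

lemma norm_mult_diff_le:
  fixes a b c d :: "'a::real_normed_algebra"
  assumes "norm (a - c) \<le> e" "norm (b - d) \<le> e'" "norm b \<le> B" "norm c \<le> C" "0 \<le> e"
  shows "norm (a * b - c * d) \<le> e * B + C * e'"
proof -
  have "a * b - c * d = (a - c) * b + c * (b - d)" by (simp add: algebra_simps)
  then have "norm (a * b - c * d) \<le> norm ((a - c) * b) + norm (c * (b - d))" by (metis norm_triangle_ineq)
  also have "\<dots> \<le> norm (a - c) * norm b + norm c * norm (b - d)"
    by (intro add_mono norm_mult_ineq)
  also have "\<dots> \<le> e * B + C * e'"
    using assms order_trans[OF norm_ge_zero assms(4)] by (intro add_mono mult_mono) auto
  finally show ?thesis .
qed

section \<open>Continuation from the torus to the half-plane over a leaf\<close>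

text \<open>Simultaneous approximation by one exponential sum on the torus and on the half-plane,
  rather than holomorphy with prescribed boundary values: the algebraic rules are then inherited
  from finite sums.\<close>

definition leaf_extension :: "(complex \<times> complex \<Rightarrow> complex) \<Rightarrow> (complex \<Rightarrow> complex) \<Rightarrow> bool" where
  "leaf_extension f F \<longleftrightarrow> (\<forall>e>0. \<exists>h H. (h, H) \<in> hardy_poly \<and> (\<forall>p\<in>T2. norm (f p - h p) \<le> e)
      \<and> (\<forall>\<zeta>. 0 \<le> Im \<zeta> \<longrightarrow> norm (F \<zeta> - H \<zeta>) \<le> e))"

lemma leaf_extensionE:
  assumes "leaf_extension f F" "0 < e"
  obtains h H where "(h, H) \<in> hardy_poly" "\<And>p. p \<in> T2 \<Longrightarrow> norm (f p - h p) \<le> e"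
    "\<And>\<zeta>. 0 \<le> Im \<zeta> \<Longrightarrow> norm (F \<zeta> - H \<zeta>) \<le> e"
  using assms unfolding leaf_extension_def by blast

lemma leaf_extension_hardy_poly: "(h, H) \<in> hardy_poly \<Longrightarrow> leaf_extension h H"
  unfolding leaf_extension_def by force

lemma leaf_extension_cong:
  "leaf_extension f F \<Longrightarrow> (\<And>p. p \<in> T2 \<Longrightarrow> f p = g p) \<Longrightarrow> leaf_extension g F"
  unfolding leaf_extension_def by simp

text \<open>By \<open>hardy_poly_norm_le\<close> sums that are close to \<open>f\<close> on the
  torus are close to each other on the closed half-plane, so approximants with error
  \<open>1 / (n + 1)\<close> converge uniformly there.\<close>

lemma leaf_extension_exists:
  assumes f: "f \<in> \<A>"
  shows "\<exists>F. leaf_extension f F"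
proof -
  define \<epsilon> where "\<epsilon> n = inverse (real (Suc n))" for n
  have \<epsilon>0: "0 < \<epsilon> n" for n by (simp add: \<epsilon>_def)
  have "\<exists>h H. (h, H) \<in> hardy_poly \<and> (\<forall>p\<in>T2. norm (f p - h p) \<le> \<epsilon> n)" for n
    using Aalpha_approx[OF f \<epsilon>0] by metis
  then obtain h H where h: "\<And>n. (h n, H n) \<in> hardy_poly" "\<And>n. \<forall>p\<in>T2. norm (f p - h n p) \<le> \<epsilon> n"
    by metis
  have diff: "norm (H i \<zeta> - H j \<zeta>) \<le> \<epsilon> i + \<epsilon> j" if "0 \<le> Im \<zeta>" for i j \<zeta>
  proof (rule hardy_poly_norm_le[OF hardy_poly_diff[OF h(1) h(1)] _ that])
    fix p assume p: "p \<in> T2"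
    have "norm (f p - h i p) \<le> \<epsilon> i" "norm (f p - h j p) \<le> \<epsilon> j" using h(2) p by auto
    then show "norm (h i p - h j p) \<le> \<epsilon> i + \<epsilon> j"
      using norm_triangle_ineq4[of "f p - h j p" "f p - h i p"] by simp
  qed
  have \<epsilon>lim: "\<epsilon> \<longlonglongrightarrow> 0" unfolding \<epsilon>_def by (rule LIMSEQ_inverse_real_of_nat)
  define F where "F \<zeta> = lim (\<lambda>n. H n \<zeta>)" for \<zeta>
  have lim: "(\<lambda>n. H n \<zeta>) \<longlonglongrightarrow> F \<zeta>" if z: "0 \<le> Im \<zeta>" for \<zeta>
  proof -
    have "Cauchy (\<lambda>n. H n \<zeta>)"
    proof (rule metric_CauchyI)
      fix e :: real assume "0 < e"
      then obtain M where M: "\<And>n. n \<ge> M \<Longrightarrow> \<epsilon> n < e / 2"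
        using order_tendstoD(2)[OF \<epsilon>lim, of "e/2"] by (auto simp: eventually_sequentially)
      have "dist (H i \<zeta>) (H j \<zeta>) < e" if "i \<ge> M" "j \<ge> M" for i j
        using diff[OF z, of i j] M[OF that(1)] M[OF that(2)] by (simp add: dist_norm)
      then show "\<exists>M. \<forall>m\<ge>M. \<forall>n\<ge>M. dist (H m \<zeta>) (H n \<zeta>) < e" by blast
    qed
    then show ?thesis unfolding F_def by (simp add: Cauchy_convergent_iff convergent_LIMSEQ_iff)
  qed
  have FH: "norm (F \<zeta> - H i \<zeta>) \<le> \<epsilon> i" if z: "0 \<le> Im \<zeta>" for i \<zeta>
  proof (rule LIMSEQ_le)
    show "(\<lambda>j. norm (H j \<zeta> - H i \<zeta>)) \<longlonglongrightarrow> norm (F \<zeta> - H i \<zeta>)"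
      using lim[OF z] by (intro tendsto_intros)
    show "(\<lambda>j. \<epsilon> j + \<epsilon> i) \<longlonglongrightarrow> \<epsilon> i" using tendsto_add[OF \<epsilon>lim tendsto_const, of "\<epsilon> i"] by simp
    show "\<exists>N. \<forall>n\<ge>N. norm (H n \<zeta> - H i \<zeta>) \<le> \<epsilon> n + \<epsilon> i" using diff[OF z] by blast
  qed
  have "leaf_extension f F"
    unfolding leaf_extension_def
  proof (intro allI impI)
    fix e :: real assume "0 < e"
    then obtain n where n: "\<epsilon> n < e" unfolding \<epsilon>_def using reals_Archimedean by blast
    have "\<forall>p\<in>T2. norm (f p - h n p) \<le> e" using h(2)[of n] n by (meson less_imp_le order_trans)
    moreover have "\<forall>\<zeta>. 0 \<le> Im \<zeta> \<longrightarrow> norm (F \<zeta> - H n \<zeta>) \<le> e"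
      using FH[of _ n] n by (meson less_imp_le order_trans)
    ultimately show "\<exists>h H. (h, H) \<in> hardy_poly \<and> (\<forall>p\<in>T2. norm (f p - h p) \<le> e) \<and> (\<forall>\<zeta>. 0 \<le> Im \<zeta> \<longrightarrow> norm (F \<zeta> - H \<zeta>) \<le> e)"
      using h(1)[of n] by blast
  qed
  then show ?thesis by blast
qed

lemma leaf_extension_norm_le:
  assumes ext: "leaf_extension f F" and B: "\<And>p. p \<in> T2 \<Longrightarrow> norm (f p) \<le> B" and z: "0 \<le> Im \<zeta>"
  shows "norm (F \<zeta>) \<le> B"
proof (rule field_le_epsilon)
  fix e :: real assume "0 < e"
  then obtain h H where h: "(h, H) \<in> hardy_poly" "\<And>p. p \<in> T2 \<Longrightarrow> norm (f p - h p) \<le> e/2"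
    "\<And>\<zeta>. 0 \<le> Im \<zeta> \<Longrightarrow> norm (F \<zeta> - H \<zeta>) \<le> e/2"
    using leaf_extensionE[OF ext, of "e/2"] by (metis half_gt_zero)
  have "norm (h p) \<le> B + e/2" if "p \<in> T2" for p
    using norm_triangle_ineq4[of "f p" "f p - h p"] B[OF that] h(2)[OF that] by simp
  then have "norm (H \<zeta>) \<le> B + e/2" by (rule hardy_poly_norm_le[OF h(1) _ z])
  then show "norm (F \<zeta>) \<le> B + e"
    using norm_triangle_ineq[of "F \<zeta> - H \<zeta>" "H \<zeta>"] h(3)[OF z] by simp
qed

lemma leaf_extension_add:
  assumes "leaf_extension f F" "leaf_extension g G"
  shows "leaf_extension (\<lambda>p. f p + g p) (\<lambda>\<zeta>. F \<zeta> + G \<zeta>)"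
  unfolding leaf_extension_def
proof (intro allI impI)
  fix e :: real assume "0 < e"
  then have "0 < e/2" by simp
  obtain h H where h: "(h, H) \<in> hardy_poly" "\<And>p. p \<in> T2 \<Longrightarrow> norm (f p - h p) \<le> e/2"
    "\<And>\<zeta>. 0 \<le> Im \<zeta> \<Longrightarrow> norm (F \<zeta> - H \<zeta>) \<le> e/2"
    using leaf_extensionE[OF assms(1) \<open>0 < e/2\<close>] by metis
  obtain k K where k: "(k, K) \<in> hardy_poly" "\<And>p. p \<in> T2 \<Longrightarrow> norm (g p - k p) \<le> e/2"
    "\<And>\<zeta>. 0 \<le> Im \<zeta> \<Longrightarrow> norm (G \<zeta> - K \<zeta>) \<le> e/2"
    using leaf_extensionE[OF assms(2) \<open>0 < e/2\<close>] by metis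
  have tri: "norm (a + b - (c + d)) \<le> e" if "norm (a - c) \<le> e/2" "norm (b - d) \<le> e/2" for a b c d :: complex
    using norm_diff_triangle_ineq[of a b c d] that by linarith
  show "\<exists>h H. (h, H) \<in> hardy_poly \<and> (\<forall>p\<in>T2. norm (f p + g p - h p) \<le> e) \<and> (\<forall>\<zeta>. 0 \<le> Im \<zeta> \<longrightarrow> norm (F \<zeta> + G \<zeta> - H \<zeta>) \<le> e)"
    using hardy_poly.add[OF h(1) k(1)] tri h(2,3) k(2,3)
    by (intro exI[of _ "\<lambda>p. h p + k p"] exI[of _ "\<lambda>\<zeta>. H \<zeta> + K \<zeta>"]) simp
qed

lemma leaf_extension_scale:
  assumes "leaf_extension f F"
  shows "leaf_extension (\<lambda>p. c * f p) (\<lambda>\<zeta>. c * F \<zeta>)"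
  unfolding leaf_extension_def
proof (intro allI impI)
  fix e :: real assume "0 < e"
  then have "0 < e / (norm c + 1)" by (simp add: add_nonneg_pos)
  then obtain h H where h: "(h, H) \<in> hardy_poly" "\<And>p. p \<in> T2 \<Longrightarrow> norm (f p - h p) \<le> e / (norm c + 1)"
    "\<And>\<zeta>. 0 \<le> Im \<zeta> \<Longrightarrow> norm (F \<zeta> - H \<zeta>) \<le> e / (norm c + 1)"
    using leaf_extensionE[OF assms] by metis
  show "\<exists>h H. (h, H) \<in> hardy_poly \<and> (\<forall>p\<in>T2. norm (c * f p - h p) \<le> e) \<and> (\<forall>\<zeta>. 0 \<le> Im \<zeta> \<longrightarrow> norm (c * F \<zeta> - H \<zeta>) \<le> e)"
    using hardy_poly_scale[OF h(1), of c] norm_scaled_diff_le[OF h(2)] norm_scaled_diff_le[OF h(3)]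
    by (intro exI[of _ "\<lambda>p. c * h p"] exI[of _ "\<lambda>\<zeta>. c * H \<zeta>"]) simp
qed

lemma leaf_extension_mult:
  assumes f: "leaf_extension f F" "f \<in> CT2" and g: "leaf_extension g G" "g \<in> CT2"
  shows "leaf_extension (\<lambda>p. f p * g p) (\<lambda>\<zeta>. F \<zeta> * G \<zeta>)"
  unfolding leaf_extension_def
proof (intro allI impI)
  fix e :: real assume e: "0 < e"
  obtain B where B: "0 < B" "\<And>p. p \<in> T2 \<Longrightarrow> norm (f p) \<le> B" using CT2_bounded[OF f(2)] by metis
  obtain C where C: "0 < C" "\<And>p. p \<in> T2 \<Longrightarrow> norm (g p) \<le> C" using CT2_bounded[OF g(2)] by metis
  \<comment> \<open>The bound 1 gives \<open>norm (h p) \<le> B + 1\<close>; the other bound makes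
    the two error terms \<open>d * C\<close> and \<open>(B + 1) * d\<close> add up to at most
    \<open>e\<close>.\<close>
  define d where "d = min 1 (e / (C + B + 1))"
  have d: "0 < d" "d \<le> 1" using e B C by (auto simp: d_def)
  have dBC: "d * C + (B + 1) * d \<le> e"
  proof -
    have "d * (C + B + 1) \<le> e / (C + B + 1) * (C + B + 1)"
      using B C by (intro mult_right_mono) (auto simp: d_def)
    also have "\<dots> = e" using B C by simp
    finally show ?thesis by (simp add: algebra_simps)
  qed
  obtain h H where h: "(h, H) \<in> hardy_poly" "\<And>p. p \<in> T2 \<Longrightarrow> norm (f p - h p) \<le> d"
    "\<And>\<zeta>. 0 \<le> Im \<zeta> \<Longrightarrow> norm (F \<zeta> - H \<zeta>) \<le> d"
    using leaf_extensionE[OF f(1) d(1)] by metis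
  obtain k K where k: "(k, K) \<in> hardy_poly" "\<And>p. p \<in> T2 \<Longrightarrow> norm (g p - k p) \<le> d"
    "\<And>\<zeta>. 0 \<le> Im \<zeta> \<Longrightarrow> norm (G \<zeta> - K \<zeta>) \<le> d"
    using leaf_extensionE[OF g(1) d(1)] by metis
  have hB: "norm (h p) \<le> B + 1" if "p \<in> T2" for p
    using norm_triangle_ineq4[of "f p" "f p - h p"] B(2)[OF that] h(2)[OF that] d by simp
  obtain q where q: "(q, \<lambda>\<zeta>. H \<zeta> * K \<zeta>) \<in> hardy_poly" "\<forall>p\<in>T2. q p = h p * k p"
    using hardy_poly_mult[OF h(1) k(1)] by blast
  have "norm (f p * g p - q p) \<le> e" if p: "p \<in> T2" for p
    using norm_mult_diff_le[OF h(2)[OF p] k(2)[OF p] C(2)[OF p] hB[OF p]] d q(2) p dBC by force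
  moreover have "norm (F \<zeta> * G \<zeta> - H \<zeta> * K \<zeta>) \<le> e" if z: "0 \<le> Im \<zeta>" for \<zeta>
    using norm_mult_diff_le[OF h(3)[OF z] k(3)[OF z] leaf_extension_norm_le[OF g(1) C(2) z] hardy_poly_norm_le[OF h(1) hB z]] d dBC
    by force
  ultimately show "\<exists>h H. (h, H) \<in> hardy_poly \<and> (\<forall>p\<in>T2. norm (f p * g p - h p) \<le> e) \<and> (\<forall>\<zeta>. 0 \<le> Im \<zeta> \<longrightarrow> norm (F \<zeta> * G \<zeta> - H \<zeta>) \<le> e)"
    using q(1) by blast
qed

lemma leaf_extension_unique:
  assumes "leaf_extension f F" "leaf_extension f G" "0 \<le> Im \<zeta>"
  shows "F \<zeta> = G \<zeta>"
proof -
  have "leaf_extension (\<lambda>p. f p + (-1) * f p) (\<lambda>\<zeta>. F \<zeta> + (-1) * G \<zeta>)"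
    using leaf_extension_add[OF assms(1) leaf_extension_scale[OF assms(2), of "-1"]] .
  then have "norm (F \<zeta> + (-1) * G \<zeta>) \<le> 0"
    by (rule leaf_extension_norm_le) (use assms in auto)
  then show ?thesis by simp
qed

lemma leaf_extension_leaf:
  assumes "leaf_extension f F"
  shows "F (of_real t) = f (cis t, cis (\<alpha> * t))"
proof -
  have "norm (F (of_real t) - f (cis t, cis (\<alpha> * t))) \<le> e" if "0 < e" for e
  proof -
    have "0 < e/2" using that by simp
    obtain h H where h: "(h, H) \<in> hardy_poly" "\<And>p. p \<in> T2 \<Longrightarrow> norm (f p - h p) \<le> e/2"
      "\<And>\<zeta>. 0 \<le> Im \<zeta> \<Longrightarrow> norm (F \<zeta> - H \<zeta>) \<le> e/2"
      using leaf_extensionE[OF assms \<open>0 < e/2\<close>] by metis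
    have "norm (F (of_real t) - H (of_real t)) \<le> e/2" "norm (f (cis t, cis (\<alpha> * t)) - H (of_real t)) \<le> e/2"
      using h(2)[of "(cis t, cis (\<alpha> * t))"] h(3)[of "of_real t"] by (simp_all add: hardy_poly_leaf[OF h(1)])
    then show ?thesis
      using norm_triangle_ineq4[of "F (of_real t) - H (of_real t)" "f (cis t, cis (\<alpha> * t)) - H (of_real t)"] by simp
  qed
  then have "norm (F (of_real t) - f (cis t, cis (\<alpha> * t))) \<le> 0"
    by (metis dense_ge)
  then show ?thesis by simp
qed

lemma leaf_extension_regular:
  assumes "leaf_extension f F"
  shows "continuous_on {\<zeta>. 0 \<le> Im \<zeta>} F" "F holomorphic_on {\<zeta>. 0 < Im \<zeta>}"
proof -
  define \<epsilon> where "\<epsilon> n = inverse (real (Suc n))" for n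
  have "\<exists>h H. (h, H) \<in> hardy_poly \<and> (\<forall>\<zeta>. 0 \<le> Im \<zeta> \<longrightarrow> norm (F \<zeta> - H \<zeta>) \<le> \<epsilon> n)" for n
    using leaf_extensionE[OF assms, of "\<epsilon> n"] unfolding \<epsilon>_def
    by (metis inverse_positive_iff_positive of_nat_0_less_iff zero_less_Suc)
  then obtain h H where h: "\<And>n. (h n, H n) \<in> hardy_poly" "\<And>n \<zeta>. 0 \<le> Im \<zeta> \<Longrightarrow> norm (F \<zeta> - H n \<zeta>) \<le> \<epsilon> n"
    by metis
  have ul: "uniform_limit {\<zeta>. 0 \<le> Im \<zeta>} H F sequentially"
  proof (rule uniform_limitI)
    fix e :: real assume "0 < e"
    then have "\<forall>\<^sub>F n in sequentially. \<epsilon> n < e"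
      unfolding \<epsilon>_def using order_tendstoD(2)[OF LIMSEQ_inverse_real_of_nat] by blast
    then show "\<forall>\<^sub>F n in sequentially. \<forall>\<zeta>\<in>{\<zeta>. 0 \<le> Im \<zeta>}. dist (H n \<zeta>) (F \<zeta>) < e"
    proof (rule eventually_mono)
      fix n assume "\<epsilon> n < e"
      then show "\<forall>\<zeta>\<in>{\<zeta>. 0 \<le> Im \<zeta>}. dist (H n \<zeta>) (F \<zeta>) < e"
        using h(2)[of _ n] by (auto simp: dist_norm norm_minus_commute intro: le_less_trans)
    qed
  qed
  have holH: "H n holomorphic_on S" for n S
    using hardy_poly_holomorphic[OF h(1)] holomorphic_on_subset by blast
  show "continuous_on {\<zeta>. 0 \<le> Im \<zeta>} F"
    by (rule uniform_limit_theorem[OF _ ul]) (auto intro: always_eventually holomorphic_on_imp_continuous_on holH)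
  show "F holomorphic_on {\<zeta>. 0 < Im \<zeta>}"
  proof (rule holomorphic_uniform_sequence)
    show op: "open {\<zeta>. 0 < Im \<zeta>}" by (rule open_halfspace_Im_gt)
    show "H n holomorphic_on {\<zeta>. 0 < Im \<zeta>}" for n by (rule holH)
    fix x assume "x \<in> {\<zeta>. 0 < Im \<zeta>}"
    then obtain d where "0 < d" "cball x d \<subseteq> {\<zeta>. 0 < Im \<zeta>}" using op open_contains_cball by blast
    moreover from this have "uniform_limit (cball x d) H F sequentially"
      by (intro uniform_limit_on_subset[OF ul]) force
    ultimately show "\<exists>d>0. cball x d \<subseteq> {\<zeta>. 0 < Im \<zeta>} \<and> uniform_limit (cball x d) H F sequentially" by blast
  qed
qed

text \<open>Products of approximating sums have exponents of non-negative weight, which replaces a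
  convolution formula for the Fourier coefficients.\<close>

lemma Aalpha_mult:
  assumes f: "f \<in> \<A>" and g: "g \<in> \<A>"
  shows "(\<lambda>p. f p * g p) \<in> \<A>"
proof -
  obtain F G where "leaf_extension f F" "leaf_extension g G" using leaf_extension_exists f g by metis
  then have "leaf_extension (\<lambda>p. f p * g p) (\<lambda>\<zeta>. F \<zeta> * G \<zeta>)"
    by (intro leaf_extension_mult Aalpha_CT2[OF f] Aalpha_CT2[OF g])
  then show ?thesis
    by (intro Aalpha_if_approx CT2_mult Aalpha_CT2[OF f] Aalpha_CT2[OF g]) (meson leaf_extension_def)
qed

text \<open>The choice is unique on the closed upper half-plane; below it the value is
  unspecified.\<close>

definition leaf_value :: "(complex \<times> complex \<Rightarrow> complex) \<Rightarrow> complex \<Rightarrow> complex" where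
  "leaf_value f = (SOME F. leaf_extension f F)"

lemma leaf_extension_leaf_value: "f \<in> \<A> \<Longrightarrow> leaf_extension f (leaf_value f)"
  unfolding leaf_value_def by (rule someI_ex[OF leaf_extension_exists])

lemma leaf_value_eqI: "f \<in> \<A> \<Longrightarrow> leaf_extension f F \<Longrightarrow> 0 \<le> Im \<zeta> \<Longrightarrow> leaf_value f \<zeta> = F \<zeta>"
  using leaf_extension_unique leaf_extension_leaf_value by blast

section \<open>Characters of the algebra\<close>

abbreviation chi :: "int \<Rightarrow> int \<Rightarrow> complex \<times> complex \<Rightarrow> complex" where
  "chi m n \<equiv> on_T2 (torus_char m n)"

lemma chi_in_Aalpha: "0 \<le> weight m n \<Longrightarrow> chi m n \<in> \<A>"
  using on_T2_hardy_poly[OF hardy_poly.char[of m n 1]] by simp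

lemma chi_mult: "(\<lambda>p. chi m n p * chi m' n' p) = chi (m + m') (n + n')"
  by (rule ext) (simp add: on_T2_def torus_char_add)

lemma norm_chi_le: "norm (chi m n p) \<le> 1"
  by (simp add: on_T2_def norm_torus_char)

text \<open>The norm condition ranges over all majorants \<open>B\<close> of \<open>f\<close>, so
  that no supremum has to be handled.\<close>

definition bounded_functional :: "real \<Rightarrow> ((complex \<times> complex \<Rightarrow> complex) \<Rightarrow> complex) \<Rightarrow> bool" where
  "bounded_functional K h \<longleftrightarrow>
     (\<forall>f\<in>\<A>. \<forall>g\<in>\<A>. h (\<lambda>p. f p + g p) = h f + h g)
   \<and> (\<forall>f\<in>\<A>. \<forall>c. h (\<lambda>p. c * f p) = c * h f)
   \<and> (\<forall>f\<in>\<A>. \<forall>B. (\<forall>p\<in>T2. norm (f p) \<le> B) \<longrightarrow> norm (h f) \<le> K * B)"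

lemma
  assumes "bounded_functional K h"
  shows bounded_functional_add: "f \<in> \<A> \<Longrightarrow> g \<in> \<A> \<Longrightarrow> h (\<lambda>p. f p + g p) = h f + h g"
    and bounded_functional_scale: "f \<in> \<A> \<Longrightarrow> h (\<lambda>p. c * f p) = c * h f"
    and bounded_functional_norm: "f \<in> \<A> \<Longrightarrow> (\<And>p. p \<in> T2 \<Longrightarrow> norm (f p) \<le> B) \<Longrightarrow> norm (h f) \<le> K * B"
  using assms unfolding bounded_functional_def by simp_all

text \<open>Characters of non-negative weight span a dense subspace. The two bounds may differ,
  which is used when a functional is compared with its composite with a multiplication.\<close>

lemma bounded_functional_eqI:
  assumes h: "bounded_functional K h" and h': "bounded_functional K' h'"
    and chi: "\<And>m n. 0 \<le> weight m n \<Longrightarrow> h (chi m n) = h' (chi m n)"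
    and f: "f \<in> \<A>"
  shows "h f = h' f"
proof -
  have poly: "h (on_T2 g) = h' (on_T2 g)" if "(g, G) \<in> hardy_poly" for g G
    using that
  proof (induction rule: hardy_poly.induct)
    case (char m n c)
    have "on_T2 (\<lambda>p. c * torus_char m n p) = (\<lambda>p. c * chi m n p)" by (auto simp: on_T2_def)
    then show ?case using h h' chi[OF char] chi_in_Aalpha[OF char] by (simp add: bounded_functional_def)
  next
    case (add g G k K)
    have "on_T2 (\<lambda>p. g p + k p) = (\<lambda>p. on_T2 g p + on_T2 k p)" by (auto simp: on_T2_def)
    then show ?case using h h' add on_T2_hardy_poly by (simp add: bounded_functional_def)
  qed
  have "norm (h f - h' f) \<le> e" if e: "0 < e" for e
  proof -
    define d where "d = e / (\<bar>K\<bar> + \<bar>K'\<bar> + 1)"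
    have d: "0 < d" using e by (simp add: d_def add_nonneg_pos)
    obtain g G where g: "(g, G) \<in> hardy_poly" "\<And>p. p \<in> T2 \<Longrightarrow> norm (f p - g p) \<le> d"
      using Aalpha_approx[OF f d] by metis
    define r where "r = (\<lambda>p. f p + (-1) * on_T2 g p)"
    have g': "(\<lambda>p. (-1) * on_T2 g p) \<in> \<A>" using Aalpha_scale[OF on_T2_hardy_poly[OF g(1)]] .
    have rA: "r \<in> \<A>" unfolding r_def using Aalpha_add[OF f g'] .
    have rd: "\<forall>p\<in>T2. norm (r p) \<le> d" using g(2) by (simp add: r_def on_T2_def)
    have hr: "k r = k f - k (on_T2 g)" if "bounded_functional L k" for k L
    proof -
      have "k r = k f + k (\<lambda>p. (-1) * on_T2 g p)"
        unfolding r_def by (rule bounded_functional_add[OF that f g'])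
      also have "k (\<lambda>p. (-1) * on_T2 g p) = (-1) * k (on_T2 g)"
        by (rule bounded_functional_scale[OF that on_T2_hardy_poly[OF g(1)]])
      finally show ?thesis by simp
    qed
    have "h f - h' f = h r - h' r" using hr[OF h] hr[OF h'] poly[OF g(1)] by simp
    then have "norm (h f - h' f) \<le> norm (h r) + norm (h' r)" using norm_triangle_ineq4 by metis
    also have "\<dots> \<le> K * d + K' * d"
      using rd by (intro add_mono bounded_functional_norm[OF h rA] bounded_functional_norm[OF h' rA]) auto
    also have "\<dots> \<le> \<bar>K\<bar> * d + \<bar>K'\<bar> * d" using d by (intro add_mono mult_right_mono) auto
    also have "\<dots> \<le> (\<bar>K\<bar> + \<bar>K'\<bar> + 1) * d" using d by (simp add: algebra_simps)
    also have "\<dots> = e"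
    proof -
      have "\<bar>K\<bar> + \<bar>K'\<bar> + 1 \<noteq> 0" using abs_ge_zero[of K] abs_ge_zero[of K'] by linarith
      then show ?thesis by (simp add: d_def)
    qed
    finally show ?thesis .
  qed
  then have "norm (h f - h' f) \<le> 0" by (metis dense_ge)
  then show ?thesis by simp
qed

text \<open>Density is used once per factor: for a fixed character as left factor both sides are
  bounded functionals of \<open>g\<close>; commutativity then allows an arbitrary left factor to be
  fixed instead.\<close>

lemma bounded_functional_mult:
  assumes h: "bounded_functional K h"
    and chi: "\<And>m n m' n'. 0 \<le> weight m n \<Longrightarrow> 0 \<le> weight m' n' \<Longrightarrow>
      h (chi (m + m') (n + n')) = h (chi m n) * h (chi m' n')"
    and f: "f \<in> \<A>" and g: "g \<in> \<A>"
  shows "h (\<lambda>p. f p * g p) = h f * h g"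
proof -
  have left: "bounded_functional (K * B) (\<lambda>g. h (\<lambda>p. f p * g p))"
    if f: "f \<in> \<A>" and B: "\<And>p. p \<in> T2 \<Longrightarrow> norm (f p) \<le> B" for f B
    unfolding bounded_functional_def
  proof (intro conjI ballI allI impI)
    fix g g' assume "g \<in> \<A>" "g' \<in> \<A>"
    then have "h (\<lambda>p. f p * g p + f p * g' p) = h (\<lambda>p. f p * g p) + h (\<lambda>p. f p * g' p)"
      by (intro bounded_functional_add[OF h] Aalpha_mult[OF f])
    then show "h (\<lambda>p. f p * (g p + g' p)) = h (\<lambda>p. f p * g p) + h (\<lambda>p. f p * g' p)"
      by (simp add: distrib_left)
  next
    fix g c assume "g \<in> \<A>"
    then have "h (\<lambda>p. c * (f p * g p)) = c * h (\<lambda>p. f p * g p)"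
      by (intro bounded_functional_scale[OF h] Aalpha_mult[OF f])
    then show "h (\<lambda>p. f p * (c * g p)) = c * h (\<lambda>p. f p * g p)" by (simp add: mult.left_commute)
  next
    fix g C assume g: "g \<in> \<A>" and C: "\<forall>p\<in>T2. norm (g p) \<le> C"
    have "\<forall>p\<in>T2. norm (f p * g p) \<le> B * C"
      unfolding norm_mult using B C by (auto intro!: mult_mono intro: order_trans[OF norm_ge_zero])
    then have "norm (h (\<lambda>p. f p * g p)) \<le> K * (B * C)"
      by (intro bounded_functional_norm[OF h Aalpha_mult[OF f g]]) blast
    then show "norm (h (\<lambda>p. f p * g p)) \<le> K * B * C" by (simp add: mult.assoc)
  qed
  have right: "bounded_functional (norm c * K) (\<lambda>g. c * h g)" for c
    unfolding bounded_functional_def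
  proof (intro conjI ballI allI impI)
    fix g C assume g: "g \<in> \<A>" and C: "\<forall>p\<in>T2. norm (g p) \<le> C"
    then have "norm (h g) \<le> K * C" using h unfolding bounded_functional_def by blast
    then show "norm (c * h g) \<le> norm c * K * C" by (simp add: norm_mult mult.assoc mult_left_mono)
  qed (use h in \<open>auto simp: bounded_functional_def algebra_simps\<close>)
  have step: "h (\<lambda>p. chi m n p * g p) = h (chi m n) * h g" if w: "0 \<le> weight m n" and g: "g \<in> \<A>" for m n g
  proof (rule bounded_functional_eqI[OF left[OF chi_in_Aalpha[OF w], of 1] right _ g])
    show "norm (chi m n p) \<le> 1" for p by (rule norm_chi_le)
    show "h (\<lambda>p. chi m n p * chi m' n' p) = h (chi m n) * h (chi m' n')" if "0 \<le> weight m' n'" for m' n'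
      unfolding chi_mult using chi[OF w that] .
  qed
  obtain B where B: "\<And>p. p \<in> T2 \<Longrightarrow> norm (f p) \<le> B" using CT2_bounded[OF Aalpha_CT2[OF f]] by metis
  show ?thesis
  proof (rule bounded_functional_eqI[OF left[OF f B] right _ g])
    show "h (\<lambda>p. f p * chi m n p) = h f * h (chi m n)" if "0 \<le> weight m n" for m n
      using step[OF that f] by (simp add: mult.commute)
  qed
qed

definition character :: "((complex \<times> complex \<Rightarrow> complex) \<Rightarrow> complex) \<Rightarrow> bool" where
  "character h \<longleftrightarrow> bounded_functional 1 h \<and> h (chi 0 0) = 1
     \<and> (\<forall>f\<in>\<A>. \<forall>g\<in>\<A>. h (\<lambda>p. f p * g p) = h f * h g)"

lemma character_mult: "character h \<Longrightarrow> f \<in> \<A> \<Longrightarrow> g \<in> \<A> \<Longrightarrow> h (\<lambda>p. f p * g p) = h f * h g"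
  by (simp add: character_def)

lemma character_chi_add:
  "character h \<Longrightarrow> 0 \<le> weight m n \<Longrightarrow> 0 \<le> weight m' n' \<Longrightarrow> h (chi (m + m') (n + n')) = h (chi m n) * h (chi m' n')"
  using character_mult[OF _ chi_in_Aalpha chi_in_Aalpha, of h m n m' n'] by (simp add: chi_mult)

lemma character_chi_norm_le: "character h \<Longrightarrow> 0 \<le> weight m n \<Longrightarrow> norm (h (chi m n)) \<le> 1"
  using chi_in_Aalpha[of m n] norm_chi_le[of m n] unfolding character_def bounded_functional_def by (metis mult_1)

lemma characterI:
  assumes "bounded_functional 1 h" "h (chi 0 0) = 1"
    and "\<And>m n m' n'. 0 \<le> weight m n \<Longrightarrow> 0 \<le> weight m' n' \<Longrightarrow>
      h (chi (m + m') (n + n')) = h (chi m n) * h (chi m' n')"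
  shows "character h"
  using assms bounded_functional_mult[OF assms(1,3)] by (simp add: character_def)

lemma weight_eq_0_iff: "\<alpha> \<notin> \<rat> \<Longrightarrow> weight m n = 0 \<longleftrightarrow> m = 0 \<and> n = 0"
  using irrational_lin_indep[of m n 0 0] by (auto simp: weight_def)

lemma torus_mean_chi: "torus_mean (chi m n) = (if m = 0 \<and> n = 0 then 1 else 0)"
  using torus_mean_cong[of "chi m n" "torus_char m n"] torus_mean_torus_char by (simp add: on_T2_def)

text \<open>Non-negative weights add up to 0 only if both are 0, and then both exponents vanish by
  irrationality.\<close>

lemma character_torus_mean:
  assumes "\<alpha> \<notin> \<rat>"
  shows "character torus_mean"
proof (rule characterI)
  show "bounded_functional 1 torus_mean"
    unfolding bounded_functional_def
    by (auto intro!: torus_mean_add torus_mean_mult_left torus_mean_norm_le intro: Aalpha_continuous)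
  fix m n m' n' assume w: "0 \<le> weight m n" "0 \<le> weight m' n'"
  then have "weight (m + m') (n + n') = 0 \<longleftrightarrow> weight m n = 0 \<and> weight m' n' = 0"
    by (simp add: weight_add add_nonneg_eq_0_iff)
  then show "torus_mean (chi (m + m') (n + n')) = torus_mean (chi m n) * torus_mean (chi m' n')"
    unfolding weight_eq_0_iff[OF assms] torus_mean_chi by auto
qed (simp add: torus_mean_chi)

lemma leaf_value_add:
  "f \<in> \<A> \<Longrightarrow> g \<in> \<A> \<Longrightarrow> 0 \<le> Im \<zeta> \<Longrightarrow> leaf_value (\<lambda>p. f p + g p) \<zeta> = leaf_value f \<zeta> + leaf_value g \<zeta>"
  using leaf_value_eqI[OF Aalpha_add leaf_extension_add[OF leaf_extension_leaf_value leaf_extension_leaf_value]] by blast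

lemma leaf_value_scale:
  "f \<in> \<A> \<Longrightarrow> 0 \<le> Im \<zeta> \<Longrightarrow> leaf_value (\<lambda>p. c * f p) \<zeta> = c * leaf_value f \<zeta>"
  using leaf_value_eqI[OF Aalpha_scale leaf_extension_scale[OF leaf_extension_leaf_value]] by blast

lemma leaf_value_norm_le:
  "f \<in> \<A> \<Longrightarrow> (\<And>p. p \<in> T2 \<Longrightarrow> norm (f p) \<le> B) \<Longrightarrow> 0 \<le> Im \<zeta> \<Longrightarrow> norm (leaf_value f \<zeta>) \<le> B"
  using leaf_extension_norm_le[OF leaf_extension_leaf_value] by blast

lemma leaf_value_chi:
  assumes "0 \<le> weight m n" "0 \<le> Im \<zeta>"
  shows "leaf_value (chi m n) \<zeta> = exp (\<i> * of_real (weight m n) * \<zeta>)"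
proof -
  have "leaf_extension (\<lambda>p. 1 * torus_char m n p) (\<lambda>\<zeta>. 1 * exp (\<i> * of_real (weight m n) * \<zeta>))"
    by (intro leaf_extension_hardy_poly hardy_poly.char assms)
  then have "leaf_extension (chi m n) (\<lambda>\<zeta>. 1 * exp (\<i> * of_real (weight m n) * \<zeta>))"
    by (rule leaf_extension_cong) (simp add: on_T2_def)
  then show ?thesis using leaf_value_eqI[OF chi_in_Aalpha] assms by fastforce
qed

lemma character_leaf_value:
  assumes "0 \<le> Im \<zeta>"
  shows "character (\<lambda>f. leaf_value f \<zeta>)"
proof (rule characterI)
  show "bounded_functional 1 (\<lambda>f. leaf_value f \<zeta>)"
    unfolding bounded_functional_def
    using leaf_value_add leaf_value_scale leaf_value_norm_le assms by auto
qed (use assms in \<open>simp_all add: leaf_value_chi weight_add algebra_simps exp_add\<close>)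

section \<open>Substitutions and evaluation on rotated leaves\<close>

lemma hardy_poly_compose:
  assumes \<phi>: "\<And>m n. 0 \<le> weight m n \<Longrightarrow> \<exists>c m' n'. 0 \<le> weight m' n' \<and> (\<forall>p\<in>T2. torus_char m n (\<phi> p) = c * torus_char m' n' p)"
    and h: "(h, H) \<in> hardy_poly"
  shows "\<exists>h' H'. (h', H') \<in> hardy_poly \<and> (\<forall>p\<in>T2. h' p = h (\<phi> p))"
  using h
proof (induction rule: hardy_poly.induct)
  case (char m n c)
  then obtain c' m' n' where "0 \<le> weight m' n'" and *: "\<forall>p\<in>T2. torus_char m n (\<phi> p) = c' * torus_char m' n' p"
    using \<phi> by blast
  from hardy_poly.char[OF this(1), of "c * c'"] show ?case
    by (intro exI conjI) (assumption, simp add: * mult.assoc)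
next
  case (add f F g G)
  then obtain f' F' g' G' where "(f', F') \<in> hardy_poly" "\<forall>p\<in>T2. f' p = f (\<phi> p)" "(g', G') \<in> hardy_poly" "\<forall>p\<in>T2. g' p = g (\<phi> p)"
    by blast
  then show ?case using hardy_poly.add[of f' F' g' G'] by (intro exI conjI) (assumption, simp)
qed

text \<open>Covers rotations and matrix substitutions alike: apart from continuity, only the effect
  on characters matters, and that up to a constant factor.\<close>

lemma Aalpha_compose:
  assumes \<phi>: "\<And>m n. 0 \<le> weight m n \<Longrightarrow> \<exists>c m' n'. 0 \<le> weight m' n' \<and> (\<forall>p\<in>T2. torus_char m n (\<phi> p) = c * torus_char m' n' p)"
    and cont: "continuous_on T2 \<phi>" and im: "\<And>p. p \<in> T2 \<Longrightarrow> \<phi> p \<in> T2"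
    and f: "f \<in> \<A>"
  shows "on_T2 (\<lambda>p. f (\<phi> p)) \<in> \<A>"
proof (rule Aalpha_if_approx)
  have "continuous_on T2 (\<lambda>p. f (\<phi> p))"
    by (rule continuous_on_compose2[OF Aalpha_continuous[OF f] cont]) (use im in blast)
  then show "on_T2 (\<lambda>p. f (\<phi> p)) \<in> CT2" by (rule on_T2_in_CT2)
  fix e :: real assume "0 < e"
  then obtain h H where h: "(h, H) \<in> hardy_poly" "\<And>p. p \<in> T2 \<Longrightarrow> norm (f p - h p) \<le> e"
    using Aalpha_approx[OF f] by metis
  obtain h' H' where h': "(h', H') \<in> hardy_poly" "\<forall>p\<in>T2. h' p = h (\<phi> p)"
    using hardy_poly_compose[OF \<phi> h(1)] by blast
  show "\<exists>h H. (h, H) \<in> hardy_poly \<and> (\<forall>p\<in>T2. norm (on_T2 (\<lambda>p. f (\<phi> p)) p - h p) \<le> e)"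
    using h'(1) by (intro exI conjI) (assumption, simp add: on_T2_def h'(2) h(2) im)
qed

lemma T2_mult_closed: "c \<in> T2 \<Longrightarrow> p \<in> T2 \<Longrightarrow> (fst c * fst p, snd c * snd p) \<in> T2"
  by (simp add: mem_T2_iff norm_mult)

lemma torus_char_mult: "torus_char m n (fst c * fst p, snd c * snd p) = torus_char m n c * torus_char m n p"
  by (simp add: torus_char_def power_int_mult_distrib)

lemma pi_c_eq: "pi_c c f = on_T2 (\<lambda>p. f (fst c * fst p, snd c * snd p))"
  by (rule ext) (simp add: pi_c_def on_T2_def case_prod_unfold)

lemma pi_c_in_Aalpha:
  assumes c: "c \<in> T2" and f: "f \<in> \<A>"
  shows "pi_c c f \<in> \<A>"
  unfolding pi_c_eq
proof (rule Aalpha_compose[OF _ _ _ f])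
  show "\<exists>c' m' n'. 0 \<le> weight m' n' \<and> (\<forall>p\<in>T2. torus_char m n (fst c * fst p, snd c * snd p) = c' * torus_char m' n' p)"
    if "0 \<le> weight m n" for m n
    using that by (intro exI[of _ "torus_char m n c"] exI[of _ m] exI[of _ n]) (simp add: torus_char_mult)
qed (auto intro!: continuous_intros T2_mult_closed c)

lemma pi_c_add: "pi_c c (\<lambda>p. f p + g p) = (\<lambda>p. pi_c c f p + pi_c c g p)"
  by (rule ext) (simp add: pi_c_eq on_T2_def)

lemma pi_c_scale: "pi_c c (\<lambda>p. a * f p) = (\<lambda>p. a * pi_c c f p)"
  by (rule ext) (simp add: pi_c_eq on_T2_def)

lemma pi_c_chi: "c \<in> T2 \<Longrightarrow> pi_c c (chi m n) = (\<lambda>p. torus_char m n c * chi m n p)"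
  by (rule ext) (simp add: pi_c_eq on_T2_def torus_char_mult T2_mult_closed)

text \<open>Rotating by \<open>c\<close> replaces the leaf through \<open>(1, 1)\<close> by the leaf
  through \<open>c\<close>, so these functionals evaluate at the points of all leaves.\<close>

lemma character_leaf_value_pi_c:
  assumes c: "c \<in> T2" and z: "0 \<le> Im \<zeta>"
  shows "character (\<lambda>f. leaf_value (pi_c c f) \<zeta>)"
proof (rule characterI)
  show "bounded_functional 1 (\<lambda>f. leaf_value (pi_c c f) \<zeta>)"
    unfolding bounded_functional_def
  proof (intro conjI ballI allI impI)
    fix f B assume f: "f \<in> \<A>" and B: "\<forall>p\<in>T2. norm (f p) \<le> B"
    have "norm (pi_c c f p) \<le> B" if "p \<in> T2" for p
      using that B T2_mult_closed[OF c that] by (simp add: pi_c_eq on_T2_def)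
    then show "norm (leaf_value (pi_c c f) \<zeta>) \<le> 1 * B"
      using leaf_value_norm_le[OF pi_c_in_Aalpha[OF c f]] z by simp
  qed (simp_all add: pi_c_add pi_c_scale leaf_value_add leaf_value_scale pi_c_in_Aalpha c z)
next
  have val: "leaf_value (pi_c c (chi m n)) \<zeta> = torus_char m n c * exp (\<i> * of_real (weight m n) * \<zeta>)"
    if "0 \<le> weight m n" for m n
    using that z by (simp add: pi_c_chi[OF c] leaf_value_scale leaf_value_chi chi_in_Aalpha del: torus_char_0)
  show "leaf_value (pi_c c (chi 0 0)) \<zeta> = 1" by (simp add: val)
  fix m n m' n' assume "0 \<le> weight m n" "0 \<le> weight m' n'"
  then show "leaf_value (pi_c c (chi (m + m') (n + n'))) \<zeta> = leaf_value (pi_c c (chi m n)) \<zeta> * leaf_value (pi_c c (chi m' n')) \<zeta>"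
    by (simp add: val torus_char_add[OF c] weight_add exp_add algebra_simps)
qed

section \<open>Homomorphisms on exponents and the classification of characters\<close>

text \<open>Every exponent is a difference of two exponents in the first quadrant, which lies in the
  half-plane since \<open>0 < \<alpha>\<close>. Hence the two generators determine all values,
  including those with a negative coordinate.\<close>

lemma half_plane_hom_powi:
  fixes H :: "int \<Rightarrow> int \<Rightarrow> 'a::field"
  assumes \<alpha>: "0 < \<alpha>"
    and hom: "\<And>m n m' n'. 0 \<le> weight m n \<Longrightarrow> 0 \<le> weight m' n' \<Longrightarrow> H (m + m') (n + n') = H m n * H m' n'"
    and "H 0 0 = 1" "H 1 0 \<noteq> 0" "H 0 1 \<noteq> 0" "0 \<le> weight m n"
  shows "H m n = H 1 0 powi m * H 0 1 powi n"
proof -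
  have w: "0 \<le> weight (int a) (int b)" for a b using \<alpha> by (simp add: weight_def)
  have H1: "H (int a) 0 = H 1 0 ^ a" for a
  proof (induction a)
    case (Suc a) then show ?case using hom[OF w[of 1 0] w[of a 0]] by simp
  qed (simp add: assms)
  have H2: "H 0 (int b) = H 0 1 ^ b" for b
  proof (induction b)
    case (Suc b) then show ?case using hom[OF w[of 0 1] w[of 0 b]] by simp
  qed (simp add: assms)
  have H12: "H (int a) (int b) = H 1 0 ^ a * H 0 1 ^ b" for a b
    using hom[OF w[of a 0] w[of 0 b]] by (simp add: H1 H2)
  define a b c d where "a = nat m" and "b = nat (- m)" and "c = nat n" and "d = nat (- n)"
  have mn: "m + int b = int a" "n + int d = int c" by (auto simp: a_def b_def c_def d_def)
  have "H (int a) (int c) = H m n * H (int b) (int d)"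
    using hom[OF assms(6) w[of b d]] by (simp add: mn)
  then have e: "H 1 0 ^ a * H 0 1 ^ c = H m n * (H 1 0 ^ b * H 0 1 ^ d)" by (simp add: H12)
  have "H 1 0 powi m * H 1 0 ^ b = H 1 0 ^ a" "H 0 1 powi n * H 0 1 ^ d = H 0 1 ^ c"
    using power_int_add[of "H 1 0" m "int b"] power_int_add[of "H 0 1" n "int d"] assms(4,5) mn by simp_all
  then have "(H 1 0 powi m * H 0 1 powi n) * (H 1 0 ^ b * H 0 1 ^ d) = H m n * (H 1 0 ^ b * H 0 1 ^ d)"
    using e by (metis mult.assoc mult.left_commute)
  then show ?thesis using assms(4,5) by simp
qed

text \<open>Exponents of weight between 0 and 1 exist for every \<open>n\<close>. On them the form
  equals \<open>P * weight m n + D * of_int n\<close>, which is unbounded below unless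
  \<open>D = 0\<close>.\<close>

lemma nonneg_on_half_plane_imp_proportional:
  fixes P Q :: real
  assumes "\<And>m n. 0 \<le> weight m n \<Longrightarrow> 0 \<le> P * of_int m + Q * of_int n"
  shows "Q = \<alpha> * P"
proof (rule ccontr)
  assume "Q \<noteq> \<alpha> * P"
  define D where "D = Q - \<alpha> * P"
  have D: "D \<noteq> 0" using \<open>Q \<noteq> \<alpha> * P\<close> by (simp add: D_def)
  have P: "0 \<le> P" using assms[of 1 0] by (simp add: weight_def)
  obtain n :: int where n: "D * of_int n < - P"
  proof -
    obtain k :: nat where k: "P / \<bar>D\<bar> < real k" using reals_Archimedean2 by blast
    then have "P < \<bar>D\<bar> * real k" using D by (simp add: pos_divide_less_eq mult.commute)
    then have "D * of_int (if 0 < D then - int k else int k) < - P" by auto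
    then show ?thesis by (rule that)
  qed
  \<comment> \<open>Least \<open>m\<close> that makes the weight non-negative.\<close>
  define m where "m = \<lceil>- \<alpha> * of_int n\<rceil>"
  have w: "0 \<le> weight m n" "weight m n \<le> 1" unfolding weight_def m_def by linarith+
  have "P * of_int m + Q * of_int n = P * weight m n + D * of_int n"
    by (simp add: weight_def D_def algebra_simps)
  also have "\<dots> \<le> P * 1 + D * of_int n" using mult_left_mono[OF w(2) P] by simp
  also have "\<dots> < 0" using n by simp
  finally show False using assms[OF w(1)] by simp
qed

lemma character_chi_power:
  assumes "character h" "0 \<le> weight m n"
  shows "h (chi (int N * m) (int N * n)) = h (chi m n) ^ N \<and> 0 \<le> weight (int N * m) (int N * n)"
proof (induction N)
  case 0 then show ?case using assms by (simp add: character_def del: torus_char_0)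
next
  case (Suc N)
  then show ?case
    using character_chi_add[OF assms(1) assms(2), of "int N * m" "int N * n"] assms(2)
      weight_add[of m "int N * m" n "int N * n"]
    by (simp add: distrib_right)
qed

lemma weight_of_nat_mult: "weight (int N * m) (int N * n) = real N * weight m n"
  by (simp add: weight_def algebra_simps)

text \<open>Archimedean divisibility: some power of the character of positive weight is a multiple
  of the one that is killed.\<close>

lemma character_chi_vanishing:
  assumes h: "character h" and 0: "h (chi m n) = 0" "0 \<le> weight m n" and w: "0 < weight m' n'"
  shows "h (chi m' n') = 0"
proof -
  obtain N :: nat where "weight m n / weight m' n' < real N" using reals_Archimedean2 by blast
  then have "weight m n \<le> weight (int N * m') (int N * n')"
    using w by (simp add: weight_of_nat_mult pos_divide_less_eq)
  moreover have "weight (int N * m') (int N * n') = weight m n + weight (int N * m' - m) (int N * n' - n)"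
    using weight_add[of m "int N * m' - m" n "int N * n' - n"] by simp
  ultimately have "h (chi (int N * m') (int N * n')) = h (chi m n) * h (chi (int N * m' - m) (int N * n' - n))"
    using character_chi_add[OF h 0(2), of "int N * m' - m" "int N * n' - n"] by simp
  then have "h (chi m' n') ^ N = 0" using character_chi_power[OF h, of m' n' N] 0 w by simp
  then show ?thesis by simp
qed

text \<open>Non-vanishing gives values \<open>Z powi m * W powi n\<close>. Their moduli are at most
  1 on the half-plane, which ties the decay rates of \<open>Z\<close> and \<open>W\<close> together
  as \<open>y\<close> and \<open>\<alpha> * y\<close>; the moduli thus become a height on the leaf
  and the phases a rotation.\<close>

lemma character_classification:
  assumes \<alpha>: "0 < \<alpha>" and h: "character h" and nz: "h (chi m0 n0) \<noteq> 0" "0 < weight m0 n0"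
  obtains x y where "x \<in> T2" "0 \<le> y" "\<And>f. f \<in> \<A> \<Longrightarrow> h f = leaf_value (pi_c x f) (\<i> * of_real y)"
proof -
  have nz': "h (chi m n) \<noteq> 0" if "0 \<le> weight m n" for m n
    using character_chi_vanishing[OF h _ that nz(2)] nz(1) by blast
  have w10: "0 \<le> weight 1 0" "0 \<le> weight 0 1" using \<alpha> by (auto simp: weight_def)
  define Z where "Z = h (chi 1 0)"
  define W where "W = h (chi 0 1)"
  have ZW: "Z \<noteq> 0" "W \<noteq> 0" using nz' w10 by (auto simp: Z_def W_def)
  have H: "h (chi m n) = Z powi m * W powi n" if "0 \<le> weight m n" for m n
    unfolding Z_def W_def
    by (rule half_plane_hom_powi[where H = "\<lambda>m n. h (chi m n)", OF \<alpha> _ _ _ _ that])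
      (use h ZW character_chi_add[OF h] in \<open>auto simp: character_def Z_def W_def\<close>)
  define y where "y = - ln (norm Z)"
  define Q where "Q = - ln (norm W)"
  have eZ: "norm Z = exp (- y)" and eW: "norm W = exp (- Q)" using ZW by (auto simp: y_def Q_def)
  have nH: "norm (Z powi m * W powi n) = exp (- (y * of_int m + Q * of_int n))" for m n
    by (simp add: norm_mult norm_power_int eZ eW algebra_simps exp_power_int flip: exp_minus exp_add)
  have "0 \<le> y * of_int m + Q * of_int n" if "0 \<le> weight m n" for m n
    using character_chi_norm_le[OF h that] unfolding H[OF that] nH by simp
  then have Q: "Q = \<alpha> * y" by (rule nonneg_on_half_plane_imp_proportional)
  have y0: "0 \<le> y" using character_chi_norm_le[OF h w10(1)] eZ by (simp add: Z_def)
  define x where "x = (Z / of_real (norm Z), W / of_real (norm W))"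
  have x: "x \<in> T2" using ZW by (simp add: x_def mem_T2_iff norm_divide)
  have z0: "0 \<le> Im (\<i> * of_real y)" using y0 by simp
  have "h f = leaf_value (pi_c x f) (\<i> * of_real y)" if f: "f \<in> \<A>" for f
  proof (rule bounded_functional_eqI[OF _ _ _ f])
    show "bounded_functional 1 h" "bounded_functional 1 (\<lambda>f. leaf_value (pi_c x f) (\<i> * of_real y))"
      using h character_leaf_value_pi_c[OF x z0] by (auto simp: character_def)
    fix m n assume w: "0 \<le> weight m n"
    have "leaf_value (pi_c x (chi m n)) (\<i> * of_real y) = torus_char m n x * exp (\<i> * of_real (weight m n) * (\<i> * of_real y))"
      using w z0 by (simp add: pi_c_chi[OF x] leaf_value_scale chi_in_Aalpha leaf_value_chi)
    also have "exp (\<i> * of_real (weight m n) * (\<i> * of_real y)) = of_real (exp (- (weight m n * y)))"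
    proof -
      have "\<i> * of_real (weight m n) * (\<i> * of_real y) = of_real (- (weight m n * y))"
        by (simp add: complex_eq_iff)
      then show ?thesis by (simp only: exp_of_real)
    qed
    also have "exp (- (weight m n * y)) = norm (Z powi m * W powi n)"
      unfolding nH Q by (simp add: weight_def algebra_simps)
    also have "torus_char m n x * of_real (norm (Z powi m * W powi n)) = Z powi m * W powi n"
      using ZW by (simp add: x_def torus_char_def power_int_divide_distrib norm_mult norm_power_int)
    finally show "h (chi m n) = leaf_value (pi_c x (chi m n)) (\<i> * of_real y)" by (simp add: H[OF w])
  qed
  then show ?thesis using that x y0 by blast
qed

section \<open>Isometric automorphisms map characters to characters\<close>

lemma supnorm_le_iff:
  assumes "f \<in> CT2"
  shows "supnorm f \<le> B \<longleftrightarrow> (\<forall>p\<in>T2. norm (f p) \<le> B)"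
proof -
  obtain C where "\<And>p. p \<in> T2 \<Longrightarrow> norm (f p) \<le> C" using CT2_bounded[OF assms] by metis
  then have bdd: "bdd_above ((\<lambda>p. norm (f p)) ` T2)" by (intro bdd_aboveI2) auto
  have ne: "T2 \<noteq> {}" using one_mem_T2 by blast
  show ?thesis unfolding supnorm_def by (rule cSUP_le_iff[OF ne bdd])
qed

lemma AutD:
  assumes "\<Phi> \<in> Aut \<alpha>"
  shows Aut_extensional: "\<Phi> \<in> extensional \<A>"
    and Aut_bij: "bij_betw \<Phi> \<A> \<A>"
    and Aut_closed: "f \<in> \<A> \<Longrightarrow> \<Phi> f \<in> \<A>"
    and Aut_add: "f \<in> \<A> \<Longrightarrow> g \<in> \<A> \<Longrightarrow> \<Phi> (\<lambda>p. f p + g p) = (\<lambda>p. \<Phi> f p + \<Phi> g p)"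
    and Aut_scale: "f \<in> \<A> \<Longrightarrow> \<Phi> (\<lambda>p. c * f p) = (\<lambda>p. c * \<Phi> f p)"
    and Aut_mult: "f \<in> \<A> \<Longrightarrow> g \<in> \<A> \<Longrightarrow> \<Phi> (\<lambda>p. f p * g p) = (\<lambda>p. \<Phi> f p * \<Phi> g p)"
    and Aut_supnorm: "f \<in> \<A> \<Longrightarrow> supnorm (\<Phi> f) = supnorm f"
  using assms unfolding Aut_def bij_betw_def by blast+

lemma Aut_norm_le_iff:
  assumes "\<Phi> \<in> Aut \<alpha>" "f \<in> \<A>"
  shows "(\<forall>p\<in>T2. norm (\<Phi> f p) \<le> B) \<longleftrightarrow> (\<forall>p\<in>T2. norm (f p) \<le> B)"
  using supnorm_le_iff[OF Aalpha_CT2[OF assms(2)], of B]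
    supnorm_le_iff[OF Aalpha_CT2[OF Aut_closed[OF assms]], of B] Aut_supnorm[OF assms] by simp

lemma Aut_inverse:
  assumes \<Phi>: "\<Phi> \<in> Aut \<alpha>"
  shows "\<exists>\<Psi>\<in>Aut \<alpha>. \<forall>f\<in>\<A>. \<Phi> (\<Psi> f) = f \<and> \<Psi> (\<Phi> f) = f"
proof -
  define \<Psi> where "\<Psi> = restrict (inv_into \<A> \<Phi>) \<A>"
  have bij: "bij_betw \<Phi> \<A> \<A>" by (rule Aut_bij[OF \<Phi>])
  have 1: "\<Psi> (\<Phi> f) = f" if "f \<in> \<A>" for f
    using bij_betw_inv_into_left[OF bij that] Aut_closed[OF \<Phi> that] by (simp add: \<Psi>_def)
  have 2: "\<Phi> (\<Psi> f) = f" if "f \<in> \<A>" for f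
    using bij_betw_inv_into_right[OF bij that] that by (simp add: \<Psi>_def)
  have bij\<Psi>: "bij_betw \<Psi> \<A> \<A>"
    using bij_betw_inv_into[OF bij] unfolding \<Psi>_def by (simp cong: bij_betw_cong)
  then have cl: "\<Psi> f \<in> \<A>" if "f \<in> \<A>" for f using that bij_betwE by blast
  have "\<Psi> \<in> Aut \<alpha>"
    unfolding Aut_def
  proof (intro CollectI conjI ballI allI)
    show "\<Psi> \<in> extensional \<A>" by (simp add: \<Psi>_def)
    show "bij_betw \<Psi> \<A> \<A>" by (rule bij\<Psi>)
    fix f assume f: "f \<in> \<A>"
    show "supnorm (\<Psi> f) = supnorm f" using Aut_supnorm[OF \<Phi> cl[OF f]] 2[OF f] by simp
    show "\<Psi> (\<lambda>p. a * f p) = (\<lambda>p. a * \<Psi> f p)" for a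
      using 1[OF Aalpha_scale[OF cl[OF f]], of a] Aut_scale[OF \<Phi> cl[OF f], of a] 2[OF f] by simp
    fix g assume g: "g \<in> \<A>"
    show "\<Psi> (\<lambda>p. f p + g p) = (\<lambda>p. \<Psi> f p + \<Psi> g p)"
      using 1[OF Aalpha_add[OF cl[OF f] cl[OF g]]] Aut_add[OF \<Phi> cl[OF f] cl[OF g]] 2[OF f] 2[OF g] by simp
    show "\<Psi> (\<lambda>p. f p * g p) = (\<lambda>p. \<Psi> f p * \<Psi> g p)"
      using 1[OF Aalpha_mult[OF cl[OF f] cl[OF g]]] Aut_mult[OF \<Phi> cl[OF f] cl[OF g]] 2[OF f] 2[OF g] by simp
  qed
  then show ?thesis using 1 2 by (intro bexI[of _ \<Psi>]) auto
qed

text \<open>\<open>chi 0 0\<close> is the unit of the algebra, and surjectivity makes its image a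
  unit again.\<close>

lemma Aut_chi_0:
  assumes "\<Phi> \<in> Aut \<alpha>"
  shows "\<Phi> (chi 0 0) = chi 0 0"
proof -
  have one: "chi 0 0 \<in> \<A>" by (rule chi_in_Aalpha) simp
  obtain \<Psi> where \<Psi>: "\<Psi> \<in> Aut \<alpha>" "\<And>f. f \<in> \<A> \<Longrightarrow> \<Phi> (\<Psi> f) = f" "\<And>f. f \<in> \<A> \<Longrightarrow> \<Psi> (\<Phi> f) = f"
    using Aut_inverse[OF assms] by blast
  have unit: "(\<lambda>p. chi 0 0 p * f p) = f" if "f \<in> \<A>" for f
    using Aalpha_outside[OF that] by (auto simp: on_T2_def)
  have "(\<lambda>p. \<Phi> (chi 0 0) p * chi 0 0 p) = chi 0 0"
    using Aut_mult[OF assms one Aut_closed[OF \<Psi>(1) one]] unit[OF Aut_closed[OF \<Psi>(1) one]] \<Psi>(2)[OF one]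
    by simp
  moreover have "(\<lambda>p. \<Phi> (chi 0 0) p * chi 0 0 p) = \<Phi> (chi 0 0)"
    using unit[OF Aut_closed[OF assms one]] by (simp only: mult.commute)
  ultimately show ?thesis by simp
qed

lemma norm_one_plus_unit_less:
  fixes e :: complex
  assumes "norm e = 1" "e \<noteq> 1"
  shows "norm (1 + e) < 2"
proof -
  have e2: "(Re e)\<^sup>2 + (Im e)\<^sup>2 = 1" using assms(1) cmod_power2[of e] by simp
  have "Re e \<le> 1" using abs_Re_le_cmod[of e] assms(1) by simp
  moreover have "Re e \<noteq> 1"
  proof
    assume "Re e = 1"
    then have "Im e = 0" using e2 by simp
    then show False using \<open>Re e = 1\<close> assms(2) by (simp add: complex_eq_iff)
  qed
  moreover have "(norm (1 + e))\<^sup>2 = 2 + 2 * Re e"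
    using e2 unfolding cmod_power2 by (simp add: power2_eq_square algebra_simps)
  ultimately have "(norm (1 + e))\<^sup>2 < 2\<^sup>2" by simp
  then show ?thesis by (rule power2_less_imp_less) simp
qed

text \<open>The average of 1 and a rotated coordinate has modulus 1 only where the two agree; the
  product of one such factor per coordinate peaks at a single point.\<close>

lemma peak_function:
  assumes \<alpha>: "0 < \<alpha>" and p0: "p0 \<in> T2"
  obtains g where "g \<in> \<A>" "g p0 = 1" "\<And>p. p \<in> T2 \<Longrightarrow> p \<noteq> p0 \<Longrightarrow> norm (g p) < 1"
proof -
  define a where "a p = 1/2 * chi 0 0 p + cnj (fst p0) / 2 * chi 1 0 p" for p
  define b where "b p = 1/2 * chi 0 0 p + cnj (snd p0) / 2 * chi 0 1 p" for p
  define g where "g p = a p * b p" for p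
  have w: "0 \<le> weight 0 0" "0 \<le> weight 1 0" "0 \<le> weight 0 1" using \<alpha> by (auto simp: weight_def)
  have "a \<in> \<A>" "b \<in> \<A>"
    unfolding a_def[abs_def] b_def[abs_def] by (intro Aalpha_add Aalpha_scale chi_in_Aalpha w)+
  then have "g \<in> \<A>" unfolding g_def[abs_def] by (rule Aalpha_mult)
  have ab: "a p = (1 + cnj (fst p0) * fst p) / 2" "b p = (1 + cnj (snd p0) * snd p) / 2" if "p \<in> T2" for p
    using that by (simp_all add: a_def b_def on_T2_def torus_char_def add_divide_distrib)
  have n0: "norm (fst p0) = 1" "norm (snd p0) = 1" using p0 by (auto simp: mem_T2_iff)
  have cc: "cnj u * u = 1" if "norm u = 1" for u :: complex
    using complex_norm_square[of u] that by (simp add: mult.commute)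
  have "g p0 = 1" using ab[OF p0] cc n0 by (simp add: g_def)
  moreover have "norm (g p) < 1" if p: "p \<in> T2" "p \<noteq> p0" for p
  proof -
    have n: "norm (fst p) = 1" "norm (snd p) = 1" using p by (auto simp: mem_T2_iff)
    have le: "norm (1 + e) \<le> 2" if "norm e = 1" for e :: complex
      using norm_triangle_ineq[of 1 e] that by simp
    have le1: "norm (a p) \<le> 1" "norm (b p) \<le> 1"
      using le[of "cnj (fst p0) * fst p"] le[of "cnj (snd p0) * snd p"] n n0 by (auto simp: ab[OF p(1)] norm_divide norm_mult)
    have strict: "norm ((1 + cnj v * u) / 2) < 1" if "norm v = 1" "norm u = 1" "u \<noteq> v" for u v :: complex
    proof -
      have "cnj v * u \<noteq> 1"
      proof
        assume "cnj v * u = 1"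
        then have "(cnj v * v) * u = v" by (simp add: mult_ac)
        then have "u = v" unfolding cc[OF that(1)] by simp
        then show False using that(3) by simp
      qed
      then show ?thesis using norm_one_plus_unit_less[of "cnj v * u"] that by (simp add: norm_divide norm_mult)
    qed
    have "fst p \<noteq> fst p0 \<or> snd p \<noteq> snd p0" using p(2) by (simp add: prod_eq_iff)
    then have "norm (a p) < 1 \<or> norm (b p) < 1" using strict n n0 by (auto simp: ab[OF p(1)])
    then show ?thesis unfolding g_def norm_mult
    proof
      assume "norm (a p) < 1"
      then show "norm (a p) * norm (b p) < 1"
        using mult_left_le[OF le1(2) norm_ge_zero[of "a p"]] by linarith
    next
      assume "norm (b p) < 1"
      then show "norm (a p) * norm (b p) < 1"
        using mult_right_le_one_le[OF norm_ge_zero[of "b p"] norm_ge_zero[of "a p"] le1(1)] by (simp add: mult.commute)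
    qed
  qed
  ultimately show ?thesis using that \<open>g \<in> \<A>\<close> by blast
qed

text \<open>Multiplication by a character is isometric, hence so is multiplication by its image
  \<open>u\<close>. For \<open>g\<close> peaking at \<open>p0\<close> the norm of
  \<open>u * g\<close> is therefore at least 1, and since \<open>norm u \<le> 1\<close> on the torus
  this can be attained only at \<open>p0\<close>.\<close>

lemma Aut_chi_norm:
  assumes \<alpha>: "0 < \<alpha>" and \<Phi>: "\<Phi> \<in> Aut \<alpha>" and w: "0 \<le> weight m n" and p0: "p0 \<in> T2"
  shows "norm (\<Phi> (chi m n) p0) = 1"
proof -
  define u where "u = \<Phi> (chi m n)"
  note chiA = chi_in_Aalpha[OF w]
  have uA: "u \<in> \<A>" unfolding u_def by (rule Aut_closed[OF \<Phi> chiA])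
  have u1: "norm (u p) \<le> 1" if "p \<in> T2" for p
    using Aut_norm_le_iff[OF \<Phi> chiA, of 1] norm_chi_le that by (simp add: u_def)
  obtain g where g: "g \<in> \<A>" "g p0 = 1" "\<And>p. p \<in> T2 \<Longrightarrow> p \<noteq> p0 \<Longrightarrow> norm (g p) < 1"
    using peak_function[OF \<alpha> p0] by metis
  obtain \<Psi> where \<Psi>: "\<Psi> \<in> Aut \<alpha>" "\<And>f. f \<in> \<A> \<Longrightarrow> \<Phi> (\<Psi> f) = f" "\<And>f. f \<in> \<A> \<Longrightarrow> \<Psi> (\<Phi> f) = f"
    using Aut_inverse[OF \<Phi>] by blast
  define k where "k = \<Psi> g"
  have kA: "k \<in> \<A>" unfolding k_def by (rule Aut_closed[OF \<Psi>(1) g(1)])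
  have \<Phi>k: "\<Phi> k = g" unfolding k_def by (rule \<Psi>(2)[OF g(1)])
  have ug: "\<Phi> (\<lambda>p. chi m n p * k p) = (\<lambda>p. u p * g p)"
    using Aut_mult[OF \<Phi> chiA kA] by (simp add: u_def \<Phi>k)
  have "T2 \<noteq> {}" using p0 by blast
  moreover have "continuous_on T2 (\<lambda>p. norm (u p * g p))"
    by (intro continuous_intros Aalpha_continuous[OF uA] Aalpha_continuous[OF g(1)])
  ultimately obtain q where q: "q \<in> T2" "\<forall>p\<in>T2. norm (u p * g p) \<le> norm (u q * g q)"
    using continuous_attains_sup[OF compact_T2] by blast
  have "\<forall>p\<in>T2. norm (chi m n p * k p) \<le> norm (u q * g q)"
    using Aut_norm_le_iff[OF \<Phi> Aalpha_mult[OF chiA kA], of "norm (u q * g q)"] q(2) by (simp add: ug)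
  then have "\<forall>p\<in>T2. norm (k p) \<le> norm (u q * g q)"
    by (simp add: on_T2_def norm_mult norm_torus_char)
  then have "\<forall>p\<in>T2. norm (g p) \<le> norm (u q * g q)"
    using Aut_norm_le_iff[OF \<Phi> kA] by (simp add: \<Phi>k)
  then have 1: "1 \<le> norm (u q) * norm (g q)" using p0 g(2) by (force simp: norm_mult)
  have "q = p0"
  proof (rule ccontr)
    assume "q \<noteq> p0"
    then have "norm (u q) * norm (g q) \<le> 1 * norm (g q)" using u1[OF q(1)] by (intro mult_right_mono) auto
    then show False using g(3)[OF q(1) \<open>q \<noteq> p0\<close>] 1 by simp
  qed
  then have "1 \<le> norm (u p0)" using 1 g(2) by simp
  then show ?thesis using u1[OF p0] by (simp add: u_def)
qed

lemma character_Aut: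
  assumes h: "character h" and \<Phi>: "\<Phi> \<in> Aut \<alpha>"
  shows "character (\<lambda>f. h (\<Phi> f))"
proof -
  have bf: "bounded_functional 1 h" using h by (simp add: character_def)
  have "bounded_functional 1 (\<lambda>f. h (\<Phi> f))"
    unfolding bounded_functional_def
  proof (intro conjI ballI allI impI)
    fix f B assume f: "f \<in> \<A>" and B: "\<forall>p\<in>T2. norm (f p) \<le> B"
    then have "\<forall>p\<in>T2. norm (\<Phi> f p) \<le> B" using Aut_norm_le_iff[OF \<Phi> f] by blast
    then show "norm (h (\<Phi> f)) \<le> 1 * B" using bounded_functional_norm[OF bf Aut_closed[OF \<Phi> f]] by blast
  qed (simp_all add: Aut_add[OF \<Phi>] Aut_scale[OF \<Phi>] bounded_functional_add[OF bf] bounded_functional_scale[OF bf] Aut_closed[OF \<Phi>])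
  then show ?thesis
    using h by (simp add: character_def Aut_chi_0[OF \<Phi>] Aut_mult[OF \<Phi>] Aut_closed[OF \<Phi>] del: torus_char_0)
qed

text \<open>Dirichlet's theorem makes \<open>k * \<alpha> - h\<close> small, irrationality makes it
  nonzero, and negating the exponent adjusts the sign.\<close>

lemma small_positive_weight:
  assumes irr: "\<alpha> \<notin> \<rat>" and e: "0 < e"
  obtains m n where "0 < weight m n" "weight m n < e"
proof -
  obtain N where N: "0 < N" "1 / real N < e" using ex_inverse_of_nat_less[OF e] by (auto simp: inverse_eq_divide)
  obtain h k where hk: "0 < k" "\<bar>of_int k * \<alpha> - of_int h\<bar> < 1 / real N" using Dirichlet_approx[OF N(1)] by metis
  have w: "weight (- h) k = of_int k * \<alpha> - of_int h" "weight h (- k) = - (of_int k * \<alpha> - of_int h)"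
    by (simp_all add: weight_def algebra_simps)
  have "weight (- h) k \<noteq> 0" using weight_eq_0_iff[OF irr, of "- h" k] hk(1) by simp
  then show ?thesis using that[of "- h" k] that[of h "- k"] hk(2) N(2) w by linarith
qed

lemma leaf_value_regular:
  assumes "f \<in> \<A>"
  shows "continuous_on {\<zeta>. 0 \<le> Im \<zeta>} (leaf_value f)" "leaf_value f holomorphic_on {\<zeta>. 0 < Im \<zeta>}"
  using leaf_extension_regular[OF leaf_extension_leaf_value[OF assms]] by auto

lemma leaf_value_real: "f \<in> \<A> \<Longrightarrow> leaf_value f (of_real t) = f (cis t, cis (\<alpha> * t))"
  by (rule leaf_extension_leaf[OF leaf_extension_leaf_value])

lemma character_eq_torus_mean:
  assumes irr: "\<alpha> \<notin> \<rat>" and h: "character h" and 0: "\<And>m n. 0 < weight m n \<Longrightarrow> h (chi m n) = 0"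
    and f: "f \<in> \<A>"
  shows "h f = torus_mean f"
proof (rule bounded_functional_eqI[OF _ _ _ f])
  show "bounded_functional 1 h" "bounded_functional 1 torus_mean"
    using h character_torus_mean[OF irr] by (auto simp: character_def)
  fix m n assume "0 \<le> weight m n"
  then consider "0 < weight m n" | "m = 0" "n = 0" using weight_eq_0_iff[OF irr, of m n] by linarith
  then show "h (chi m n) = torus_mean (chi m n)"
  proof cases
    case 1
    then have "\<not> (m = 0 \<and> n = 0)" by auto
    then show ?thesis using 0[OF 1] by (auto simp: torus_mean_chi)
  next
    case 2
    then show ?thesis using h by (simp add: character_def torus_mean_chi del: torus_char_0)
  qed
qed

text \<open>If the mean were moved to a point \<open>i y\<close> of a leaf, the inner function \<open>\<Phi>\<^sup>-\<^sup>1 z\<close> would be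
  divisible by arbitrarily high powers of functions vanishing at that point, hence vanish on the leaf.\<close>

lemma Aut_torus_mean:
  assumes \<alpha>: "0 < \<alpha>" and irr: "\<alpha> \<notin> \<rat>" and \<Phi>: "\<Phi> \<in> Aut \<alpha>" and f: "f \<in> \<A>"
  shows "torus_mean (\<Phi> f) = torus_mean f"
proof -
  define h where "h f = torus_mean (\<Phi> f)" for f
  have h: "character h" unfolding h_def[abs_def] by (rule character_Aut[OF character_torus_mean[OF irr] \<Phi>])
  obtain \<Psi> where \<Psi>: "\<Psi> \<in> Aut \<alpha>" "\<And>f. f \<in> \<A> \<Longrightarrow> \<Phi> (\<Psi> f) = f" "\<And>f. f \<in> \<A> \<Longrightarrow> \<Psi> (\<Phi> f) = f"
    using Aut_inverse[OF \<Phi>] by blast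
  have "h (chi m0 n0) = 0" if w0: "0 < weight m0 n0" for m0 n0
  proof (rule ccontr)
    assume "h (chi m0 n0) \<noteq> 0"
    then obtain x y where x: "x \<in> T2" and y: "0 \<le> y"
      and hv: "\<And>f. f \<in> \<A> \<Longrightarrow> h f = leaf_value (pi_c x f) (\<i> * of_real y)"
      using character_classification[OF \<alpha> h _ w0] by metis
    \<comment> \<open>Preimages of the characters, unimodular on the torus; \<open>V\<close>
      continues them over the leaf through \<open>x\<close>.\<close>
    define v where "v m n = \<Psi> (chi m n)" for m n
    define V where "V m n = leaf_value (pi_c x (v m n))" for m n
    have vA: "v m n \<in> \<A>" if "0 \<le> weight m n" for m n
      unfolding v_def by (rule Aut_closed[OF \<Psi>(1) chi_in_Aalpha[OF that]])
    note pA = pi_c_in_Aalpha[OF x vA]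
    have chV: "character (\<lambda>f. leaf_value (pi_c x (\<Psi> f)) \<zeta>)" if "0 \<le> Im \<zeta>" for \<zeta>
      by (rule character_Aut[OF character_leaf_value_pi_c[OF x that] \<Psi>(1)])
    have Vadd: "V (m + m') (n + n') \<zeta> = V m n \<zeta> * V m' n' \<zeta>"
      if "0 \<le> weight m n" "0 \<le> weight m' n'" "0 \<le> Im \<zeta>" for m n m' n' \<zeta>
      using character_chi_add[OF chV[OF that(3)] that(1,2)] by (simp add: V_def v_def)
    have Vpow: "V (int N * m) (int N * n) \<zeta> = V m n \<zeta> ^ N"
      if "0 \<le> weight m n" "0 \<le> Im \<zeta>" for m n \<zeta> N
      using character_chi_power[OF chV[OF that(2)] that(1), of N] by (simp add: V_def v_def)
    have V1: "norm (V m n \<zeta>) \<le> 1" if "0 \<le> weight m n" "0 \<le> Im \<zeta>" for m n \<zeta>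
      using character_chi_norm_le[OF chV[OF that(2)] that(1)] by (simp add: V_def v_def)
    have V0: "norm (V m n 0) = 1" if "0 \<le> weight m n" for m n
    proof -
      have "V m n 0 = v m n x"
        using leaf_value_real[OF pA[OF that], of 0] by (simp add: V_def pi_c_eq on_T2_def)
      then show ?thesis using Aut_chi_norm[OF \<alpha> \<Psi>(1) that x] by (simp add: v_def)
    qed
    \<comment> \<open>Evaluation at this point is the mean after \<open>\<Phi>\<close>, and
      \<open>\<Phi>\<close> undoes \<open>\<Psi>\<close>; a character of positive weight has mean
      0.\<close>
    have Va: "V m n (\<i> * of_real y) = 0" if "0 < weight m n" for m n
    proof -
      have "V m n (\<i> * of_real y) = torus_mean (chi m n)"
        using hv[of "v m n"] vA that \<Psi>(2)[OF chi_in_Aalpha] by (simp add: V_def h_def v_def)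
      also have "\<dots> = 0" using that by (auto simp: torus_mean_chi)
      finally show ?thesis .
    qed
    have w10: "0 < weight 1 0" "0 \<le> weight 1 0" by (auto simp: weight_def)
    show False
    proof (cases "y = 0")
      \<comment> \<open>Height 0 is the point \<open>x\<close> of the torus itself, where the
        preimages are unimodular.\<close>
      case True
      then show False using Va[OF w10(1)] V0[OF w10(2)] by simp
    next
      case False
      then have a: "0 < Im (\<i> * of_real y)" using y by simp
      have Vz: "V 1 0 \<zeta> = 0" if z: "0 < Im \<zeta>" for \<zeta>
      proof -
        define \<rho> where "\<rho> = norm ((\<zeta> - \<i> * of_real y) / (\<zeta> - cnj (\<i> * of_real y)))"
        have \<rho>: "0 \<le> \<rho>" "\<rho> < 1" unfolding \<rho>_def using pseudo_hyperbolic_less_1[OF a z] by auto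
        have "norm (V 1 0 \<zeta>) \<le> \<rho> ^ N" for N :: nat
        proof -
          \<comment> \<open>\<open>chi 1 0\<close> has weight 1, so with a weight below
            \<open>1 / (N + 1)\<close> the \<open>N\<close>-th power of \<open>chi m n\<close>
            divides it; \<open>Suc N\<close> keeps the bound meaningful for
            \<open>N = 0\<close>.\<close>
          obtain m n where w: "0 < weight m n" "weight m n < 1 / real (Suc N)"
            using small_positive_weight[OF irr, of "1 / real (Suc N)"] by auto
          have "real N * weight m n \<le> real (Suc N) * weight m n" using w by (intro mult_right_mono) auto
          also have "\<dots> \<le> 1" using w(2) by (simp add: field_simps del: of_nat_Suc)
          finally have "0 \<le> weight (1 - int N * m) (0 - int N * n)"
            by (simp add: weight_def algebra_simps)
          then have split: "V 1 0 \<zeta> = V m n \<zeta> ^ N * V (1 - int N * m) (0 - int N * n) \<zeta>"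
            using Vadd[of "int N * m" "int N * n" "1 - int N * m" "0 - int N * n" \<zeta>] Vpow[of m n \<zeta> N] w z
            by (simp add: weight_of_nat_mult)
          have rest: "norm (V (1 - int N * m) (0 - int N * n) \<zeta>) \<le> 1"
            by (rule V1) (use \<open>0 \<le> weight (1 - int N * m) (0 - int N * n)\<close> z in auto)
          have "norm (V m n \<zeta>) \<le> \<rho>"
            unfolding \<rho>_def
          proof (rule schwarz_pick_half_plane[OF _ _ _ a z])
            show "V m n holomorphic_on {z. 0 < Im z}"
              unfolding V_def using leaf_value_regular(2)[OF pA] w by simp
          qed (use w V1 Va in auto)
          have "norm (V 1 0 \<zeta>) \<le> norm (V m n \<zeta>) ^ N * 1"
            unfolding split norm_mult norm_power using rest by (rule mult_left_mono) simp
          also have "\<dots> \<le> \<rho> ^ N" using \<open>norm (V m n \<zeta>) \<le> \<rho>\<close> by (simp add: power_mono)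
          finally show ?thesis .
        qed
        moreover have "(\<lambda>N. \<rho> ^ N) \<longlonglongrightarrow> 0" using \<rho> by (rule LIMSEQ_realpow_zero)
        ultimately have "norm (V 1 0 \<zeta>) \<le> 0" by (intro LIMSEQ_le_const) auto
        then show ?thesis by simp
      qed
      \<comment> \<open>Vanishing on the open half-plane passes to the boundary point 0, where the
        modulus is 1.\<close>
      have "continuous_on {\<zeta>. 0 \<le> Im \<zeta>} (V 1 0)"
        unfolding V_def by (rule leaf_value_regular(1)[OF pA[OF w10(2)]])
      moreover have "(\<lambda>n. \<i> * of_real (inverse (real (Suc n)))) \<longlonglongrightarrow> \<i> * of_real 0"
        by (intro tendsto_intros LIMSEQ_inverse_real_of_nat)
      ultimately have "(\<lambda>n. V 1 0 (\<i> * of_real (inverse (real (Suc n))))) \<longlonglongrightarrow> V 1 0 (\<i> * of_real 0)"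
        by (rule continuous_on_tendsto_compose) (auto intro!: always_eventually)
      moreover have "V 1 0 (\<i> * of_real (inverse (real (Suc n)))) = 0" for n by (rule Vz) simp
      ultimately have "(\<lambda>n. 0) \<longlonglongrightarrow> V 1 0 0" by simp
      then have "V 1 0 0 = 0" using LIMSEQ_unique tendsto_const by blast
      then show False using V0[OF w10(2)] by simp
    qed
  qed
  then show ?thesis using character_eq_torus_mean[OF irr h _ f] by (simp add: h_def)
qed

section \<open>Recovering functions and frequencies from one leaf\<close>

text \<open>Times \<open>s + 2 * pi * k\<close> meet the first coordinate exactly, and density of
  the fractional parts of \<open>k * \<alpha>\<close> brings the second one to within
  \<open>2 * pi * d\<close> of \<open>r\<close>.\<close>

lemma leaf_dense:
  assumes irr: "\<alpha> \<notin> \<rat>" and f: "continuous_on T2 f" and g: "continuous_on T2 g"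
    and eq: "\<And>t. f (cis t, cis (\<alpha> * t)) = g (cis t, cis (\<alpha> * t))" and p: "p \<in> T2"
  shows "f p = (g p :: complex)"
proof -
  obtain s r where sr: "p = (cis s, cis r)" using T2_E[OF p] by metis
  have "\<exists>t d. cis t = cis s \<and> cis (\<alpha> * t) = cis (r + 2 * pi * d) \<and> \<bar>d\<bar> < inverse (real (Suc n))" for n
  proof -
    have n: "0 < inverse (real (Suc n))" by simp
    obtain h k where hk: "\<bar>of_int k * \<alpha> - of_int h - (r - \<alpha> * s) / (2 * pi)\<bar> < inverse (real (Suc n))"
      using sequence_of_fractional_parts_is_dense[OF irr n] by metis
    define d where "d = of_int k * \<alpha> - of_int h - (r - \<alpha> * s) / (2 * pi)"
    define t where "t = s + 2 * pi * of_int k"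
    have per: "cis (2 * pi * of_int j) = 1" for j :: int
      by (rule cis_multiple_2pi) simp
    have "cis t = cis s" unfolding t_def cis_mult[symmetric] per by simp
    moreover have "\<alpha> * t = (r + 2 * pi * d) + 2 * pi * of_int h"
      by (simp add: t_def d_def field_simps)
    then have "cis (\<alpha> * t) = cis (r + 2 * pi * d)" by (simp only: cis_mult[symmetric] per) simp
    ultimately show ?thesis using hk unfolding d_def[symmetric] by blast
  qed
  then obtain t d where t: "\<And>n. cis (t n) = cis s" "\<And>n. cis (\<alpha> * t n) = cis (r + 2 * pi * d n)"
    and d: "\<And>n. \<bar>d n\<bar> < inverse (real (Suc n))" by metis
  have "d \<longlonglongrightarrow> 0"
    by (rule Lim_null_comparison[OF _ LIMSEQ_inverse_real_of_nat]) (use d in \<open>auto intro!: always_eventually less_imp_le\<close>)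
  then have "(\<lambda>n. r + 2 * pi * d n) \<longlonglongrightarrow> r + 2 * pi * 0" by (intro tendsto_intros)
  then have "(\<lambda>n. cis (r + 2 * pi * d n)) \<longlonglongrightarrow> cis (r + 2 * pi * 0)"
    by (rule continuous_on_tendsto_compose[of UNIV cis, rotated])
      (auto intro: continuous_on_cis[OF continuous_on_id, unfolded id_def])
  then have lim: "(\<lambda>n. (cis (t n), cis (\<alpha> * t n))) \<longlonglongrightarrow> p"
    unfolding sr t by (intro tendsto_Pair) auto
  have "(\<lambda>n. f (cis (t n), cis (\<alpha> * t n))) \<longlonglongrightarrow> f p"
    by (rule continuous_on_tendsto_compose[OF f lim p]) simp
  moreover have "(\<lambda>n. f (cis (t n), cis (\<alpha> * t n))) \<longlonglongrightarrow> g p"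
    unfolding eq by (rule continuous_on_tendsto_compose[OF g lim p]) simp
  ultimately show ?thesis using LIMSEQ_unique by blast
qed

text \<open>A nonzero frequency difference \<open>b\<close> integrates to at most
  \<open>2 / \<bar>b\<bar>\<close> over any interval, so the integral stays bounded and its Bohr
  mean is 0.\<close>

lemma hardy_poly_mean_bounded:
  assumes "(h, H) \<in> hardy_poly" and a: "\<And>m n. 0 \<le> weight m n \<Longrightarrow> a \<noteq> weight m n"
  shows "\<exists>C. \<forall>T\<ge>0. norm (integral {0..T} (\<lambda>t. H (of_real t) * cis (- a * t))) \<le> C"
  using assms(1)
proof (induction rule: hardy_poly.induct)
  case (char m n c)
  define b where "b = weight m n - a"
  have b: "b \<noteq> 0" using a[OF char] by (simp add: b_def)
  have "norm (integral {0..T} (\<lambda>t. c * exp (\<i> * of_real (weight m n) * of_real t) * cis (- a * t))) \<le> norm c * (2 / \<bar>b\<bar>)"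
    if T: "0 \<le> T" for T
  proof -
    have "c * exp (\<i> * of_real (weight m n) * of_real t) * cis (- a * t) = c * exp (\<i> * of_real b * of_real t)" for t
      by (simp add: b_def cis_conv_exp exp_add[symmetric] algebra_simps)
    then have "integral {0..T} (\<lambda>t. c * exp (\<i> * of_real (weight m n) * of_real t) * cis (- a * t))
        = c * ((exp (\<i> * of_real b * of_real T) - 1) / (\<i> * of_real b))"
      using integral_exp[OF T, of "\<i> * of_real b"] b by (simp only: integral_mult_right) simp
    moreover have "norm (exp (\<i> * of_real b * of_real T) - 1) \<le> 2"
      using norm_triangle_ineq4[of "exp (\<i> * of_real b * of_real T)" 1] by simp
    ultimately show ?thesis using b
      by (simp add: norm_mult norm_divide mult_left_mono divide_right_mono del: times_divide_eq_right)
  qed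
  then show ?case by blast
next
  case (add f F g G)
  then obtain C D where
    "\<forall>T\<ge>0. norm (integral {0..T} (\<lambda>t. F (of_real t) * cis (- a * t))) \<le> C"
    "\<forall>T\<ge>0. norm (integral {0..T} (\<lambda>t. G (of_real t) * cis (- a * t))) \<le> D" by blast
  moreover have "(\<lambda>t. K (of_real t) * cis (- a * t)) integrable_on {0..T}" if "(k, K) \<in> hardy_poly" for k K T
  proof -
    have "continuous_on UNIV K" using hardy_poly_holomorphic[OF that] holomorphic_on_imp_continuous_on by blast
    then have "continuous_on {0..T} (\<lambda>t. K (of_real t))"
      by (rule continuous_on_compose2) (auto intro!: continuous_intros)
    then show ?thesis by (intro integrable_continuous_interval continuous_intros)
  qed
  then have "integral {0..T} (\<lambda>t. (F (of_real t) + G (of_real t)) * cis (- a * t))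
      = integral {0..T} (\<lambda>t. F (of_real t) * cis (- a * t)) + integral {0..T} (\<lambda>t. G (of_real t) * cis (- a * t))" for T
    using integral_add[of "\<lambda>t. F (of_real t) * cis (- a * t)" "{0..T}" "\<lambda>t. G (of_real t) * cis (- a * t)"] add.hyps
    by (simp add: distrib_right)
  ultimately have "\<forall>T\<ge>0. norm (integral {0..T} (\<lambda>t. (F (of_real t) + G (of_real t)) * cis (- a * t))) \<le> C + D"
    by (simp add: norm_triangle_mono)
  then show ?case by blast
qed

text \<open>If \<open>a\<close> were not an admissible weight, an approximant within 1/2 of
  \<open>f\<close> would have mean 0 against frequency \<open>a\<close>, whereas \<open>f\<close>
  has mean \<open>c\<close> of modulus 1.\<close>

lemma leaf_frequency:
  assumes f: "f \<in> \<A>" and c: "norm c = 1" and leaf: "\<And>t. f (cis t, cis (\<alpha> * t)) = c * cis (a * t)"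
  shows "\<exists>m n. 0 \<le> weight m n \<and> a = weight m n"
proof (rule ccontr)
  assume "\<not> (\<exists>m n. 0 \<le> weight m n \<and> a = weight m n)"
  then have a: "a \<noteq> weight m n" if "0 \<le> weight m n" for m n using that by blast
  obtain h H where h: "(h, H) \<in> hardy_poly" "\<And>p. p \<in> T2 \<Longrightarrow> norm (f p - h p) \<le> 1/2"
    using Aalpha_approx[OF f, of "1/2"] by auto
  obtain C where C: "\<forall>T\<ge>0. norm (integral {0..T} (\<lambda>t. H (of_real t) * cis (- a * t))) \<le> C"
    using hardy_poly_mean_bounded[OF h(1) a] by blast
  \<comment> \<open>Long enough to violate the inequality \<open>T \<le> T / 2 + C\<close> that
    closeness will give.\<close>
  define T where "T = 2 * (\<bar>C\<bar> + 1)"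
  have T: "0 \<le> T" by (simp add: T_def)
  have cH: "continuous_on {0..T} (\<lambda>t. H (of_real t))"
    by (rule continuous_on_compose2[of UNIV H])
      (auto intro!: continuous_intros holomorphic_on_imp_continuous_on hardy_poly_holomorphic[OF h(1)])
  have int: "(\<lambda>t. H (of_real t) * cis (- a * t)) integrable_on {0..T}"
    by (intro integrable_continuous_interval continuous_intros cH)
  have bound: "norm (c - H (of_real t) * cis (- a * t)) \<le> 1/2" for t
  proof -
    have "c - H (of_real t) * cis (- a * t) = (c * cis (a * t) - H (of_real t)) * cis (- a * t)"
      by (simp add: left_diff_distrib cis_mult mult.assoc)
    then have "norm (c - H (of_real t) * cis (- a * t)) = norm (c * cis (a * t) - H (of_real t))"
      by (simp add: norm_mult)
    also have "\<dots> \<le> 1/2" using h(2)[of "(cis t, cis (\<alpha> * t))"] leaf[of t] hardy_poly_leaf[OF h(1), of t] by simp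
    finally show ?thesis .
  qed
  have "norm (integral {0..T} (\<lambda>t. c - H (of_real t) * cis (- a * t))) \<le> 1/2 * (T - 0)"
    by (rule integral_bound[OF T]) (use bound in \<open>auto intro!: continuous_intros cH\<close>)
  moreover have "integral {0..T} (\<lambda>t. c - H (of_real t) * cis (- a * t)) = of_real T * c - integral {0..T} (\<lambda>t. H (of_real t) * cis (- a * t))"
    using integral_diff[OF integrable_const_ivl int, of c] T by (simp add: scaleR_conv_of_real)
  moreover have "norm (of_real T * c) = T" using c T by (simp add: norm_mult)
  moreover have "norm (integral {0..T} (\<lambda>t. H (of_real t) * cis (- a * t))) \<le> C" using C T by blast
  ultimately have "T \<le> 1/2 * T + C"
    using norm_triangle_ineq2[of "of_real T * c" "integral {0..T} (\<lambda>t. H (of_real t) * cis (- a * t))"] by simp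
  then have "T / 2 \<le> C" by linarith
  then have "\<bar>C\<bar> + 1 \<le> C" unfolding T_def by simp
  then show False by linarith
qed

lemma Aut_chi:
  assumes \<alpha>: "0 < \<alpha>" and irr: "\<alpha> \<notin> \<rat>" and \<Phi>: "\<Phi> \<in> Aut \<alpha>" and w: "0 \<le> weight m n"
  shows "\<exists>c m' n'. norm c = 1 \<and> (\<forall>p\<in>T2. \<Phi> (chi m n) p = c * torus_char m' n' p)"
proof (cases "weight m n = 0")
  case True
  then have "m = 0" "n = 0" using weight_eq_0_iff[OF irr] by blast+
  then have "\<Phi> (chi m n) p = 1 * torus_char 0 0 p" if "p \<in> T2" for p
    using Aut_chi_0[OF \<Phi>] that by (simp add: on_T2_def)
  then show ?thesis by (intro exI[of _ 1] exI[of _ 0]) simp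
next
  case False
  then have w': "0 < weight m n" using w by simp
  define u where "u = \<Phi> (chi m n)"
  have uA: "u \<in> \<A>" unfolding u_def by (rule Aut_closed[OF \<Phi> chi_in_Aalpha[OF w]])
  have u1: "norm (u p) = 1" if "p \<in> T2" for p unfolding u_def by (rule Aut_chi_norm[OF \<alpha> \<Phi> w that])
  obtain \<Psi> where \<Psi>: "\<Psi> \<in> Aut \<alpha>" "\<And>f. f \<in> \<A> \<Longrightarrow> \<Phi> (\<Psi> f) = f" "\<And>f. f \<in> \<A> \<Longrightarrow> \<Psi> (\<Phi> f) = f"
    using Aut_inverse[OF \<Phi>] by blast
  have w10: "0 \<le> weight 1 0" by (simp add: weight_def)
  \<comment> \<open>A zero at \<open>\<zeta>\<close> makes evaluation there, composed with
    \<open>\<Phi>\<close>, kill all characters of positive weight, so it is the mean. Since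
    \<open>\<Psi>\<close> preserves the mean, \<open>chi 1 0\<close> would then vanish at
    \<open>\<zeta>\<close>, but its value there is \<open>exp (\<i> * \<zeta>)\<close>.\<close>
  have nz: "leaf_value u \<zeta> \<noteq> 0" if z: "0 < Im \<zeta>" for \<zeta>
  proof
    assume 0: "leaf_value u \<zeta> = 0"
    define k where "k f = leaf_value (\<Phi> f) \<zeta>" for f
    have k: "character k"
      unfolding k_def[abs_def] using z by (intro character_Aut[OF character_leaf_value \<Phi>]) simp
    have "k (chi m n) = 0" using 0 by (simp add: k_def u_def)
    then have "k (chi m' n') = 0" if "0 < weight m' n'" for m' n'
      using character_chi_vanishing[OF k _ w that] by blast
    then have "k (\<Psi> (chi 1 0)) = torus_mean (\<Psi> (chi 1 0))"
      by (intro character_eq_torus_mean[OF irr k] Aut_closed[OF \<Psi>(1) chi_in_Aalpha[OF w10]])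
    also have "\<dots> = 0"
      unfolding Aut_torus_mean[OF \<alpha> irr \<Psi>(1) chi_in_Aalpha[OF w10]] by (simp add: torus_mean_chi)
    finally have "leaf_value (chi 1 0) \<zeta> = 0" using \<Psi>(2)[OF chi_in_Aalpha[OF w10]] by (simp add: k_def)
    then show False using leaf_value_chi[OF w10, of \<zeta>] z by simp
  qed
  have "\<exists>a. \<forall>t::real. leaf_value u (of_real t) = leaf_value u 0 * cis (a * t)"
  proof (rule zero_free_inner_half_plane[OF leaf_value_regular[OF uA] _ _ nz])
    show "norm (leaf_value u z) \<le> 1" if "0 \<le> Im z" for z
      using leaf_value_norm_le[OF uA _ that, of 1] u1 by simp
    show "norm (leaf_value u (of_real t)) = 1" for t
      unfolding leaf_value_real[OF uA] by (rule u1) simp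
    fix a assume "\<And>t::real. leaf_value u (of_real t) = leaf_value u 0 * cis (a * t)"
    then show "\<exists>a. \<forall>t::real. leaf_value u (of_real t) = leaf_value u 0 * cis (a * t)" by blast
  qed
  then obtain a where a: "\<And>t::real. leaf_value u (of_real t) = leaf_value u 0 * cis (a * t)" by blast
  define c where "c = leaf_value u 0"
  have c: "norm c = 1" using leaf_value_real[OF uA, of 0] u1[of "(1, 1)"] by (simp add: c_def)
  have leaf: "u (cis t, cis (\<alpha> * t)) = c * cis (a * t)" for t
    using a[of t] leaf_value_real[OF uA, of t] by (simp add: c_def)
  obtain m' n' where mn: "a = weight m' n'" using leaf_frequency[OF uA c leaf] by metis
  have "u p = c * torus_char m' n' p" if "p \<in> T2" for p
  proof (rule leaf_dense[OF irr _ _ _ that])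
    show "u (cis t, cis (\<alpha> * t)) = c * torus_char m' n' (cis t, cis (\<alpha> * t))" for t
      unfolding leaf mn by (simp add: torus_char_cis weight_def algebra_simps)
  qed (intro continuous_intros Aalpha_continuous[OF uA])+
  then show ?thesis using c unfolding u_def by blast
qed

section \<open>Affine actions on the torus\<close>

definition T2_mult :: "complex \<times> complex \<Rightarrow> complex \<times> complex \<Rightarrow> complex \<times> complex" where
  "T2_mult c d = (fst c * fst d, snd c * snd d)"

lemma T2_mult_assoc: "T2_mult (T2_mult a b) c = T2_mult a (T2_mult b c)"
  by (simp add: T2_mult_def mult.assoc)

lemma T2_mult_commute: "T2_mult a b = T2_mult b a"
  by (simp add: T2_mult_def mult.commute)

lemma T2_mult_one [simp]: "T2_mult (1, 1) a = a" "T2_mult a (1, 1) = a"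
  by (simp_all add: T2_mult_def)

lemma T2_mult_in [simp]: "a \<in> T2 \<Longrightarrow> b \<in> T2 \<Longrightarrow> T2_mult a b \<in> T2"
  by (simp add: T2_mult_def T2_mult_closed)

lemma T2_inverse: "a \<in> T2 \<Longrightarrow> \<exists>b\<in>T2. T2_mult b a = (1, 1)"
  by (intro bexI[of _ "(inverse (fst a), inverse (snd a))"])
    (use fst_snd_nz_T2[of a] in \<open>auto simp: T2_mult_def mem_T2_iff norm_inverse\<close>)

lemma torus_char_T2_mult: "torus_char m n (T2_mult c p) = torus_char m n c * torus_char m n p"
  by (simp add: T2_mult_def torus_char_mult)

lemma mat_map_eq_torus_char: "mat_map A p = (torus_char (A$1$1) (A$1$2) p, torus_char (A$2$1) (A$2$2) p)"
  by (simp add: mat_map_def torus_char_def)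

lemma mat_map_in_T2 [simp]: "p \<in> T2 \<Longrightarrow> mat_map A p \<in> T2"
  by (simp add: mat_map_eq_torus_char mem_T2_iff[of "(_, _)"] norm_torus_char)

lemma mat_map_T2_mult: "mat_map A (T2_mult c p) = T2_mult (mat_map A c) (mat_map A p)"
  by (simp add: mat_map_eq_torus_char torus_char_T2_mult) (simp add: T2_mult_def)

lemma mat_map_one [simp]: "mat_map A (1, 1) = (1, 1)"
  by (simp add: mat_map_def)

lemma mat_map_mat_1 [simp]: "mat_map (mat 1) p = p"
  by (simp add: mat_map_def mat2_one)

lemma torus_char_mat_map:
  assumes "p \<in> T2"
  shows "torus_char m n (mat_map A p) = torus_char (m * A$1$1 + n * A$2$1) (m * A$1$2 + n * A$2$2) p"
  by (rule T2_E[OF assms]) (simp add: mat_map_eq_torus_char torus_char_cis algebra_simps)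

lemma mat_map_mult: "p \<in> T2 \<Longrightarrow> mat_map A (mat_map B p) = mat_map (A ** B) p"
  by (simp add: mat_map_eq_torus_char[of A] mat_map_eq_torus_char[of "A ** B"] torus_char_mat_map mat2_mult)

lemma continuous_on_mat_map: "continuous_on T2 (mat_map A)"
  unfolding mat_map_eq_torus_char[abs_def] by (intro continuous_intros)

text \<open>\<open>affine_action x A\<close> is \<open>\<pi>(A)\<close> followed by \<open>\<pi>(x')\<close> where \<open>x'\<close> is the preimage of \<open>x\<close> under \<open>\<psi>\<^sub>A\<close>;
  translating after applying \<open>A\<close> keeps the composition law free of inverses.\<close>

definition affine_action :: "complex \<times> complex \<Rightarrow> int^2^2 \<Rightarrow> (complex \<times> complex \<Rightarrow> complex) \<Rightarrow> complex \<times> complex \<Rightarrow> complex" where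
  "affine_action x A f = on_T2 (\<lambda>p. f (T2_mult x (mat_map A p)))"

text \<open>Substitutions compose contravariantly, hence the order \<open>B ** A\<close>.\<close>

lemma affine_action_compose:
  assumes "x \<in> T2"
  shows "affine_action x A (affine_action y B f) = affine_action (T2_mult y (mat_map B x)) (B ** A) f"
  by (rule ext) (use assms in \<open>simp add: affine_action_def on_T2_def mat_map_T2_mult mat_map_mult T2_mult_assoc\<close>)

lemma affine_action_id: "f \<in> \<A> \<Longrightarrow> affine_action (1, 1) (mat 1) f = f"
  by (rule ext) (auto simp: affine_action_def on_T2_def dest: Aalpha_outside)

lemma pi_c_eq_affine_action: "pi_c c = affine_action c (mat 1)"
  by (rule ext) (simp add: affine_action_def pi_c_eq T2_mult_def)

lemma pi_A_eq_affine_action: "pi_A A = affine_action (1, 1) A"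
  by (intro ext) (simp add: affine_action_def pi_A_def on_T2_def)

lemma weight_cone_stabilizer:
  assumes "A \<in> cone_stabilizer"
  shows "weight (m * A$1$1 + n * A$2$1) (m * A$1$2 + n * A$2$2) = eigval A * weight m n"
proof -
  have "weight (m * A$1$1 + n * A$2$1) (m * A$1$2 + n * A$2$2)
      = of_int m * eigval A + of_int n * (of_int (A$2$1) + \<alpha> * of_int (A$2$2))"
    by (simp add: weight_def eigval_def algebra_simps)
  also have "of_int (A$2$1) + \<alpha> * of_int (A$2$2) = eigval A * \<alpha>" using assms by (simp add: cone_stabilizer_def)
  finally show ?thesis by (simp add: weight_def algebra_simps)
qed

lemma affine_action_in_Aalpha:
  assumes x: "x \<in> T2" and A: "A \<in> cone_stabilizer" and f: "f \<in> \<A>"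
  shows "affine_action x A f \<in> \<A>"
  unfolding affine_action_def
proof (rule Aalpha_compose[OF _ _ _ f])
  fix m n assume w: "0 \<le> weight m n"
  have "0 < eigval A" using A by (simp add: cone_stabilizer_def)
  then have "0 \<le> weight (m * A$1$1 + n * A$2$1) (m * A$1$2 + n * A$2$2)"
    using w by (simp add: weight_cone_stabilizer[OF A])
  moreover have "\<forall>p\<in>T2. torus_char m n (T2_mult x (mat_map A p))
      = torus_char m n x * torus_char (m * A$1$1 + n * A$2$1) (m * A$1$2 + n * A$2$2) p"
    by (simp add: torus_char_T2_mult torus_char_mat_map)
  ultimately show "\<exists>c m' n'. 0 \<le> weight m' n' \<and> (\<forall>p\<in>T2. torus_char m n (T2_mult x (mat_map A p)) = c * torus_char m' n' p)"
    by blast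
next
  show "continuous_on T2 (\<lambda>p. T2_mult x (mat_map A p))"
    unfolding T2_mult_def by (intro continuous_intros continuous_on_mat_map)
qed (use x in simp)

lemma affine_action_norm_le:
  assumes "x \<in> T2" "\<forall>p\<in>T2. norm (f p) \<le> B"
  shows "\<forall>p\<in>T2. norm (affine_action x A f p) \<le> B"
  using assms by (simp add: affine_action_def on_T2_def)

lemma affine_action_inverse:
  assumes x: "x \<in> T2" and A: "A \<in> cone_stabilizer"
  obtains y B where "y \<in> T2" "B \<in> cone_stabilizer"
    "\<And>f. f \<in> \<A> \<Longrightarrow> affine_action x A (affine_action y B f) = f"
    "\<And>f. f \<in> \<A> \<Longrightarrow> affine_action y B (affine_action x A f) = f"
proof -
  obtain B where B: "B \<in> cone_stabilizer" "A ** B = mat 1" "B ** A = mat 1" "eigval B = 1 / eigval A"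
    by (rule cone_stabilizer_inverse[OF A])
  obtain y where y: "y \<in> T2" "T2_mult y (mat_map B x) = (1, 1)" using T2_inverse[of "mat_map B x"] x by auto
  have "mat_map A (T2_mult y (mat_map B x)) = (1, 1)" unfolding y(2) by simp
  then have "T2_mult x (mat_map A y) = (1, 1)"
    using x by (simp add: mat_map_T2_mult mat_map_mult B T2_mult_commute)
  then show ?thesis using that[OF y(1) B(1)] x y B by (simp add: affine_action_compose affine_action_id)
qed

lemma affine_action_Aut:
  assumes x: "x \<in> T2" and A: "A \<in> cone_stabilizer"
  shows "restrict (affine_action x A) \<A> \<in> Aut \<alpha>"
proof -
  obtain y B where y: "y \<in> T2" and B: "B \<in> cone_stabilizer"
    and inv: "\<And>f. f \<in> \<A> \<Longrightarrow> affine_action x A (affine_action y B f) = f"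
      "\<And>f. f \<in> \<A> \<Longrightarrow> affine_action y B (affine_action x A f) = f"
    using affine_action_inverse[OF x A] by metis
  note cl = affine_action_in_Aalpha[OF x A] and cl' = affine_action_in_Aalpha[OF y B]
  have "bij_betw (affine_action x A) \<A> \<A>"
    by (rule bij_betw_byWitness[where f' = "affine_action y B"]) (use inv cl cl' in auto)
  then have bij: "bij_betw (restrict (affine_action x A) \<A>) \<A> \<A>"
    by (simp cong: bij_betw_cong)
  \<comment> \<open>The action and its inverse are both contractive, so \<open>f\<close> and its
    image have the same upper bounds.\<close>
  have norm: "supnorm (affine_action x A f) = supnorm f" if f: "f \<in> \<A>" for f
  proof -
    have "supnorm (affine_action x A f) \<le> C \<longleftrightarrow> supnorm f \<le> C" for C
      unfolding supnorm_le_iff[OF Aalpha_CT2[OF f]] supnorm_le_iff[OF Aalpha_CT2[OF cl[OF f]]]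
      using affine_action_norm_le[OF x, of f C A] affine_action_norm_le[OF y, of "affine_action x A f" C B] inv(2)[OF f]
      by auto
    then show ?thesis by (meson order_antisym order_refl)
  qed
  show ?thesis
    unfolding Aut_def
  proof (intro CollectI conjI ballI allI)
    fix f assume f: "f \<in> \<A>"
    show "supnorm (restrict (affine_action x A) \<A> f) = supnorm f" using norm f by simp
    show "restrict (affine_action x A) \<A> (\<lambda>p. a * f p) = (\<lambda>p. a * restrict (affine_action x A) \<A> f p)" for a
      using f Aalpha_scale[OF f] by (auto simp: affine_action_def on_T2_def)
    fix g assume g: "g \<in> \<A>"
    show "restrict (affine_action x A) \<A> (\<lambda>p. f p + g p) = (\<lambda>p. restrict (affine_action x A) \<A> f p + restrict (affine_action x A) \<A> g p)"
      using f g Aalpha_add[OF f g] by (auto simp: affine_action_def on_T2_def)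
    show "restrict (affine_action x A) \<A> (\<lambda>p. f p * g p) = (\<lambda>p. restrict (affine_action x A) \<A> f p * restrict (affine_action x A) \<A> g p)"
      using f g Aalpha_mult[OF f g] by (auto simp: affine_action_def on_T2_def)
  qed (use bij in simp_all)
qed

lemma torus_char_multiple_unique:
  assumes eq: "\<And>p. p \<in> T2 \<Longrightarrow> c * torus_char m n p = c' * torus_char m' n' p" and c: "c \<noteq> 0"
  shows "m = m' \<and> n = n' \<and> c = c'"
proof -
  have "fourier (\<lambda>p. c * torus_char m n p) m n = fourier (\<lambda>p. c' * torus_char m' n' p) m n"
    by (rule fourier_cong) (rule eq)
  then have "c = c' * (if m' = m \<and> n' = n then 1 else 0)"
    by (simp add: fourier_mult_left fourier_torus_char)
  then show ?thesis using c by (auto split: if_splits)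
qed

lemma affine_action_chi:
  assumes "p \<in> T2" "x \<in> T2"
  shows "affine_action x A (chi m n) p = torus_char m n x * torus_char (m * A$1$1 + n * A$2$1) (m * A$1$2 + n * A$2$2) p"
  using assms by (simp add: affine_action_def on_T2_def torus_char_T2_mult torus_char_mat_map)

lemma affine_action_unique:
  assumes \<alpha>: "0 < \<alpha>" and x: "x \<in> T2" and y: "y \<in> T2"
    and eq: "\<And>f. f \<in> \<A> \<Longrightarrow> affine_action x A f = affine_action y B f"
  shows "x = y \<and> A = B"
proof -
  have w: "0 \<le> weight 1 0" "0 \<le> weight 0 1" using \<alpha> by (auto simp: weight_def)
  have nz: "torus_char m n x \<noteq> 0" for m n using norm_torus_char[OF x, of m n] by auto
  have 1: "torus_char m n x * torus_char (m * A$1$1 + n * A$2$1) (m * A$1$2 + n * A$2$2) p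
      = torus_char m n y * torus_char (m * B$1$1 + n * B$2$1) (m * B$1$2 + n * B$2$2) p" if "0 \<le> weight m n" "p \<in> T2" for m n p
    using eq[OF chi_in_Aalpha[OF that(1)]] affine_action_chi[OF that(2)] x y by metis
  show ?thesis
    using torus_char_multiple_unique[OF 1[OF w(1)] nz] torus_char_multiple_unique[OF 1[OF w(2)] nz]
    by (auto simp: mat2_eq_iff prod_eq_iff torus_char_def)
qed

text \<open>The images of the two coordinate characters supply the rows of the matrix and the
  translation. It is applied to an automorphism and to its inverse, and comparing the two matrices
  yields invertibility.\<close>

lemma Aut_matrix:
  assumes \<alpha>: "0 < \<alpha>" and irr: "\<alpha> \<notin> \<rat>" and \<Phi>: "\<Phi> \<in> Aut \<alpha>"
  shows "\<exists>x\<in>T2. \<exists>A. \<forall>m n p. 0 \<le> weight m n \<longrightarrow> p \<in> T2 \<longrightarrow> \<Phi> (chi m n) p = torus_char m n (T2_mult x (mat_map A p))"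
proof -
  have w: "0 \<le> weight 1 0" "0 \<le> weight 0 1" using \<alpha> by (auto simp: weight_def)
  obtain c1 a b where 1: "norm c1 = 1" "\<And>p. p \<in> T2 \<Longrightarrow> \<Phi> (chi 1 0) p = c1 * torus_char a b p"
    using Aut_chi[OF \<alpha> irr \<Phi> w(1)] by blast
  obtain c2 c d where 2: "norm c2 = 1" "\<And>p. p \<in> T2 \<Longrightarrow> \<Phi> (chi 0 1) p = c2 * torus_char c d p"
    using Aut_chi[OF \<alpha> irr \<Phi> w(2)] by blast
  define A :: "int^2^2" where "A = (\<chi> i j. if i = 1 then (if j = 1 then a else b) else (if j = 1 then c else d))"
  have A: "A$1$1 = a" "A$1$2 = b" "A$2$1 = c" "A$2$2 = d" by (simp_all add: A_def)
  define x where "x = (c1, c2)"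
  have x: "x \<in> T2" using 1 2 by (simp add: x_def mem_T2_iff)
  have "\<Phi> (chi m n) p = torus_char m n (T2_mult x (mat_map A p))" if mn: "0 \<le> weight m n" and p: "p \<in> T2" for m n p
  proof -
    have "\<Phi> (chi m n) p = \<Phi> (chi 1 0) p powi m * \<Phi> (chi 0 1) p powi n"
    proof (rule half_plane_hom_powi[where H = "\<lambda>m n. \<Phi> (chi m n) p", OF \<alpha> _ _ _ _ mn])
      show "\<Phi> (chi (m + m') (n + n')) p = \<Phi> (chi m n) p * \<Phi> (chi m' n') p"
        if "0 \<le> weight m n" "0 \<le> weight m' n'" for m n m' n'
        using Aut_mult[OF \<Phi> chi_in_Aalpha[OF that(1)] chi_in_Aalpha[OF that(2)]] by (simp add: chi_mult)
      show "\<Phi> (chi 0 0) p = 1" using Aut_chi_0[OF \<Phi>] p by (simp add: on_T2_def)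
      show "\<Phi> (chi 1 0) p \<noteq> 0" "\<Phi> (chi 0 1) p \<noteq> 0" using Aut_chi_norm[OF \<alpha> \<Phi> _ p] w by force+
    qed
    also have "\<dots> = torus_char m n (T2_mult x (mat_map A p))"
      using 1(2)[OF p] 2(2)[OF p] by (simp add: torus_char_def[of m n] T2_mult_def x_def mat_map_eq_torus_char A)
    finally show ?thesis .
  qed
  then show ?thesis using x by blast
qed

lemma Aut_affine:
  assumes \<alpha>: "0 < \<alpha>" and irr: "\<alpha> \<notin> \<rat>" and \<Phi>: "\<Phi> \<in> Aut \<alpha>"
  shows "\<exists>x\<in>T2. \<exists>A\<in>cone_stabilizer. \<Phi> = restrict (affine_action x A) \<A>"
proof -
  have w: "0 \<le> weight 1 0" "0 \<le> weight 0 1" using \<alpha> by (auto simp: weight_def)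
  obtain x A where x: "x \<in> T2"
    and A: "\<And>m n p. 0 \<le> weight m n \<Longrightarrow> p \<in> T2 \<Longrightarrow> \<Phi> (chi m n) p = torus_char m n (T2_mult x (mat_map A p))"
    using Aut_matrix[OF \<alpha> irr \<Phi>] by blast
  have A': "\<Phi> (chi m n) p = torus_char m n x * torus_char (m * A$1$1 + n * A$2$1) (m * A$1$2 + n * A$2$2) p"
    if "0 \<le> weight m n" "p \<in> T2" for m n p
    using A[OF that] that by (simp add: torus_char_T2_mult torus_char_mat_map)
  \<comment> \<open>The image lies in the algebra and has a single frequency, which therefore cannot
    have negative weight.\<close>
  have wA: "0 \<le> weight (m * A$1$1 + n * A$2$1) (m * A$1$2 + n * A$2$2)" if mn: "0 \<le> weight m n" for m n
  proof (rule ccontr)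
    assume "\<not> ?thesis"
    then have "fourier (\<Phi> (chi m n)) (m * A$1$1 + n * A$2$1) (m * A$1$2 + n * A$2$2) = 0"
      using Aut_closed[OF \<Phi> chi_in_Aalpha[OF mn]] by (simp add: Aalpha_def weight_def)
    moreover have "fourier (\<Phi> (chi m n)) (m * A$1$1 + n * A$2$1) (m * A$1$2 + n * A$2$2) = torus_char m n x"
      using fourier_cong[OF A'[OF mn]] by (simp add: fourier_mult_left fourier_torus_char)
    ultimately show False using norm_torus_char[OF x, of m n] by simp
  qed
  \<comment> \<open>The weight of the transformed exponent is a linear form that is non-negative on
    the half-plane, hence a multiple of the weight: the eigenvector equation.\<close>
  have "of_int (A$2$1) + \<alpha> * of_int (A$2$2) = \<alpha> * eigval A"
    using wA by (intro nonneg_on_half_plane_imp_proportional[of "eigval A"])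
      (simp add: weight_def eigval_def algebra_simps)
  then have eig: "of_int (A$2$1) + \<alpha> * of_int (A$2$2) = eigval A * \<alpha>" by (simp add: mult.commute)
  obtain \<Psi> where \<Psi>: "\<Psi> \<in> Aut \<alpha>" "\<And>f. f \<in> \<A> \<Longrightarrow> \<Phi> (\<Psi> f) = f" using Aut_inverse[OF \<Phi>] by blast
  obtain y B where y: "y \<in> T2"
    and B: "\<And>m n p. 0 \<le> weight m n \<Longrightarrow> p \<in> T2 \<Longrightarrow> \<Psi> (chi m n) p = torus_char m n (T2_mult y (mat_map B p))"
    using Aut_matrix[OF \<alpha> irr \<Psi>(1)] by blast
  have \<Phi>eq: "\<Phi> f = affine_action x A f" if f: "f \<in> \<A>" for f
  proof
    fix p
    show "\<Phi> f p = affine_action x A f p"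
    proof (cases "p \<in> T2")
      case False
      then show ?thesis using Aalpha_outside[OF Aut_closed[OF \<Phi> f]] by (simp add: affine_action_def on_T2_def)
    next
      case p: True
      show ?thesis
      proof (rule bounded_functional_eqI[OF _ _ _ f])
        show "bounded_functional 1 (\<lambda>f. \<Phi> f p)"
          unfolding bounded_functional_def
          using Aut_norm_le_iff[OF \<Phi>] p by (auto simp: Aut_add[OF \<Phi>] Aut_scale[OF \<Phi>])
        show "bounded_functional 1 (\<lambda>f. affine_action x A f p)"
          unfolding bounded_functional_def using p x by (simp add: affine_action_def on_T2_def)
        show "\<Phi> (chi m n) p = affine_action x A (chi m n) p" if "0 \<le> weight m n" for m n
          using A[OF that p] p x by (simp add: affine_action_def on_T2_def)
      qed
    qed
  qed
  \<comment> \<open>\<open>\<Phi>\<close> after \<open>\<Psi>\<close> fixes each character;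
    comparing frequencies shows that the product matrix fixes the exponent.\<close>
  have row: "m * (B ** A)$1$1 + n * (B ** A)$2$1 = m \<and> m * (B ** A)$1$2 + n * (B ** A)$2$2 = n" if mn: "0 \<le> weight m n" for m n
  proof -
    have \<Psi>chi: "\<Psi> (chi m n) = affine_action y B (chi m n)"
    proof (rule ext)
      fix p show "\<Psi> (chi m n) p = affine_action y B (chi m n) p"
        using B[OF mn] Aalpha_outside[OF Aut_closed[OF \<Psi>(1) chi_in_Aalpha[OF mn]]] y
        by (cases "p \<in> T2") (auto simp: affine_action_def on_T2_def)
    qed
    have "chi m n = affine_action x A (affine_action y B (chi m n))"
      using \<Psi>(2)[OF chi_in_Aalpha[OF mn]] \<Phi>eq[OF Aut_closed[OF \<Psi>(1) chi_in_Aalpha[OF mn]]] \<Psi>chi by simp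
    also have "\<dots> = affine_action (T2_mult y (mat_map B x)) (B ** A) (chi m n)"
      by (rule affine_action_compose[OF x])
    finally have e: "chi m n = affine_action (T2_mult y (mat_map B x)) (B ** A) (chi m n)" .
    have "1 * torus_char m n p = torus_char m n (T2_mult y (mat_map B x))
        * torus_char (m * (B ** A)$1$1 + n * (B ** A)$2$1) (m * (B ** A)$1$2 + n * (B ** A)$2$2) p" if p: "p \<in> T2" for p
      using fun_cong[OF e, of p] affine_action_chi[OF p, of "T2_mult y (mat_map B x)" "B ** A" m n] x y p
      by (simp add: on_T2_def)
    then show ?thesis using torus_char_multiple_unique[of 1 m n] by force
  qed
  have "B ** A = mat 1" using row[OF w(1)] row[OF w(2)] by (simp add: mat2_eq_iff mat2_one)
  then have "det B * det A = 1" using det_mul[of B A] by simp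
  then have det: "det A = 1 \<or> det A = -1" using zmult_eq_1_iff by auto
  \<comment> \<open>Eigenvalue 0 would make the first row vanish, against the determinant.\<close>
  have "eigval A \<noteq> 0"
  proof
    assume "eigval A = 0"
    then have "A$1$1 = 0 \<and> A$1$2 = 0"
      using irrational_lin_indep[OF irr, of "A$1$1" "A$1$2" 0 0] by (simp add: eigval_def)
    then show False using det by (simp add: det_2)
  qed
  moreover have "0 \<le> eigval A" using wA[OF w(1)] by (simp add: eigval_def weight_def)
  ultimately have AS: "A \<in> cone_stabilizer" using det eig by (simp add: cone_stabilizer_def GL2Z_def)
  have "\<Phi> = restrict (affine_action x A) \<A>"
    by (rule extensionalityI[OF Aut_extensional[OF \<Phi>] restrict_extensional]) (simp add: \<Phi>eq)
  then show ?thesis using x AS by blast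
qed

text \<open>Negative powers in \<open>zpow\<close> go through \<open>inv_into S\<close>, which is a
  two-sided inverse only on \<open>S\<close>. Any action of the integers on \<open>S\<close> whose
  generator agrees with \<open>g\<close> computes them; this serves both the torus and the
  algebra.\<close>

lemma zpow_eqI:
  fixes G :: "int \<Rightarrow> 'a \<Rightarrow> 'a"
  assumes closed: "\<And>k x. x \<in> S \<Longrightarrow> G k x \<in> S"
    and add: "\<And>k l x. x \<in> S \<Longrightarrow> G (k + l) x = G k (G l x)"
    and zero: "\<And>x. x \<in> S \<Longrightarrow> G 0 x = x"
    and one: "\<And>x. x \<in> S \<Longrightarrow> g x = G 1 x"
    and x: "x \<in> S"
  shows "zpow S g k x = G k x"
proof -
  have pow: "(g ^^ n) x = G (int n) x" for n
  proof (induction n)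
    case (Suc n)
    have "(g ^^ Suc n) x = G 1 (G (int n) x)" using Suc one[OF closed[OF x]] by simp
    then show ?case using add[OF x, of 1 "int n"] by (simp add: add.commute)
  qed (simp add: zero x)
  have "inj_on g S"
  proof (rule inj_onI)
    fix u v assume "u \<in> S" "v \<in> S" "g u = g v"
    then have "G (-1) (G 1 u) = G (-1) (G 1 v)" using one by simp
    then show "u = v" using add[of u "-1" 1] add[of v "-1" 1] zero \<open>u \<in> S\<close> \<open>v \<in> S\<close> by simp
  qed
  then have inv: "inv_into S g u = G (-1) u" if "u \<in> S" for u
    by (rule inv_into_f_eq) (use that closed one add[of u 1 "-1"] zero in auto)
  have neg: "(inv_into S g ^^ n) x = G (- int n) x" for n
  proof (induction n)
    case (Suc n)
    have "(inv_into S g ^^ Suc n) x = G (-1) (G (- int n) x)" using Suc inv[OF closed[OF x]] by simp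
    then show ?case using add[OF x, of "-1" "- int n"] by (simp add: algebra_simps)
  qed (simp add: zero x)
  show ?thesis using pow[of "nat k"] neg[of "nat (- k)"] by (simp add: zpow_def)
qed

end

section \<open>The automorphism group\<close>

lemma Aut_eq_affine_actions:
  assumes "0 < \<alpha>" "\<alpha> \<notin> \<rat>"
  shows "Aut \<alpha> = {restrict (affine_action x A) (Aalpha \<alpha>) | x A. x \<in> T2 \<and> A \<in> cone_stabilizer \<alpha>}"
  using Aut_affine[OF assms] affine_action_Aut by blast

lemma restrict_affine_action_inject:
  assumes \<alpha>: "0 < \<alpha>" and x: "x \<in> T2" and y: "y \<in> T2"
    and eq: "restrict (affine_action x A) (Aalpha \<alpha>) = restrict (affine_action y B) (Aalpha \<alpha>)"
  shows "x = y \<and> A = B"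
proof (rule affine_action_unique[OF \<alpha> x y])
  fix f assume "f \<in> Aalpha \<alpha>"
  then show "affine_action x A f = affine_action y B f" using fun_cong[OF eq, of f] by simp
qed

lemma Aut_not_quadratic:
  assumes \<alpha>: "0 < \<alpha>" and irr: "\<alpha> \<notin> \<rat>" and nq: "\<not> quadratic_irrational \<alpha>"
  shows "Aut \<alpha> = (\<lambda>c. restrict (pi_c c) (Aalpha \<alpha>)) ` T2"
    and "bij_betw (\<lambda>c. restrict (pi_c c) (Aalpha \<alpha>)) T2 (Aut \<alpha>)"
proof -
  show 1: "Aut \<alpha> = (\<lambda>c. restrict (pi_c c) (Aalpha \<alpha>)) ` T2"
    unfolding Aut_eq_affine_actions[OF \<alpha> irr] cone_stabilizer_trivial[OF irr nq] pi_c_eq_affine_action by blast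
  have "inj_on (\<lambda>c. restrict (pi_c c) (Aalpha \<alpha>)) T2"
    unfolding pi_c_eq_affine_action by (rule inj_onI) (use restrict_affine_action_inject[OF \<alpha>] in blast)
  then show "bij_betw (\<lambda>c. restrict (pi_c c) (Aalpha \<alpha>)) T2 (Aut \<alpha>)"
    by (simp add: bij_betw_def 1)
qed

lemma restrict_pi_c_mult:
  assumes "c \<in> T2" "d \<in> T2"
  shows "restrict (pi_c (fst c * fst d, snd c * snd d)) (Aalpha \<alpha>)
       = restrict (restrict (pi_c c) (Aalpha \<alpha>) \<circ> restrict (pi_c d) (Aalpha \<alpha>)) (Aalpha \<alpha>)"
proof (rule restrict_ext)
  fix f assume f: "f \<in> Aalpha \<alpha>"
  have "pi_c (fst c * fst d, snd c * snd d) f = pi_c c (pi_c d f)"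
    unfolding pi_c_eq_affine_action affine_action_compose[OF assms(1)]
    by (simp add: T2_mult_def mult.commute)
  then show "pi_c (fst c * fst d, snd c * snd d) f = (restrict (pi_c c) (Aalpha \<alpha>) \<circ> restrict (pi_c d) (Aalpha \<alpha>)) f"
    using f pi_c_in_Aalpha[OF assms(2) f] by simp
qed

text \<open>The integral powers of \<open>A\<close> enter only through their eigenvalues \<open>\<lambda>\<^sup>k\<close>, which determine them.\<close>

locale cyclic_stabilizer =
  fixes \<alpha> :: real and A :: "int^2^2" and P :: "int \<Rightarrow> int^2^2"
  assumes \<alpha>: "0 < \<alpha>" and irr: "\<alpha> \<notin> \<rat>"
    and A: "A \<in> cone_stabilizer \<alpha>" and eigval_gt_1: "1 < eigval \<alpha> A"
    and P: "\<And>k. P k \<in> cone_stabilizer \<alpha>" "\<And>k. eigval \<alpha> (P k) = eigval \<alpha> A powi k"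
    and cyclic: "\<And>B. B \<in> cone_stabilizer \<alpha> \<Longrightarrow> \<exists>k::int. eigval \<alpha> B = eigval \<alpha> A powi k"
begin

lemma P_1: "P 1 = A"
  using P by (intro cone_stabilizer_eqI[OF irr _ A]) simp_all

lemma P_0: "P 0 = mat 1"
  using P by (intro cone_stabilizer_eqI[OF irr _ mat_1_in_cone_stabilizer]) (simp_all add: eigval_mat_1)

lemma P_add: "P (k + l) = P k ** P l"
  using P eigval_gt_1
  by (intro cone_stabilizer_eqI[OF irr]) (auto simp: cone_stabilizer_mult power_int_add)

lemma P_surj: "B \<in> cone_stabilizer \<alpha> \<Longrightarrow> \<exists>k. B = P k"
  using cyclic[of B] cone_stabilizer_eqI[OF irr _ P(1)] P(2) by metis

lemma P_inj: "P k = P l \<Longrightarrow> k = l"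
proof -
  assume "P k = P l"
  then have "eigval \<alpha> A powi k = eigval \<alpha> A powi l" using P(2) by metis
  then show "k = l"
    using power_int_strict_increasing[OF _ eigval_gt_1, of k l] power_int_strict_increasing[OF _ eigval_gt_1, of l k]
    by (cases k l rule: linorder_cases) auto
qed

lemma mat_map_P_add: "p \<in> T2 \<Longrightarrow> mat_map (P (k + l)) p = mat_map (P k) (mat_map (P l) p)"
  by (simp add: P_add mat_map_mult)

lemma mat_map_P_cancel: "p \<in> T2 \<Longrightarrow> mat_map (P k) (mat_map (P (- k)) p) = p"
  using mat_map_P_add[of p k "- k"] by (simp add: P_0)

lemma zpow_psi_A: "d \<in> T2 \<Longrightarrow> zpow T2 (psi_A A) k d = mat_map (P k) d"
  by (rule zpow_eqI) (auto simp: mat_map_P_add P_0 P_1 psi_A_def)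

lemma zpow_pi_A:
  assumes "f \<in> Aalpha \<alpha>"
  shows "zpow (Aalpha \<alpha>) (restrict (pi_A A) (Aalpha \<alpha>)) k f = affine_action (1, 1) (P k) f"
proof (rule zpow_eqI[where G = "\<lambda>k. affine_action (1, 1) (P k)", OF _ _ _ _ assms])
  show "affine_action (1, 1) (P (k + l)) f = affine_action (1, 1) (P k) (affine_action (1, 1) (P l) f)" for k l f
    by (simp add: affine_action_compose P_add[symmetric] add.commute)
qed (auto simp: affine_action_in_Aalpha P affine_action_id P_0 pi_A_eq_affine_action P_1)

lemma pi_c_zpow_pi_A:
  assumes "c \<in> T2" "f \<in> Aalpha \<alpha>"
  shows "pi_c c (zpow (Aalpha \<alpha>) (restrict (pi_A A) (Aalpha \<alpha>)) k f) = affine_action (mat_map (P k) c) (P k) f"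
  unfolding zpow_pi_A[OF assms(2)] pi_c_eq_affine_action affine_action_compose[OF assms(1)] by simp

lemma Aut_eq:
  "Aut \<alpha> = {restrict (\<lambda>f. pi_c c (zpow (Aalpha \<alpha>) (restrict (pi_A A) (Aalpha \<alpha>)) k f)) (Aalpha \<alpha>) | c k. c \<in> T2}"
proof -
  have eq: "restrict (\<lambda>f. pi_c c (zpow (Aalpha \<alpha>) (restrict (pi_A A) (Aalpha \<alpha>)) k f)) (Aalpha \<alpha>)
      = restrict (affine_action (mat_map (P k) c) (P k)) (Aalpha \<alpha>)" if "c \<in> T2" for c k
    by (rule restrict_ext) (rule pi_c_zpow_pi_A[OF that])
  have "\<exists>c k. restrict (affine_action x B) (Aalpha \<alpha>) = restrict (affine_action (mat_map (P k) c) (P k)) (Aalpha \<alpha>) \<and> c \<in> T2"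
    if x: "x \<in> T2" and B: "B \<in> cone_stabilizer \<alpha>" for x B
  proof -
    obtain k where "B = P k" using P_surj[OF B] by blast
    then show ?thesis using mat_map_P_cancel[OF x, of k] x
      by (intro exI[of _ "mat_map (P (- k)) x"] exI[of _ k]) simp
  qed
  then show ?thesis
    unfolding Aut_eq_affine_actions[OF \<alpha> irr] using eq P(1) mat_map_in_T2 by (smt (verit) Collect_cong)
qed

text \<open>The map \<open>(c, m) \<mapsto> \<pi>(c) \<pi>(A)\<close> to the power
  \<open>- m\<close>. Conjugating \<open>\<pi>(c)\<close> by \<open>\<pi>(A)\<close> gives the
  rotation by the preimage of \<open>c\<close> under \<open>psi_A A\<close>, so the negative power
  is the one that fits \<open>sd_mult\<close>.\<close>

definition iso :: "(complex \<times> complex) \<times> int \<Rightarrow> (complex \<times> complex \<Rightarrow> complex) \<Rightarrow> complex \<times> complex \<Rightarrow> complex" where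
  "iso x = restrict (affine_action (mat_map (P (- snd x)) (fst x)) (P (- snd x))) (Aalpha \<alpha>)"

lemma bij_betw_iso: "bij_betw iso (T2 \<times> UNIV) (Aut \<alpha>)"
  unfolding bij_betw_def
proof (intro conjI inj_onI equalityI subsetI)
  fix x y assume x: "x \<in> T2 \<times> (UNIV :: int set)" and y: "y \<in> T2 \<times> (UNIV :: int set)" and "iso x = iso y"
  then have e: "mat_map (P (- snd x)) (fst x) = mat_map (P (- snd y)) (fst y)" "P (- snd x) = P (- snd y)"
    using restrict_affine_action_inject[OF \<alpha>, of "mat_map (P (- snd x)) (fst x)" "mat_map (P (- snd y)) (fst y)"]
    by (auto simp: iso_def)
  from P_inj[OF e(2)] have s: "snd x = snd y" by simp
  have "fst x = mat_map (P (snd x)) (mat_map (P (- snd x)) (fst x))" using x mat_map_P_cancel by auto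
  also have "\<dots> = fst y" unfolding e(1) unfolding s using y mat_map_P_cancel by auto
  finally show "x = y" using s by (simp add: prod_eq_iff)
next
  fix \<Phi> assume "\<Phi> \<in> iso ` (T2 \<times> UNIV)"
  then show "\<Phi> \<in> Aut \<alpha>" by (auto simp: iso_def intro!: affine_action_Aut P)
next
  fix \<Phi> assume "\<Phi> \<in> Aut \<alpha>"
  then obtain x B where x: "x \<in> T2" and B: "B \<in> cone_stabilizer \<alpha>" and \<Phi>: "\<Phi> = restrict (affine_action x B) (Aalpha \<alpha>)"
    using Aut_affine[OF \<alpha> irr] by blast
  obtain k where k: "B = P k" using P_surj[OF B] by blast
  have "\<Phi> = iso (mat_map (P (- k)) x, - k)"
    unfolding \<Phi> k iso_def using mat_map_P_cancel[OF x, of k] by simp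
  then show "\<Phi> \<in> iso ` (T2 \<times> UNIV)" using x by auto
qed

lemma iso_sd_mult:
  assumes x: "x \<in> T2 \<times> UNIV" and y: "y \<in> T2 \<times> UNIV"
  shows "iso (sd_mult A x y) = restrict (iso x \<circ> iso y) (Aalpha \<alpha>)"
proof -
  obtain c m d n where xy: "x = (c, m)" "y = (d, n)" by (cases x, cases y)
  have c: "c \<in> T2" and d: "d \<in> T2" using x y by (auto simp: xy)
  have sd: "sd_mult A x y = (T2_mult c (mat_map (P m) d), m + n)"
    by (simp add: sd_mult_def xy zpow_psi_A[OF d] T2_mult_def Let_def)
  \<comment> \<open>The twist \<open>P m\<close> on \<open>d\<close> cancels part of
    \<open>P (- (m + n))\<close> and leaves \<open>P (- n)\<close>, the translation that
    \<open>affine_action_compose\<close> expects.\<close>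
  have "mat_map (P (- (m + n))) (T2_mult c (mat_map (P m) d))
      = T2_mult (mat_map (P (- n)) d) (mat_map (P (- n)) (mat_map (P (- m)) c))"
    using c d by (simp add: mat_map_T2_mult mat_map_P_add[symmetric] T2_mult_commute algebra_simps)
  moreover have "P (- (m + n)) = P (- n) ** P (- m)" by (simp add: P_add[symmetric] add.commute)
  ultimately have "affine_action (mat_map (P (- (m + n))) (T2_mult c (mat_map (P m) d))) (P (- (m + n))) f
      = affine_action (mat_map (P (- m)) c) (P (- m)) (affine_action (mat_map (P (- n)) d) (P (- n)) f)" for f
    using c by (simp add: affine_action_compose)
  then show ?thesis
    unfolding sd by (intro ext) (simp add: iso_def xy restrict_def affine_action_in_Aalpha P c d)
qed

end

theorem mainTheorem13:
  fixes \<alpha> :: real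
  assumes "\<alpha> > 0" and "\<alpha> \<notin> \<rat>"
  shows "(\<not> quadratic_irrational \<alpha> \<longrightarrow>
            Aut \<alpha> = (\<lambda>c. restrict (pi_c c) (Aalpha \<alpha>)) ` T2
          \<and> bij_betw (\<lambda>c. restrict (pi_c c) (Aalpha \<alpha>)) T2 (Aut \<alpha>)
          \<and> (\<forall>c\<in>T2. \<forall>d\<in>T2.
               restrict (pi_c (fst c * fst d, snd c * snd d)) (Aalpha \<alpha>)
               = restrict (restrict (pi_c c) (Aalpha \<alpha>) \<circ> restrict (pi_c d) (Aalpha \<alpha>)) (Aalpha \<alpha>)))
       \<and> (quadratic_irrational \<alpha> \<longrightarrow>
          (\<exists>A\<in>GL2Z. A \<noteq> mat 1 \<and>
             Aut \<alpha> = {restrict (\<lambda>f. pi_c c (zpow (Aalpha \<alpha>) (restrict (pi_A A) (Aalpha \<alpha>)) k f)) (Aalpha \<alpha>)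
                       | c k. c \<in> T2}
           \<and> (\<exists>h. bij_betw h (T2 \<times> (UNIV :: int set)) (Aut \<alpha>)
                 \<and> (\<forall>x\<in>T2 \<times> UNIV. \<forall>y\<in>T2 \<times> UNIV.
                      h (sd_mult A x y) = restrict (h x \<circ> h y) (Aalpha \<alpha>)))))"
proof (intro conjI impI)
  assume nq: "\<not> quadratic_irrational \<alpha>"
  show "Aut \<alpha> = (\<lambda>c. restrict (pi_c c) (Aalpha \<alpha>)) ` T2"
    and "bij_betw (\<lambda>c. restrict (pi_c c) (Aalpha \<alpha>)) T2 (Aut \<alpha>)"
    using Aut_not_quadratic[OF assms nq] .
  show "\<forall>c\<in>T2. \<forall>d\<in>T2.
      restrict (pi_c (fst c * fst d, snd c * snd d)) (Aalpha \<alpha>)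
      = restrict (restrict (pi_c c) (Aalpha \<alpha>) \<circ> restrict (pi_c d) (Aalpha \<alpha>)) (Aalpha \<alpha>)"
    using restrict_pi_c_mult by blast
next
  assume "quadratic_irrational \<alpha>"
  then obtain A where cyc: "A \<in> cone_stabilizer \<alpha>" "1 < eigval \<alpha> A"
    "\<And>B. B \<in> cone_stabilizer \<alpha> \<Longrightarrow> \<exists>k::int. eigval \<alpha> B = eigval \<alpha> A powi k"
    using cone_stabilizer_cyclic by blast
  obtain P where P: "\<And>k::int. P k \<in> cone_stabilizer \<alpha>" "\<And>k. eigval \<alpha> (P k) = eigval \<alpha> A powi k"
    using cone_stabilizer_powi[OF cyc(1)] by metis
  interpret cyclic_stabilizer \<alpha> A P
    by unfold_locales (use assms cyc P in auto)
  have "A \<in> GL2Z" using cyc(1) by (simp add: cone_stabilizer_def)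
  moreover have "A \<noteq> mat 1" using cyc(2) eigval_mat_1 by auto
  ultimately show "\<exists>A\<in>GL2Z. A \<noteq> mat 1 \<and>
             Aut \<alpha> = {restrict (\<lambda>f. pi_c c (zpow (Aalpha \<alpha>) (restrict (pi_A A) (Aalpha \<alpha>)) k f)) (Aalpha \<alpha>)
                       | c k. c \<in> T2}
           \<and> (\<exists>h. bij_betw h (T2 \<times> (UNIV :: int set)) (Aut \<alpha>)
                 \<and> (\<forall>x\<in>T2 \<times> UNIV. \<forall>y\<in>T2 \<times> UNIV.
                      h (sd_mult A x y) = restrict (h x \<circ> h y) (Aalpha \<alpha>)))"
    using Aut_eq bij_betw_iso iso_sd_mult by blast
qed

end
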